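(* Let $n \ge 2$, let $P \in \mathbb{C}[X_1,\dots,X_n]$ be a non-constant reduced polynomial, and let $P=\prod_{i=1}^s P_i$ be its factorization into irreducible factors in $\mathbb{C}[X_1,\dots,X_n]$. Let $M(P)=\mathbb{C}^n\setminus V(P)$, let $F(P)$ be the complex vector space of tuples of polynomials defined in the context, and for $A=(A_1,\dots,A_n)\in F(P)$ let $\omega(A)=\sum_{i=1}^n \frac{A_i}{P}\,dX_i$, a closed $1$-form on $M(P)$. Then the linear map $$T: F(P)\longrightarrow H^1(M(P),\mathbb{C}),\qquad T(A)=[\omega(A)],$$ is an isomorphism. In particular, $\dim_{\mathbb{C}} F(P)=s$.
   Context: A polynomial is reduced if its irreducible factors are distinct (pairwise non-associate). $V(P)=\{x\in\mathbb{C}^n : P(x)=0\}$. $H^1(M(P),\mathbb{C})$ is the first de Rham cohomology group with complex coefficients of the smooth affine variety $M(P)$, and $[\omega]$ denotes the cohomology class of a closed $1$-form $\omega$. Let $m_i=\deg_{X_i}P$ be the degree of $P$ in the variable $X_i$. The multidegree of a polynomial $Q$ is $\operatorname{multideg}(Q)=(\deg_{X_1}Q,\dots,\deg_{X_n}Q)$, and inequalities between multidegrees are understood componentwise; the zero polynomial satisfies every degree bound, and a bound $\deg_{X_i}\le -1$ forces the polynomial to be zero. $F(P)$ is the $\mathbb{C}$-vector space of all $A=(A_1,\dots,A_n)\in\mathbb{C}[X_1,\dots,X_n]^n$ such that $$\frac{\partial}{\partial X_i}\left(\frac{A_j}{P}\right)-\frac{\partial}{\partial X_j}\left(\frac{A_i}{P}\right)=0\quad\text{for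 all } 1\le i<j\le n,$$ and $$\operatorname{multideg}(A_i)\le (m_1,\dots,m_{i-1},m_i-1,m_{i+1},\dots,m_n)\quad\text{for all } i=1,\dots,n.$$ The first set of conditions says exactly that $\omega(A)$ is closed. *)

theory Defs
  imports
    "HOL-Analysis.Analysis"
    "HOL-Library.Poly_Mapping"
    "HOL-Computational_Algebra.Fraction_Field"
    "HOL-Computational_Algebra.Factorial_Ring"
begin

section \<open>Polynomials and rational functions in finitely many variables over the complex numbers\<close>

text \<open>
  The variables are indexed by a finite linearly ordered type. The order plays the role of the
  order of \<open>X\<^sub>1, \<dots>, X\<^sub>n\<close>; it is also what the library uses to show that the polynomials form an
  integral domain. A monomial is a finitely supported exponent function.
\<close>

type_synonym 'n mpoly = "('n \<Rightarrow>\<^sub>0 nat) \<Rightarrow>\<^sub>0 complex"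

abbreviation mpoly_const :: "complex \<Rightarrow> 'n mpoly" where
  "mpoly_const \<equiv> Poly_Mapping.single 0"

definition mpoly_eval :: "'n::finite mpoly \<Rightarrow> complex ^ 'n \<Rightarrow> complex" where
  "mpoly_eval p x = (\<Sum>m\<in>Poly_Mapping.keys p.
     Poly_Mapping.lookup p m * (\<Prod>i\<in>UNIV. (x $ i) ^ Poly_Mapping.lookup m i))"

definition mpoly_deg :: "'n \<Rightarrow> 'n mpoly \<Rightarrow> nat" where
  "mpoly_deg i p = Max (insert 0 ((\<lambda>m. Poly_Mapping.lookup m i) ` Poly_Mapping.keys p))"

text \<open>The bound is an integer, so that a bound of \<open>-1\<close> is satisfied by the zero polynomial only.\<close>

definition mpoly_deg_le :: "'n \<Rightarrow> 'n mpoly \<Rightarrow> int \<Rightarrow> bool" where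
  "mpoly_deg_le i p d \<longleftrightarrow> (\<forall>m\<in>Poly_Mapping.keys p. int (Poly_Mapping.lookup m i) \<le> d)"

text \<open>
  The formal partial derivative: the coefficient of \<open>X^m\<close> in \<open>\<partial>p/\<partial>X\<^sub>i\<close> is \<open>m\<^sub>i + 1\<close> times the
  coefficient of \<open>X^m X\<^sub>i\<close> in \<open>p\<close>.
\<close>

lift_definition mpoly_pd :: "'n \<Rightarrow> 'n mpoly \<Rightarrow> 'n mpoly" is
  "\<lambda>i p m. of_nat (Poly_Mapping.lookup m i + 1) * p (m + Poly_Mapping.single i 1)"
proof -
  fix i :: 'n and p :: "('n \<Rightarrow>\<^sub>0 nat) \<Rightarrow> complex"
  assume "finite {m. p m \<noteq> 0}"
  then have "finite ((\<lambda>m. m + Poly_Mapping.single i 1) -` {m. p m \<noteq> 0})"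
    by (rule finite_vimageI) (simp add: inj_def)
  then show "finite {m. of_nat (Poly_Mapping.lookup m i + 1) * p (m + Poly_Mapping.single i 1) \<noteq> 0}"
    by (rule finite_subset[rotated]) auto
qed

lemma lookup_mpoly_pd:
  "Poly_Mapping.lookup (mpoly_pd i p) m =
     of_nat (Poly_Mapping.lookup m i + 1) * Poly_Mapping.lookup p (m + Poly_Mapping.single i 1)"
  by transfer simp

lemma mpoly_pd_add: "mpoly_pd i (p + q) = mpoly_pd i p + mpoly_pd i q"
  by (rule poly_mapping_eqI) (simp add: lookup_mpoly_pd lookup_add algebra_simps)

lemma mpoly_pd_zero [simp]: "mpoly_pd i 0 = 0"
  by (rule poly_mapping_eqI) (simp add: lookup_mpoly_pd)

lemma mpoly_pd_sum: "mpoly_pd i (sum f A) = (\<Sum>a\<in>A. mpoly_pd i (f a))"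
  by (induction A rule: infinite_finite_induct) (simp_all add: mpoly_pd_add)

lemma mpoly_pd_single:
  fixes m :: "'n \<Rightarrow>\<^sub>0 nat"
  shows "mpoly_pd i (Poly_Mapping.single m c) =
    Poly_Mapping.single (m - Poly_Mapping.single i 1) (of_nat (Poly_Mapping.lookup m i) * c)"
proof (rule poly_mapping_eqI)
  fix k :: "'n \<Rightarrow>\<^sub>0 nat"
  show "Poly_Mapping.lookup (mpoly_pd i (Poly_Mapping.single m c)) k =
    Poly_Mapping.lookup (Poly_Mapping.single (m - Poly_Mapping.single i 1)
      (of_nat (Poly_Mapping.lookup m i) * c)) k"
  proof (cases "m = k + Poly_Mapping.single i 1")
    case True
    then show ?thesis by (simp add: lookup_mpoly_pd lookup_add)
  next
    case False
    have "Poly_Mapping.lookup m i = 0" if "m - Poly_Mapping.single i 1 = k"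
    proof (rule ccontr)
      assume *: "Poly_Mapping.lookup m i \<noteq> 0"
      have "m = k + Poly_Mapping.single i 1"
      proof (rule poly_mapping_eqI)
        fix j
        show "Poly_Mapping.lookup m j = Poly_Mapping.lookup (k + Poly_Mapping.single i 1) j"
          using * by (cases "i = j") (auto simp: that[symmetric] lookup_add lookup_minus lookup_single)
      qed
      with False show False by simp
    qed
    with False show ?thesis
      by (auto simp: lookup_mpoly_pd lookup_single when_def)
  qed
qed

lemma mpoly_sum_single:
  "p = (\<Sum>m\<in>Poly_Mapping.keys p. Poly_Mapping.single m (Poly_Mapping.lookup p m))"
  for p :: "'n mpoly"
  by (rule poly_mapping_eqI)
     (auto simp: lookup_sum lookup_single when_def sum.delta' in_keys_iff)

lemma mpoly_pd_mult_single:
  fixes m k :: "'n \<Rightarrow>\<^sub>0 nat"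
  shows "mpoly_pd i (Poly_Mapping.single m c * Poly_Mapping.single k d) =
    mpoly_pd i (Poly_Mapping.single m c) * Poly_Mapping.single k d +
    Poly_Mapping.single m c * mpoly_pd i (Poly_Mapping.single k d)"
proof -
  let ?e = "Poly_Mapping.single i (1::nat)"
  have shift: "a - ?e + b = a + b - ?e" if "Poly_Mapping.lookup a i \<noteq> 0" for a b
  proof (rule poly_mapping_eqI)
    fix j
    show "Poly_Mapping.lookup (a - ?e + b) j = Poly_Mapping.lookup (a + b - ?e) j"
      using that by (cases "i = j") (auto simp: lookup_add lookup_minus lookup_single)
  qed
  have 1: "mpoly_pd i (Poly_Mapping.single m c) * Poly_Mapping.single k d =
      Poly_Mapping.single (m + k - ?e) (of_nat (Poly_Mapping.lookup m i) * (c * d))"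
    unfolding mpoly_pd_single mult_single using shift[of m k]
    by (cases "Poly_Mapping.lookup m i = 0") (simp_all add: mult.assoc)
  have 2: "Poly_Mapping.single m c * mpoly_pd i (Poly_Mapping.single k d) =
      Poly_Mapping.single (m + k - ?e) (of_nat (Poly_Mapping.lookup k i) * (c * d))"
    unfolding mpoly_pd_single mult_single using shift[of k m]
    by (cases "Poly_Mapping.lookup k i = 0") (simp_all add: mult.left_commute add.commute)
  show ?thesis
    unfolding 1 2
    by (simp add: mult_single mpoly_pd_single lookup_add single_add[symmetric] distrib_right)
qed

lemma mpoly_pd_mult: "mpoly_pd i (p * q) = mpoly_pd i p * q + p * mpoly_pd i q"
proof -
  let ?s = "\<lambda>p m. Poly_Mapping.single m (Poly_Mapping.lookup p m) :: 'a mpoly"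
  have "mpoly_pd i ((\<Sum>m\<in>Poly_Mapping.keys p. ?s p m) * (\<Sum>k\<in>Poly_Mapping.keys q. ?s q k)) =
    mpoly_pd i (\<Sum>m\<in>Poly_Mapping.keys p. ?s p m) * (\<Sum>k\<in>Poly_Mapping.keys q. ?s q k) +
    (\<Sum>m\<in>Poly_Mapping.keys p. ?s p m) * mpoly_pd i (\<Sum>k\<in>Poly_Mapping.keys q. ?s q k)"
    by (simp add: sum_product mpoly_pd_sum mpoly_pd_mult_single sum.distrib)
  then show ?thesis
    by (simp only: mpoly_sum_single[symmetric])
qed

text \<open>
  The partial derivative of a rational function, given by the quotient rule; it does not depend on
  the chosen fraction.
\<close>

lift_definition ratfun_pd ::
  "'n::linorder \<Rightarrow> 'n mpoly fract \<Rightarrow> 'n mpoly fract" is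
  "\<lambda>i (a, b). (mpoly_pd i a * b - a * mpoly_pd i b, b * b)"
proof -
  fix i :: 'n and x y :: "'n mpoly \<times> 'n mpoly"
  obtain a b c d where xy: "x = (a, b)" "y = (c, d)" by (cases x, cases y) auto
  assume "fractrel x y"
  then have nz: "b \<noteq> 0" "d \<noteq> 0" and eq: "a * d = c * b" by (auto simp: xy)
  have "mpoly_pd i a * d + a * mpoly_pd i d = mpoly_pd i c * b + c * mpoly_pd i b"
    using arg_cong[OF eq, of "mpoly_pd i"] by (simp add: mpoly_pd_mult)
  with eq have "(mpoly_pd i a * b - a * mpoly_pd i b) * (d * d) =
      (mpoly_pd i c * d - c * mpoly_pd i d) * (b * b)"
    by algebra
  with nz show "fractrel ((\<lambda>(a, b). (mpoly_pd i a * b - a * mpoly_pd i b, b * b)) x)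
      ((\<lambda>(a, b). (mpoly_pd i a * b - a * mpoly_pd i b, b * b)) y)"
    by (simp add: xy)
qed

lemma ratfun_pd_Fract:
  "b \<noteq> 0 \<Longrightarrow> ratfun_pd i (Fract a b) = Fract (mpoly_pd i a * b - a * mpoly_pd i b) (b * b)"
  by transfer simp

definition irreducible_factorization :: "'n mpoly \<Rightarrow> nat \<Rightarrow> (nat \<Rightarrow> 'n mpoly) \<Rightarrow> bool" where
  "irreducible_factorization P s Q \<longleftrightarrow> (\<forall>i<s. irreducible (Q i)) \<and> P = (\<Prod>i<s. Q i)"

definition reduced_mpoly :: "'n mpoly \<Rightarrow> bool" where
  "reduced_mpoly P \<longleftrightarrow> (\<forall>s Q. irreducible_factorization P s Q \<longrightarrow>
     (\<forall>i<s. \<forall>j<s. i \<noteq> j \<longrightarrow> \<not> (Q i dvd Q j \<and> Q j dvd Q i)))"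


section \<open>First de Rham cohomology with complex coefficients\<close>

fun C_k_on :: "nat \<Rightarrow> ('a::real_normed_vector \<Rightarrow> 'b::real_normed_vector) \<Rightarrow> 'a set \<Rightarrow> bool" where
  "C_k_on 0 f U \<longleftrightarrow> continuous_on U f"
| "C_k_on (Suc k) f U \<longleftrightarrow> (\<forall>x\<in>U. f differentiable (at x)) \<and>
     (\<forall>v. C_k_on k (\<lambda>x. frechet_derivative f (at x) v) U)"

definition smooth_on :: "('a::real_normed_vector \<Rightarrow> 'b::real_normed_vector) \<Rightarrow> 'a set \<Rightarrow> bool" where
  "smooth_on f U \<longleftrightarrow> (\<forall>k. C_k_on k f U)"

text \<open>
  A complex valued 1-form on an open set \<open>U\<close> of a real normed space \<open>E\<close> (here \<open>E = \<complex>\<^sup>n\<close>, seen as a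
  real vector space) is a function \<open>\<omega> :: E \<Rightarrow> E \<Rightarrow> complex\<close> taking a point and a tangent vector. Forms
  are set to 0 outside \<open>U\<close>, so that two forms on \<open>U\<close> are equal iff they are equal as functions.
\<close>

type_synonym 'a form1 = "'a \<Rightarrow> 'a \<Rightarrow> complex"

definition smooth_forms1 :: "'a::real_normed_vector set \<Rightarrow> 'a form1 set" where
  "smooth_forms1 U = {\<omega>. (\<forall>x\<in>U. linear (\<omega> x)) \<and> (\<forall>v. smooth_on (\<lambda>x. \<omega> x v) U) \<and>
     (\<forall>x v. x \<notin> U \<longrightarrow> \<omega> x v = 0)}"

text \<open>The exterior derivative of a 1-form, evaluated at the point \<open>x\<close> on the vectors \<open>u\<close> and \<open>v\<close>.\<close>

definition ext_deriv1 :: "'a::real_normed_vector form1 \<Rightarrow> 'a \<Rightarrow> 'a \<Rightarrow> 'a \<Rightarrow> complex" where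
  "ext_deriv1 \<omega> x u v =
     frechet_derivative (\<lambda>y. \<omega> y v) (at x) u - frechet_derivative (\<lambda>y. \<omega> y u) (at x) v"

definition ext_deriv0 :: "'a::real_normed_vector set \<Rightarrow> ('a \<Rightarrow> complex) \<Rightarrow> 'a form1" where
  "ext_deriv0 U f x v = (if x \<in> U then frechet_derivative f (at x) v else 0)"

definition closed_forms1 :: "'a::real_normed_vector set \<Rightarrow> 'a form1 set" where
  "closed_forms1 U = {\<omega> \<in> smooth_forms1 U. \<forall>x\<in>U. \<forall>u v. ext_deriv1 \<omega> x u v = 0}"

definition exact_forms1 :: "'a::real_normed_vector set \<Rightarrow> 'a form1 set" where
  "exact_forms1 U = {ext_deriv0 U f | f. smooth_on f U}"

text \<open>
  \<open>H\<^sup>1(U, \<complex>)\<close> is the quotient of the closed by the exact forms: its elements are the cosets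
  \<open>[\<omega>] = \<omega> + B\<close>, where \<open>B\<close> is the space of exact forms, with the vector space operations of a
  quotient space.
\<close>

definition derham_class :: "'a::real_normed_vector set \<Rightarrow> 'a form1 \<Rightarrow> 'a form1 set" where
  "derham_class U \<omega> = {(\<lambda>x v. \<omega> x v + \<beta> x v) | \<beta>. \<beta> \<in> exact_forms1 U}"

definition derham_H1 :: "'a::real_normed_vector set \<Rightarrow> 'a form1 set set" where
  "derham_H1 U = derham_class U ` closed_forms1 U"

definition derham_add :: "'a::real_normed_vector form1 set \<Rightarrow> 'a form1 set \<Rightarrow> 'a form1 set" where
  "derham_add C D = {(\<lambda>x v. \<omega> x v + \<eta> x v) | \<omega> \<eta>. \<omega> \<in> C \<and> \<eta> \<in> D}"

text \<open>The exact form \<open>\<beta>\<close> is only needed for \<open>c = 0\<close>, where \<open>0 \<cdot> [\<omega>]\<close> has to be all of \<open>B\<close>.\<close>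

definition derham_scale ::
  "'a::real_normed_vector set \<Rightarrow> complex \<Rightarrow> 'a form1 set \<Rightarrow> 'a form1 set" where
  "derham_scale U c C = {(\<lambda>x v. c * \<omega> x v + \<beta> x v) | \<omega> \<beta>. \<omega> \<in> C \<and> \<beta> \<in> exact_forms1 U}"


section \<open>The space \<open>F(P)\<close> and the map \<open>T\<close>\<close>

text \<open>The complement of the hypersurface \<open>P = 0\<close>.\<close>

definition hyp_compl :: "'n::finite mpoly \<Rightarrow> (complex ^ 'n) set" where
  "hyp_compl P = {x. mpoly_eval P x \<noteq> 0}"

definition F_space :: "'n::{finite,linorder} mpoly \<Rightarrow> ('n mpoly ^ 'n::{finite,linorder}) set" where
  "F_space P = {A.
     (\<forall>i j. i < j \<longrightarrow> ratfun_pd i (Fract (A $ j) P) - ratfun_pd j (Fract (A $ i) P) = 0) \<and>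
     (\<forall>i j. mpoly_deg_le j (A $ i)
        (if j = i then int (mpoly_deg j P) - 1 else int (mpoly_deg j P)))}"

definition tuple_scale :: "complex \<Rightarrow> 'n::finite mpoly ^ 'n \<Rightarrow> 'n mpoly ^ 'n" where
  "tuple_scale c A = (\<chi> i. mpoly_const c * A $ i)"

interpretation tuples: vector_space "tuple_scale :: complex \<Rightarrow> 'n::finite mpoly ^ 'n \<Rightarrow> 'n mpoly ^ 'n"
  by standard
     (simp_all add: tuple_scale_def vec_eq_iff algebra_simps single_add mult_single
        flip: mult.assoc)

text \<open>
  The form \<open>\<omega>(A) = \<Sum>\<^sub>i (A\<^sub>i / P) dX\<^sub>i\<close>, where \<open>dX\<^sub>i\<close> is the projection of a tangent vector to its
  \<open>i\<close>-th coordinate. It vanishes outside of \<open>hyp_compl P\<close> because of \<open>a / 0 = 0\<close>.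
\<close>

definition omega :: "'n::finite mpoly \<Rightarrow> 'n mpoly ^ 'n \<Rightarrow> (complex ^ 'n) form1" where
  "omega P A = (\<lambda>x v. \<Sum>i\<in>UNIV. mpoly_eval (A $ i) x / mpoly_eval P x * v $ i)"

definition T_map :: "'n::finite mpoly \<Rightarrow> 'n mpoly ^ 'n \<Rightarrow> (complex ^ 'n) form1 set" where
  "T_map P A = derham_class (hyp_compl P) (omega P A)"

end

(*
  Choose a direction u such that P(x + z u) is, for every x, a polynomial in z whose leading
  coefficient is a fixed nonzero constant. Restricting a closed form omega to the lines in direction
  u yields a residue at every point of V(P), and the residue is locally constant at the points where
  the derivative of P along u does not vanish. The sum of r(s) kappa prod_{s' /= s} (z - s') over the
  roots s of P(x + z u), where r is the residue, takes the value r(s) P'(s) at z = s. It is holomorphic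
  in x off a hypersurface and of polynomial growth, hence a polynomial by Liouville's theorem. As the
  factors P_j are prime, r is a constant c_j on V(P_j). After subtraction of sum_j c_j dP_j / P_j all
  residues of omega vanish, so omega is exact on every line in direction u, and the primitives on the
  lines fit together along a section far away from V(P). So H^1 is spanned by the classes of
  dP_j / P_j. Injectivity: if omega(A) is exact, its residues along u vanish, so P divides
  sum_i u_i A_i; this holds for all generic u, so P divides every A_i, and the degree bound forces
  A_i = 0.
*)

theory Submission
  imports
    Defs
    "HOL-Complex_Analysis.Cauchy_Integral_Formula"
    "HOL-Computational_Algebra.Fundamental_Theorem_Algebra"
begin

section \<open>Polynomials: evaluation and substitution\<close>

text \<open>The obstacle is monodromy: as the line moves, the roots of P on it are permuted, so a
  single root or a single residue is not a holomorphic function of x. The interpolation sum is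
  symmetric in the roots and escapes this; it is used at z = 0 only, where it is the function
  \<open>a\<close>. Roots collide only over a hypersurface D = 0, which exists because P is reduced.
  On the lines over D = 0 the vanishing of residues is inherited from neighbouring lines, by
  comparison on an annulus that encloses the colliding roots. The constancy of the residue on V(P_j)
  does not go through the connectedness of its regular part. The polynomial A - c dP/du vanishes at
  the zeros of P_j near one simple point. If P_j did not divide a polynomial B, an identity E = U
  P_j + V B on the lines, with E nonzero and free of z, would prevent B from vanishing at all zeros
  of P_j near that point. Identities of the same kind show that irreducible polynomials are prime,
  and they produce D.\<close>

definition msubst :: "(complex \<Rightarrow> 'b) \<Rightarrow> ('n::finite \<Rightarrow> 'b) \<Rightarrow> 'n mpoly \<Rightarrow> 'b::comm_ring_1" where
  "msubst \<iota> \<theta> p = (\<Sum>m\<in>Poly_Mapping.keys p.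
     \<iota> (Poly_Mapping.lookup p m) * (\<Prod>i\<in>UNIV. \<theta> i ^ Poly_Mapping.lookup m i))"

text \<open>One substitution map serves for evaluation at a point, for the restriction
  \<open>shift\<close> to a line, and for the view \<open>var_poly\<close> as a polynomial in one
  variable. These differ in the target of the constants; multiplicativity is proved once, by
  expansion into monomials.\<close>

locale coeff_hom =
  fixes \<iota> :: "complex \<Rightarrow> 'b::comm_ring_1"
  assumes hom_add: "\<iota> (a + b) = \<iota> a + \<iota> b"
    and hom_mult: "\<iota> (a * b) = \<iota> a * \<iota> b"
    and hom_one: "\<iota> 1 = 1"
begin

lemma hom_zero: "\<iota> 0 = 0"
  using hom_add[of 0 0] by simp

lemma msubst_superset:
  assumes "finite K" "Poly_Mapping.keys p \<subseteq> K"
  shows "msubst \<iota> \<theta> p = (\<Sum>m\<in>K. \<iota> (Poly_Mapping.lookup p m) * (\<Prod>i\<in>UNIV. \<theta> i ^ Poly_Mapping.lookup m i))"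
  unfolding msubst_def using assms
  by (intro sum.mono_neutral_left) (auto simp: in_keys_iff hom_zero)

lemma msubst_zero [simp]: "msubst \<iota> \<theta> 0 = 0"
  by (simp add: msubst_def)

lemma msubst_add: "msubst \<iota> \<theta> (p + q) = msubst \<iota> \<theta> p + msubst \<iota> \<theta> q"
proof -
  let ?K = "Poly_Mapping.keys p \<union> Poly_Mapping.keys q"
  have "msubst \<iota> \<theta> (p + q) = (\<Sum>m\<in>?K. \<iota> (Poly_Mapping.lookup (p + q) m) * (\<Prod>i\<in>UNIV. \<theta> i ^ Poly_Mapping.lookup m i))"
    by (rule msubst_superset) (auto simp: Poly_Mapping.keys_add)
  then show ?thesis
    by (subst (2 3) msubst_superset[of ?K]) (auto simp: lookup_add hom_add distrib_right sum.distrib)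
qed

lemma msubst_sum: "msubst \<iota> \<theta> (sum f A) = (\<Sum>a\<in>A. msubst \<iota> \<theta> (f a))"
  by (induction A rule: infinite_finite_induct) (simp_all add: msubst_add)

lemma msubst_single: "msubst \<iota> \<theta> (Poly_Mapping.single m c) = \<iota> c * (\<Prod>i\<in>UNIV. \<theta> i ^ Poly_Mapping.lookup m i)"
  by (subst msubst_superset[of "{m}"]) auto

lemma msubst_const [simp]: "msubst \<iota> \<theta> (mpoly_const c) = \<iota> c"
  by (simp add: msubst_single)

lemma msubst_one [simp]: "msubst \<iota> \<theta> 1 = 1"
  using msubst_const[of \<theta> 1] by (simp add: hom_one)

lemma msubst_mult: "msubst \<iota> \<theta> (p * q) = msubst \<iota> \<theta> p * msubst \<iota> \<theta> q"
proof -
  let ?s = "\<lambda>p m. Poly_Mapping.single m (Poly_Mapping.lookup p m) :: 'a mpoly"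
  have "msubst \<iota> \<theta> ((\<Sum>m\<in>Poly_Mapping.keys p. ?s p m) * (\<Sum>k\<in>Poly_Mapping.keys q. ?s q k)) =
     msubst \<iota> \<theta> (\<Sum>m\<in>Poly_Mapping.keys p. ?s p m) * msubst \<iota> \<theta> (\<Sum>k\<in>Poly_Mapping.keys q. ?s q k)"
    by (simp add: sum_product msubst_sum mult_single msubst_single hom_mult lookup_add power_add
        prod.distrib mult_ac)
  then show ?thesis
    by (simp only: mpoly_sum_single[symmetric])
qed

lemma msubst_uminus: "msubst \<iota> \<theta> (- p) = - msubst \<iota> \<theta> p"
  using msubst_add[of \<theta> p "- p"] by (simp add: eq_neg_iff_add_eq_0 add.commute)

lemma msubst_diff: "msubst \<iota> \<theta> (p - q) = msubst \<iota> \<theta> p - msubst \<iota> \<theta> q"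
  using msubst_add[of \<theta> p "- q"] by (simp add: msubst_uminus)

lemma msubst_prod: "msubst \<iota> \<theta> (prod f A) = (\<Prod>a\<in>A. msubst \<iota> \<theta> (f a))"
  by (induction A rule: infinite_finite_induct) (simp_all add: msubst_mult)

lemma msubst_power: "msubst \<iota> \<theta> (p ^ k) = msubst \<iota> \<theta> p ^ k"
  by (induction k) (simp_all add: msubst_mult)

end

definition mpoly_X :: "'n \<Rightarrow> 'n mpoly" where
  "mpoly_X i = Poly_Mapping.single (Poly_Mapping.single i 1) 1"

lemma (in coeff_hom) msubst_X [simp]: "msubst \<iota> \<theta> (mpoly_X i) = \<theta> i"
proof -
  have "(\<Prod>j\<in>UNIV. \<theta> j ^ Poly_Mapping.lookup (Poly_Mapping.single i 1) j) = (\<Prod>j\<in>UNIV. if j = i then \<theta> j else 1)"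
    by (intro prod.cong) (auto simp: lookup_single when_def)
  then show ?thesis
    by (simp add: mpoly_X_def msubst_single hom_one)
qed

interpretation ceval: coeff_hom "\<lambda>c::complex. c"
  by standard auto

interpretation cconst: coeff_hom "mpoly_const :: complex \<Rightarrow> 'n::linorder mpoly"
  by standard (simp_all add: single_add mult_single)

interpretation cpconst: coeff_hom "\<lambda>c. [:mpoly_const c :: 'n::linorder mpoly:]"
  by standard (simp_all add: single_add mult_single one_pCons mult.commute)

lemma mpoly_eval_msubst: "mpoly_eval p x = msubst (\<lambda>c. c) (($) x) p"
  by (simp add: mpoly_eval_def msubst_def)

lemma mpoly_eval_add [simp]: "mpoly_eval (p + q) x = mpoly_eval p x + mpoly_eval q x"
  and mpoly_eval_mult [simp]: "mpoly_eval (p * q) x = mpoly_eval p x * mpoly_eval q x"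
  and mpoly_eval_zero [simp]: "mpoly_eval 0 x = 0"
  and mpoly_eval_one [simp]: "mpoly_eval 1 x = 1"
  and mpoly_eval_const [simp]: "mpoly_eval (mpoly_const c) x = c"
  and mpoly_eval_X [simp]: "mpoly_eval (mpoly_X i) x = x $ i"
  and mpoly_eval_diff [simp]: "mpoly_eval (p - q) x = mpoly_eval p x - mpoly_eval q x"
  and mpoly_eval_sum [simp]: "mpoly_eval (sum f A) x = (\<Sum>a\<in>A. mpoly_eval (f a) x)"
  and mpoly_eval_prod [simp]: "mpoly_eval (prod f A) x = (\<Prod>a\<in>A. mpoly_eval (f a) x)"
  and mpoly_eval_power [simp]: "mpoly_eval (p ^ k) x = mpoly_eval p x ^ k"
  by (simp_all add: mpoly_eval_msubst ceval.msubst_add ceval.msubst_mult ceval.msubst_diff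
      ceval.msubst_uminus ceval.msubst_sum ceval.msubst_prod ceval.msubst_power)

lemma mpoly_X_power: "mpoly_X i ^ k = Poly_Mapping.single (Poly_Mapping.single i k) 1"
  by (induction k) (simp_all add: mpoly_X_def mult_single single_add[symmetric] add.commute)

lemma single_eq_prod_X:
  "Poly_Mapping.single m c = mpoly_const c * (\<Prod>i\<in>UNIV. mpoly_X i ^ Poly_Mapping.lookup m i)"
  for m :: "'n::{finite,linorder} \<Rightarrow>\<^sub>0 nat"
proof -
  have "(\<Prod>i\<in>A. mpoly_X i ^ Poly_Mapping.lookup m i) =
     Poly_Mapping.single (\<Sum>i\<in>A. Poly_Mapping.single i (Poly_Mapping.lookup m i)) 1" if "finite A" for A
    using that by (induction) (simp_all add: mpoly_X_power mult_single)
  moreover have "(\<Sum>i\<in>UNIV. Poly_Mapping.single i (Poly_Mapping.lookup m i)) = m"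
    by (rule poly_mapping_eqI) (simp add: lookup_sum lookup_single when_def)
  ultimately show ?thesis by (simp add: mult_single)
qed

text \<open>Monomials are products of variables, so constants and variables generate the ring.
  Identities between homomorphisms, and rules compatible with products, need to be checked on
  generators only.\<close>

lemma mpoly_induct [case_names const X add mult]:
  fixes p :: "'n::{finite,linorder} mpoly"
  assumes c: "\<And>c. R (mpoly_const c)" and x: "\<And>i. R (mpoly_X i)"
    and a: "\<And>p q. R p \<Longrightarrow> R q \<Longrightarrow> R (p + q)" and m: "\<And>p q. R p \<Longrightarrow> R q \<Longrightarrow> R (p * q)"
  shows "R p"
proof -
  have 0: "R 0" and 1: "R 1"
    using c[of 0] c[of 1] by simp_all
  have pw: "R (q ^ k)" if "R q" for q k
    using that by (induction k) (auto simp: 1 m)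
  have pr: "finite A \<Longrightarrow> (\<And>i. i \<in> A \<Longrightarrow> R (f i)) \<Longrightarrow> R (prod f A)" for f and A :: "'n set"
    by (induction A rule: finite_induct) (auto simp: 1 m)
  have sm: "finite A \<Longrightarrow> (\<And>i. i \<in> A \<Longrightarrow> R (f i)) \<Longrightarrow> R (sum f A)" for f and A :: "('n \<Rightarrow>\<^sub>0 nat) set"
    by (induction A rule: finite_induct) (auto simp: 0 a)
  show ?thesis
  proof (subst mpoly_sum_single, intro sm)
    show "R (Poly_Mapping.single k (Poly_Mapping.lookup p k))" for k
      by (subst single_eq_prod_X) (intro m c pr pw x finite)
  qed simp
qed

text \<open>A polynomial in z over the polynomial ring is specialised in two ways:
  \<open>ev2\<close> fixes both x and z, while \<open>evp\<close> fixes x only and leaves a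
  polynomial over the complex numbers, which splits into linear factors.\<close>

definition ev2 :: "'n::{finite,linorder} mpoly poly \<Rightarrow> complex ^ 'n::{finite,linorder} \<Rightarrow> complex \<Rightarrow> complex" where
  "ev2 f x z = mpoly_eval (poly f (mpoly_const z)) x"

definition evp :: "'n::{finite,linorder} mpoly poly \<Rightarrow> complex ^ 'n::{finite,linorder} \<Rightarrow> complex poly" where
  "evp f x = map_poly (\<lambda>p. mpoly_eval p x) f"

lemma coeff_evp [simp]: "coeff (evp f x) k = mpoly_eval (coeff f k) x"
  by (simp add: evp_def coeff_map_poly)

lemma evp_add [simp]: "evp (f + g) x = evp f x + evp g x"
  and evp_0 [simp]: "evp 0 x = 0"
  and evp_pCons [simp]: "evp (pCons a f) x = pCons (mpoly_eval a x) (evp f x)"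
  and evp_smult [simp]: "evp (smult a f) x = smult (mpoly_eval a x) (evp f x)"
  by (auto intro!: poly_eqI simp: coeff_pCons split: nat.splits simp flip: one_poly_eq_simps(1))

lemma evp_mult [simp]: "evp (f * g) x = evp f x * evp g x"
  by (rule poly_eqI) (simp add: coeff_mult)

lemma poly_evp: "poly (evp f x) z = ev2 f x z"
  by (induction f) (simp_all add: ev2_def)

lemma degree_evp_le: "degree (evp f x) \<le> degree f"
  by (intro degree_le) (simp add: coeff_eq_0)

text \<open>The polynomial \<open>p(X + z u)\<close> in the variable \<open>z\<close>.\<close>

definition shift :: "complex ^ 'n::{finite,linorder} \<Rightarrow> 'n::{finite,linorder} mpoly \<Rightarrow> 'n mpoly poly" where
  "shift u = msubst (\<lambda>c. [:mpoly_const c:]) (\<lambda>i. [:mpoly_X i, mpoly_const (u $ i):])"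

lemma shift_add [simp]: "shift u (p + q) = shift u p + shift u q"
  and shift_mult [simp]: "shift u (p * q) = shift u p * shift u q"
  and shift_const [simp]: "shift u (mpoly_const c) = [:mpoly_const c:]"
  and shift_diff [simp]: "shift u (p - q) = shift u p - shift u q"
  by (simp_all add: shift_def cpconst.msubst_add cpconst.msubst_mult cpconst.msubst_diff cpconst.msubst_prod)

lemma shift_X [simp]: "shift u (mpoly_X i) = [:mpoly_X i, mpoly_const (u $ i):]"
  by (simp add: shift_def)

lemma ev2_shift [simp]: "ev2 (shift u p) x z = mpoly_eval p (x + z *s u)"
  by (induction p rule: mpoly_induct) (simp_all add: ev2_def)

lemma poly_shift_0 [simp]: "poly (shift u p) 0 = p"
  by (induction p rule: mpoly_induct) simp_all

section \<open>Derivatives of the evaluation, and complements of hypersurfaces\<close>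

lemma mpoly_pd_const [simp]: "mpoly_pd i (mpoly_const c) = 0"
  by (simp add: mpoly_pd_single)

lemma mpoly_pd_X: "mpoly_pd i (mpoly_X j) = (if i = j then 1 else 0)"
  by (auto simp: mpoly_X_def mpoly_pd_single lookup_single when_def)

lemma has_derivative_mpoly_eval:
  fixes p :: "'n::{finite,linorder} mpoly"
  shows "(mpoly_eval p has_derivative (\<lambda>v. \<Sum>i\<in>UNIV. mpoly_eval (mpoly_pd i p) x * v $ i)) (at x within S)"
proof (induction p rule: mpoly_induct)
  case (const c)
  have "mpoly_eval (mpoly_const c) = (\<lambda>x :: complex ^ 'n::{finite,linorder}. c)" by (rule ext) simp
  then show ?case by simp
next
  case (X j)
  have "(\<Sum>i\<in>UNIV. mpoly_eval (mpoly_pd i (mpoly_X j)) x * v $ i) = v $ j" for v :: "complex^'n::{finite,linorder}"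
  proof -
    have "(\<Sum>i\<in>UNIV. mpoly_eval (mpoly_pd i (mpoly_X j)) x * v $ i) = (\<Sum>i\<in>UNIV. if i = j then v $ i else 0)"
      by (intro sum.cong) (auto simp: mpoly_pd_X)
    then show ?thesis by simp
  qed
  then show ?case
    by (auto simp: bounded_linear_vec_nth intro!: bounded_linear_imp_has_derivative)
next
  case (add p q)
  from has_derivative_add[OF this] show ?case
    by (simp add: mpoly_pd_add distrib_right sum.distrib)
next
  case (mult p q)
  from has_derivative_mult[OF this] show ?case
    by (simp add: mpoly_pd_mult algebra_simps sum.distrib sum_distrib_left)
qed

lemma continuous_on_mpoly_eval [continuous_intros]:
  fixes p :: "'n::{finite,linorder} mpoly"
  assumes "continuous_on S f"
  shows "continuous_on S (\<lambda>x. mpoly_eval p (f x))"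
proof -
  have "continuous_on UNIV (mpoly_eval p)"
    by (rule has_derivative_continuous_on[OF has_derivative_mpoly_eval])
  from continuous_on_compose2[OF this assms] show ?thesis by simp
qed

text \<open>A polynomial whose values vanish has derivatives with the same property, and the coefficients
  are the derivatives at \<open>0\<close> up to factorials.\<close>

lemma mpoly_eval_inject:
  fixes p q :: "'n::{finite,linorder} mpoly"
  assumes "\<And>x. mpoly_eval p x = mpoly_eval q x"
  shows "p = q"
proof -
  have *: "Poly_Mapping.lookup r m = 0" if "\<And>x. mpoly_eval r x = 0" for r :: "'n mpoly" and m
    using that
  proof (induction "\<Sum>i\<in>UNIV. Poly_Mapping.lookup m i" arbitrary: r m)
    case 0
    then have "m = 0" by (intro poly_mapping_eqI) auto
    have "mpoly_eval r 0 = (\<Sum>k\<in>insert 0 (Poly_Mapping.keys r). Poly_Mapping.lookup r k * (\<Prod>i\<in>UNIV. 0 ^ Poly_Mapping.lookup k i))"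
      unfolding mpoly_eval_def by (intro sum.mono_neutral_cong_left) (auto simp: in_keys_iff)
    also have "\<dots> = (\<Sum>k\<in>insert 0 (Poly_Mapping.keys r). if k = 0 then Poly_Mapping.lookup r k else 0)"
    proof (intro sum.cong refl)
      fix k :: "'n \<Rightarrow>\<^sub>0 nat"
      show "Poly_Mapping.lookup r k * (\<Prod>i\<in>UNIV. 0 ^ Poly_Mapping.lookup k i) = (if k = 0 then Poly_Mapping.lookup r k else 0)"
      proof (cases "k = 0")
        case False
        then obtain i where "Poly_Mapping.lookup k i \<noteq> 0"
          by (metis lookup_zero poly_mapping_eqI)
        then have "(\<Prod>i\<in>UNIV. (0::complex) ^ Poly_Mapping.lookup k i) = 0"
          by (intro prod_zero) auto
        with False show ?thesis by simp
      qed simp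
    qed
    also have "\<dots> = Poly_Mapping.lookup r 0" by (subst sum.delta) auto
    finally show ?case using 0 \<open>m = 0\<close> by simp
  next
    case (Suc k)
    then have "(\<Sum>i\<in>UNIV. Poly_Mapping.lookup m i) \<noteq> 0" by linarith
    then obtain i where i: "Poly_Mapping.lookup m i \<noteq> 0" by (meson sum.neutral)
    define m' where "m' = m - Poly_Mapping.single i 1"
    have m: "m = m' + Poly_Mapping.single i 1"
      using i by (intro poly_mapping_eqI) (auto simp: m'_def lookup_add lookup_minus lookup_single when_def)
    have k: "k = (\<Sum>i\<in>UNIV. Poly_Mapping.lookup m' i)"
      using Suc(2) unfolding m by (simp add: lookup_add sum.distrib lookup_single when_def)
    have "mpoly_eval (mpoly_pd i r) x = 0" for x
    proof -
      have "(mpoly_eval r has_derivative (\<lambda>v. 0)) (at x)"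
      proof -
        have "mpoly_eval r = (\<lambda>_. 0)" using Suc.prems by auto
        then show ?thesis by simp
      qed
      with has_derivative_mpoly_eval[of r x UNIV]
      have "(\<lambda>v. \<Sum>i\<in>UNIV. mpoly_eval (mpoly_pd i r) x * v $ i) = (\<lambda>v. 0)"
        by (rule has_derivative_unique)
      from fun_cong[OF this, of "axis i 1"] show ?thesis
        by (simp add: axis_def if_distrib cong: if_cong)
    qed
    from Suc.hyps(1)[OF k this] show ?case
      using of_nat_neq_0[of "Poly_Mapping.lookup m' i", where 'a = complex] by (auto simp: m lookup_mpoly_pd)
  qed
  have "p - q = 0"
    by (rule poly_mapping_eqI) (use *[of "p - q"] assms in auto)
  then show ?thesis by simp
qed

text \<open>A line with one point off the zero set meets it in the roots of a nonzero polynomial in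
  z. Connectedness and density of complements of hypersurfaces rest on this.\<close>

lemma evp_shift_eq_0_finite:
  fixes p :: "'n::{finite,linorder} mpoly"
  assumes "mpoly_eval p (x + c *s v) \<noteq> 0"
  shows "finite {z. mpoly_eval p (x + z *s v) = 0}"
proof -
  have "evp (shift v p) x \<noteq> 0"
    using assms by (metis ev2_shift poly_0 poly_evp)
  then have "finite {z. poly (evp (shift v p) x) z = 0}"
    by (rule poly_roots_finite)
  then show ?thesis by (simp add: poly_evp)
qed

lemma continuous_on_vector_smult [continuous_intros]:
  fixes v :: "complex ^ 'n"
  assumes "continuous_on S f" "continuous_on S g"
  shows "continuous_on S (\<lambda>z. f z *s (g z :: complex ^ 'n))"
  unfolding vector_scalar_mult_def by (intro continuous_intros assms)

text \<open>Two points off the zero set are joined inside the complex line through them: this line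
  meets \<open>W\<close> in a convex open subset of the plane, and deleting finitely many points
  does not disconnect it.\<close>

lemma convex_diff_zeros:
  fixes p :: "'n::{finite,linorder} mpoly"
  assumes "p \<noteq> 0" "convex W" "open W" "W \<noteq> {}"
  shows "connected (W - {x. mpoly_eval p x = 0})" and "W - {x. mpoly_eval p x = 0} \<noteq> {}"
proof -
  let ?V = "{x. mpoly_eval p x = 0}"
  \<comment> \<open>Only \<open>a\<close> has to lie in \<open>W\<close>. The use with z = 1 and
    \<open>b\<close> anywhere off the zero set gives nonemptiness; the use with z = 0 gives
    connectedness.\<close>
  have line: "\<exists>C. connected C \<and> C \<subseteq> W - ?V \<and> (\<forall>z\<in>{0,1}. a + z *s (b - a) \<in> W - ?V \<longrightarrow> a + z *s (b - a) \<in> C)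
      \<and> C \<noteq> {}" if a: "a \<in> W" and z: "mpoly_eval p (a + z *s (b - a)) \<noteq> 0" for a b z
  proof -
    define l where "l = (\<lambda>z. a + z *s (b - a))"
    have cont: "continuous_on A l" for A
      unfolding l_def by (intro continuous_intros)
    define U where "U = l -` W"
    have U: "open U"
      unfolding U_def using assms(3) cont[of UNIV] by (simp add: open_vimage)
    have cU: "convex U"
    proof (rule convexI)
      fix x y :: complex and s t :: real
      assume *: "x \<in> U" "y \<in> U" "0 \<le> s" "0 \<le> t" "s + t = 1"
      have 1: "complex_of_real s + complex_of_real t = 1" using * by (metis of_real_1 of_real_add)
      then have "l (s *\<^sub>R x + t *\<^sub>R y) = s *\<^sub>R l x + t *\<^sub>R l y"
        unfolding l_def vec_eq_iff by (simp add: scaleR_conv_of_real[of _ "_::complex"]) algebra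
      with * show "s *\<^sub>R x + t *\<^sub>R y \<in> U"
        using convexD[OF assms(2)] by (simp add: U_def)
    qed
    have fin: "finite {z. mpoly_eval p (l z) = 0}"
      unfolding l_def by (rule evp_shift_eq_0_finite[OF z])
    have con: "connected (U - {z. mpoly_eval p (l z) = 0})"
      using U cU fin by (intro connected_open_delete_finite) (auto simp: convex_connected)
    have "0 \<in> U" using a by (simp add: U_def l_def)
    then have "U \<noteq> {}" by blast
    then have "infinite U"
      using U finite_imp_not_open by blast
    then have "U - {z. mpoly_eval p (l z) = 0} \<noteq> {}"
      using fin by (metis Diff_eq_empty_iff finite_subset)
    moreover have "connected (l ` (U - {z. mpoly_eval p (l z) = 0}))"
      by (rule connected_continuous_image[OF cont con])
    moreover have "a + z *s (b - a) = l z" for z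
      by (simp add: l_def)
    ultimately show ?thesis
      by (intro exI[of _ "l ` (U - {z. mpoly_eval p (l z) = 0})"] conjI) (simp_all add: U_def, auto)
  qed
  obtain y where y: "mpoly_eval p y \<noteq> 0"
    using mpoly_eval_inject[of p 0] assms(1) by auto
  obtain a where a: "a \<in> W" using assms by blast
  from line[OF a, of 1 y] y show "W - ?V \<noteq> {}" by auto
  show "connected (W - ?V)"
    unfolding connected_iff_connected_component
  proof (intro ballI)
    fix a b assume ab: "a \<in> W - ?V" "b \<in> W - ?V"
    then obtain C where "connected C" "C \<subseteq> W - ?V"
      "\<forall>z\<in>{0,1}. a + z *s (b - a) \<in> W - ?V \<longrightarrow> a + z *s (b - a) \<in> C"
      using line[of a 0 b] by auto
    with ab show "connected_component (W - ?V) a b"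
      unfolding connected_component_def by (intro exI[of _ C]) auto
  qed
qed

lemma mpoly_nonzero_dense:
  fixes p :: "'n::{finite,linorder} mpoly"
  assumes "p \<noteq> 0" "\<delta> > 0"
  obtains y where "dist x y < \<delta>" "mpoly_eval p y \<noteq> 0"
proof -
  have "ball x \<delta> - {x. mpoly_eval p x = 0} \<noteq> {}"
    using assms by (intro convex_diff_zeros) auto
  then obtain y where "y \<in> ball x \<delta> - {x. mpoly_eval p x = 0}" by blast
  then show ?thesis using that[of y] by auto
qed

section \<open>Growth and divisibility\<close>

text \<open>The base \<open>1 + norm x ^ 2\<close> is at least 1, so exponents may be raised freely.
  It is also differentiable at the origin, which is needed when a root bound is turned into the
  section in \<open>exact_global\<close>.\<close>

definition poly_growth :: "('a::real_normed_vector \<Rightarrow> real) \<Rightarrow> bool" where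
  "poly_growth f \<longleftrightarrow> (\<exists>K N. K \<ge> 0 \<and> (\<forall>x. \<bar>f x\<bar> \<le> K * (1 + norm x ^ 2) ^ N))"

lemma poly_growthI: "K \<ge> 0 \<Longrightarrow> (\<And>x. \<bar>f x\<bar> \<le> K * (1 + norm x ^ 2) ^ N) \<Longrightarrow> poly_growth f"
  unfolding poly_growth_def by blast

lemma poly_growth_const [simp]: "poly_growth (\<lambda>_. c)"
  by (rule poly_growthI[of "\<bar>c\<bar>" _ 0]) auto

lemma poly_growth_nu [simp]: "poly_growth (\<lambda>x. 1 + norm x ^ 2)"
  by (rule poly_growthI[of 1 _ 1]) auto

lemma poly_growth_mono: "poly_growth g \<Longrightarrow> (\<And>x. \<bar>f x\<bar> \<le> \<bar>g x\<bar>) \<Longrightarrow> poly_growth f"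
  unfolding poly_growth_def by (meson order_trans)

lemma poly_growth_add:
  assumes "poly_growth f" "poly_growth g"
  shows "poly_growth (\<lambda>x. f x + g x)"
proof -
  obtain K N where 1: "K \<ge> 0" "\<And>x. \<bar>f x\<bar> \<le> K * (1 + norm x ^ 2) ^ N"
    using assms(1) unfolding poly_growth_def by blast
  obtain L M where 2: "L \<ge> 0" "\<And>x. \<bar>g x\<bar> \<le> L * (1 + norm x ^ 2) ^ M"
    using assms(2) unfolding poly_growth_def by blast
  show ?thesis
  proof (rule poly_growthI[of "K + L" _ "N + M"])
    fix x
    have "\<bar>f x + g x\<bar> \<le> K * (1 + norm x ^ 2) ^ N + L * (1 + norm x ^ 2) ^ M"
      using 1(2)[of x] 2(2)[of x] by linarith
    also have "\<dots> \<le> K * (1 + norm x ^ 2) ^ (N + M) + L * (1 + norm x ^ 2) ^ (N + M)"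
      using 1(1) 2(1) by (intro add_mono mult_left_mono power_increasing) auto
    finally show "\<bar>f x + g x\<bar> \<le> (K + L) * (1 + norm x ^ 2) ^ (N + M)" by (simp add: distrib_right)
  qed (use 1 2 in auto)
qed

lemma poly_growth_mult:
  assumes "poly_growth f" "poly_growth g"
  shows "poly_growth (\<lambda>x. f x * g x)"
proof -
  obtain K N where 1: "K \<ge> 0" "\<And>x. \<bar>f x\<bar> \<le> K * (1 + norm x ^ 2) ^ N"
    using assms(1) unfolding poly_growth_def by blast
  obtain L M where 2: "L \<ge> 0" "\<And>x. \<bar>g x\<bar> \<le> L * (1 + norm x ^ 2) ^ M"
    using assms(2) unfolding poly_growth_def by blast
  show ?thesis
  proof (rule poly_growthI[of "K * L" _ "N + M"])
    fix x
    have "\<bar>f x * g x\<bar> \<le> (K * (1 + norm x ^ 2) ^ N) * (L * (1 + norm x ^ 2) ^ M)"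
      using 1(1) 1(2)[of x] 2(2)[of x] by (auto simp: abs_mult intro!: mult_mono)
    then show "\<bar>f x * g x\<bar> \<le> (K * L) * (1 + norm x ^ 2) ^ (N + M)" by (simp add: power_add mult_ac)
  qed (use 1 2 in auto)
qed

lemma poly_growth_power: "poly_growth f \<Longrightarrow> poly_growth (\<lambda>x. f x ^ k)"
  by (induction k) (auto intro: poly_growth_mult)

lemma poly_growth_sum: "(\<And>i. i \<in> A \<Longrightarrow> poly_growth (f i)) \<Longrightarrow> poly_growth (\<lambda>x. \<Sum>i\<in>A. f i x)"
  by (induction A rule: infinite_finite_induct) (auto intro: poly_growth_add)

lemma poly_growth_mpoly: "poly_growth (\<lambda>x. norm (mpoly_eval p x))"
  for p :: "'n::{finite,linorder} mpoly"
proof (induction p rule: mpoly_induct)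
  case (X i)
  have "norm (x $ i) \<le> 1 + norm x ^ 2" for x :: "complex ^ 'n::{finite,linorder}"
  proof -
    have "norm (x $ i) \<le> norm x" by (rule Finite_Cartesian_Product.norm_nth_le)
    moreover have "0 \<le> (norm x - 1) ^ 2" by simp
    moreover have "(norm x - 1) ^ 2 = norm x ^ 2 - 2 * norm x + 1" by (simp add: power2_diff)
    ultimately show ?thesis using norm_ge_zero[of x] by linarith
  qed
  then show ?case by (intro poly_growthI[of 1 _ 1]) auto
next
  case (add p q)
  show ?case by (rule poly_growth_mono[OF poly_growth_add[OF add]]) (simp add: norm_triangle_ineq)
next
  case (mult p q)
  show ?case using poly_growth_mult[OF mult] by (simp add: norm_mult)
qed simp

text \<open>At a root \<open>s\<close> of \<open>c\<close> the polynomial \<open>a\<close> vanishes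
  too, and the linear factor is cancelled. The inequality survives away from \<open>s\<close>, and
  by continuity of \<open>C\<close> also at \<open>s\<close>, so the induction on the degree
  continues.\<close>

lemma poly_dvd_if_bounded:
  fixes a c :: "complex poly"
  assumes "c \<noteq> 0" and C: "continuous_on UNIV C" and "\<And>z. norm (poly a z) \<le> C z * norm (poly c z)"
  shows "c dvd a"
  using assms(1,3)
proof (induction "degree c" arbitrary: a c)
  case 0
  then show ?case
    by (metis is_unit_iff_degree unit_imp_dvd)
next
  case (Suc n)
  obtain s where s: "poly c s = 0"
    using Suc(2) Fundamental_Theorem_Algebra.fundamental_theorem_of_algebra[of c] by (auto simp: constant_degree)
  then obtain c' where c': "c = [:- s, 1:] * c'" by (auto simp: poly_eq_0_iff_dvd)
  have "poly a s = 0" using Suc(4)[of s] s by simp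
  then obtain a' where a': "a = [:- s, 1:] * a'" by (auto simp: poly_eq_0_iff_dvd)
  have "c' \<noteq> 0" using Suc(3) c' by auto
  then have deg: "n = degree c'" using Suc(2) unfolding c' by (subst (asm) degree_mult_eq) auto
  let ?G = "{z. norm (poly a' z) \<le> C z * norm (poly c' z)}"
  have "closed ?G"
    by (intro closed_Collect_le continuous_intros C)
  moreover have "- {s} \<subseteq> ?G"
  proof
    fix z assume "z \<in> - {s}"
    then have "0 < norm (z - s)" by simp
    moreover have "norm (z - s) * norm (poly a' z) \<le> norm (z - s) * (C z * norm (poly c' z))"
    proof -
      have "poly a z = (z - s) * poly a' z" "poly c z = (z - s) * poly c' z"
        by (simp_all add: a' c' algebra_simps)
      with Suc(4)[of z] show ?thesis by (simp add: norm_mult mult_ac)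
    qed
    ultimately show "z \<in> ?G" by simp
  qed
  ultimately have "closure (- {s}) \<subseteq> ?G" by (simp add: closure_minimal)
  then have "?G = UNIV" by (auto simp: closure_complement)
  then have "c' dvd a'" using Suc(1)[OF deg \<open>c' \<noteq> 0\<close>] by auto
  then show ?case unfolding a' c' by (rule mult_dvd_mono[OF dvd_refl])
qed

text \<open>Multiplication by \<open>[:- s, 1:]\<close> enlarges a bound on the coefficients by at
  most the factor \<open>1 + B\<close> and keeps the leading coefficient.\<close>

lemma coeff_le_roots_bound:
  fixes h :: "complex poly"
  assumes "\<And>z. poly h z = 0 \<Longrightarrow> norm z \<le> B" "B \<ge> 0"
  shows "norm (coeff h i) \<le> norm (lead_coeff h) * (1 + B) ^ degree h"
  using assms(1)
proof (induction "degree h" arbitrary: h i)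
  case 0
  then show ?case by (cases i) (auto simp: coeff_eq_0)
next
  case (Suc n)
  obtain s where s: "poly h s = 0"
    using Suc(2) Fundamental_Theorem_Algebra.fundamental_theorem_of_algebra[of h] by (auto simp: constant_degree)
  then obtain g where g: "h = [:- s, 1:] * g" by (auto simp: poly_eq_0_iff_dvd)
  have "g \<noteq> 0" using Suc(2) g by auto
  then have deg: "n = degree g" using Suc(2) unfolding g by (subst (asm) degree_mult_eq) auto
  have IH: "norm (coeff g i) \<le> norm (lead_coeff g) * (1 + B) ^ n" for i
    using Suc(1)[OF deg, of i] Suc(3) g deg by simp
  have lc: "lead_coeff h = lead_coeff g" unfolding g by (subst lead_coeff_mult) simp
  have "norm s \<le> B" using Suc(3) s by blast
  have "coeff h i = coeff (pCons 0 g) i - s * coeff g i" unfolding g by simp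
  then have "norm (coeff h i) \<le> norm (coeff (pCons 0 g) i) + norm s * norm (coeff g i)"
    by (metis norm_mult norm_triangle_ineq4)
  also have "\<dots> \<le> norm (lead_coeff g) * (1 + B) ^ n + B * (norm (lead_coeff g) * (1 + B) ^ n)"
    using IH \<open>norm s \<le> B\<close> assms(2)
    by (intro add_mono mult_mono) (auto simp: coeff_pCons split: nat.splits)
  finally show ?case using lc Suc(2)[symmetric] by (simp add: algebra_simps)
qed

lemma ev2_inject:
  assumes "\<And>x z. ev2 f x z = ev2 g x z"
  shows "f = g"
proof (rule poly_eqI, rule mpoly_eval_inject)
  fix n x
  have "evp f x = evp g x"
    using assms by (intro poly_ext) (simp add: poly_evp)
  then show "mpoly_eval (coeff f n) x = mpoly_eval (coeff g n) x"
    by (metis coeff_evp)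
qed

lemma ev2_mult [simp]: "ev2 (f * g) x z = ev2 f x z * ev2 g x z"
  and ev2_add [simp]: "ev2 (f + g) x z = ev2 f x z + ev2 g x z"
  and ev2_diff [simp]: "ev2 (f - g) x z = ev2 f x z - ev2 g x z"
  and ev2_pCons: "ev2 (pCons a f) x z = mpoly_eval a x + z * ev2 f x z"
  and ev2_0 [simp]: "ev2 0 x z = 0"
  by (simp_all add: ev2_def)

lemma mpoly_const_power: "mpoly_const c ^ k = (mpoly_const (c ^ k) :: 'n::linorder mpoly)"
  by (induction k) (simp_all add: mult_single)

lemma const_dvd_one: "c \<noteq> 0 \<Longrightarrow> mpoly_const c dvd (1 :: 'n::linorder mpoly)"
  by (rule dvdI[of _ _ "mpoly_const (1 / c)"]) (simp add: mult_single)

lemma mpoly_const_eq_0_iff [simp]: "mpoly_const c = 0 \<longleftrightarrow> c = 0"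
  by (metis lookup_single_eq lookup_zero single_zero)

text \<open>On every line through the origin the two factors are polynomials in one variable with a
  nonzero constant product, hence constant there; so \<open>p\<close> takes its value at 0
  everywhere.\<close>

lemma mult_eq_const_imp_const:
  fixes p q :: "'n::{finite,linorder} mpoly"
  assumes "p * q = mpoly_const \<kappa>" "\<kappa> \<noteq> 0"
  obtains a where "p = mpoly_const a" "a \<noteq> 0"
proof -
  have "mpoly_eval p x = mpoly_eval p 0" for x
  proof -
    have "evp (shift x p) 0 * evp (shift x q) 0 = [:\<kappa>:]"
      by (metis evp_0 evp_mult evp_pCons shift_mult shift_const assms(1) mpoly_eval_const)
    then have "evp (shift x p) 0 dvd [:\<kappa>:]" by (metis dvd_triv_left)
    then have "degree (evp (shift x p) 0) = 0"
      using assms(2) dvd_imp_degree_le by fastforce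
    then have "poly (evp (shift x p) 0) 1 = poly (evp (shift x p) 0) 0"
      by (metis degree_0_id poly_const_conv)
    then show ?thesis by (simp add: poly_evp)
  qed
  then have 1: "p = mpoly_const (mpoly_eval p 0)"
    by (intro mpoly_eval_inject) simp
  moreover have "mpoly_eval p 0 \<noteq> 0"
    using 1 assms by (metis mpoly_const_eq_0_iff mult_zero_left)
  ultimately show ?thesis using that by blast
qed

text \<open>In such a direction the degree in z is the same for every x, no root escapes to infinity
  over a bounded set of x, and division by \<open>shift u p\<close> needs no denominators.\<close>

definition good_dir :: "complex ^ 'n::{finite,linorder} \<Rightarrow> 'n mpoly \<Rightarrow> bool" where
  "good_dir u p \<longleftrightarrow> (\<exists>\<kappa>. \<kappa> \<noteq> 0 \<and> lead_coeff (shift u p) = mpoly_const \<kappa>)"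

lemma coeff_mult_degree_bounds:
  fixes f g :: "'a::comm_ring_1 poly"
  assumes "degree f \<le> a" "degree g \<le> b"
  shows "coeff (f * g) (a + b) = coeff f a * coeff g b"
proof -
  have "coeff (f * g) (a + b) = (\<Sum>i\<le>a + b. if i = a then coeff f i * coeff g (a + b - i) else 0)"
    unfolding coeff_mult
  proof (intro sum.cong refl)
    fix i assume "i \<in> {..a + b}"
    then consider "i = a" | "i > a" | "i < a" "a + b - i > b" by force
    then show "coeff f i * coeff g (a + b - i) = (if i = a then coeff f i * coeff g (a + b - i) else 0)"
      using assms by cases (auto simp: coeff_eq_0)
  qed
  then show ?thesis by simp
qed

text \<open>\<open>H\<close> is the homogeneous part of highest total degree \<open>N\<close>: the
  coefficient of z^N in p(X + z u) is the constant H(u). The result is phrased with a polynomial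
  \<open>H\<close> because good directions have to be perturbed later.\<close>

lemma good_dir_exists:
  fixes p :: "'n::{finite,linorder} mpoly"
  assumes "p \<noteq> 0"
  shows "\<exists>H. H \<noteq> 0 \<and> (\<forall>u. mpoly_eval H u \<noteq> 0 \<longrightarrow> good_dir u p)"
proof -
  define td where "td = (\<lambda>m::'n \<Rightarrow>\<^sub>0 nat. \<Sum>i\<in>UNIV. Poly_Mapping.lookup m i)"
  define N where "N = Max (td ` Poly_Mapping.keys p)"
  define K where "K = {m \<in> Poly_Mapping.keys p. td m = N}"
  define H where "H = (\<Sum>m\<in>K. Poly_Mapping.single m (Poly_Mapping.lookup p m))"
  have keys: "Poly_Mapping.keys p \<noteq> {}" using assms by simp
  then have "N \<in> td ` Poly_Mapping.keys p" unfolding N_def by (intro Max_in) auto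
  then obtain m0 where m0: "m0 \<in> K" by (auto simp: K_def)
  have "finite K" by (simp add: K_def)
  then have "Poly_Mapping.lookup H m0 = Poly_Mapping.lookup p m0"
    using m0 by (simp add: H_def lookup_sum lookup_single when_def)
  then have "H \<noteq> 0" using m0 by (auto simp: K_def in_keys_iff)
  moreover have "good_dir u p" if u: "mpoly_eval H u \<noteq> 0" for u
  proof -
    define L where "L = (\<lambda>i. [:mpoly_X i, mpoly_const (u $ i):] :: 'n mpoly poly)"
    \<comment> \<open>Only a degree bound and the coefficient at that bound are tracked, since the
      degree itself drops when \<open>u $ i = 0\<close>.\<close>
    have pw: "degree (L i ^ k) \<le> k \<and> coeff (L i ^ k) k = mpoly_const ((u $ i) ^ k)" for i k
    proof (induction k)
      case (Suc k)
      have "degree (L i) \<le> 1" by (simp add: L_def)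
      then have "degree (L i * L i ^ k) \<le> 1 + k"
        using Suc by (meson add_mono degree_mult_le order_trans)
      moreover have "coeff (L i * L i ^ k) (1 + k) = coeff (L i) 1 * coeff (L i ^ k) k"
        using Suc \<open>degree (L i) \<le> 1\<close> by (intro coeff_mult_degree_bounds) auto
      ultimately show ?case using Suc by (simp add: L_def mult_single)
    qed simp
    have pr: "degree (\<Prod>i\<in>A. L i ^ Poly_Mapping.lookup m i) \<le> (\<Sum>i\<in>A. Poly_Mapping.lookup m i) \<and>
        coeff (\<Prod>i\<in>A. L i ^ Poly_Mapping.lookup m i) (\<Sum>i\<in>A. Poly_Mapping.lookup m i) =
        mpoly_const (\<Prod>i\<in>A. (u $ i) ^ Poly_Mapping.lookup m i)" if "finite A" for A and m :: "'n \<Rightarrow>\<^sub>0 nat"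
      using that
    proof induction
      case (insert i A)
      have "degree (L i ^ Poly_Mapping.lookup m i * (\<Prod>i\<in>A. L i ^ Poly_Mapping.lookup m i)) \<le>
        Poly_Mapping.lookup m i + (\<Sum>i\<in>A. Poly_Mapping.lookup m i)"
        using insert.IH pw by (meson add_mono degree_mult_le order_trans)
      moreover have "coeff (L i ^ Poly_Mapping.lookup m i * (\<Prod>i\<in>A. L i ^ Poly_Mapping.lookup m i))
        (Poly_Mapping.lookup m i + (\<Sum>i\<in>A. Poly_Mapping.lookup m i)) =
        coeff (L i ^ Poly_Mapping.lookup m i) (Poly_Mapping.lookup m i) *
        coeff (\<Prod>i\<in>A. L i ^ Poly_Mapping.lookup m i) (\<Sum>i\<in>A. Poly_Mapping.lookup m i)"
        using insert.IH pw by (intro coeff_mult_degree_bounds) auto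
      ultimately show ?case using insert pw by (simp add: mult_single)
    qed auto
    have td: "td m \<le> N" if "m \<in> Poly_Mapping.keys p" for m
      using that by (auto simp: N_def)
    have sh: "shift u p = (\<Sum>m\<in>Poly_Mapping.keys p. smult (mpoly_const (Poly_Mapping.lookup p m))
        (\<Prod>i\<in>UNIV. L i ^ Poly_Mapping.lookup m i))"
      by (simp add: shift_def msubst_def L_def)
    have d: "degree (shift u p) \<le> N"
      unfolding sh
      by (intro degree_sum_le) (auto intro!: order_trans[OF degree_smult_le] order_trans[OF conjunct1[OF pr]] td[unfolded td_def])
    have "coeff (shift u p) N = (\<Sum>m\<in>Poly_Mapping.keys p. mpoly_const (Poly_Mapping.lookup p m) *
        coeff (\<Prod>i\<in>UNIV. L i ^ Poly_Mapping.lookup m i) N)"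
      unfolding sh by (simp add: coeff_sum)
    also have "\<dots> = (\<Sum>m\<in>K. mpoly_const (Poly_Mapping.lookup p m) *
        mpoly_const (\<Prod>i\<in>UNIV. (u $ i) ^ Poly_Mapping.lookup m i))"
    proof (rule sum.mono_neutral_cong_right)
      show "\<forall>m\<in>Poly_Mapping.keys p - K. mpoly_const (Poly_Mapping.lookup p m) *
        coeff (\<Prod>i\<in>UNIV. L i ^ Poly_Mapping.lookup m i) N = 0"
      proof
        fix m assume m: "m \<in> Poly_Mapping.keys p - K"
        then have "td m < N" using td[of m] by (auto simp: K_def)
        then have "degree (\<Prod>i\<in>UNIV. L i ^ Poly_Mapping.lookup m i) < N"
          using pr[of UNIV m] by (auto simp: td_def)
        then show "mpoly_const (Poly_Mapping.lookup p m) *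
        coeff (\<Prod>i\<in>UNIV. L i ^ Poly_Mapping.lookup m i) N = 0" by (simp add: coeff_eq_0)
      qed
      show "mpoly_const (Poly_Mapping.lookup p m) * coeff (\<Prod>i\<in>UNIV. L i ^ Poly_Mapping.lookup m i) N =
        mpoly_const (Poly_Mapping.lookup p m) * mpoly_const (\<Prod>i\<in>UNIV. (u $ i) ^ Poly_Mapping.lookup m i)"
        if "m \<in> K" for m
        using pr[of UNIV m] that by (auto simp: K_def td_def)
    qed (auto simp: K_def)
    also have "\<dots> = mpoly_const (mpoly_eval H u)"
    proof -
      have "mpoly_eval H u = (\<Sum>m\<in>K. Poly_Mapping.lookup p m * (\<Prod>i\<in>UNIV. (u $ i) ^ Poly_Mapping.lookup m i))"
        by (simp add: H_def mpoly_eval_msubst ceval.msubst_sum ceval.msubst_single)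
      moreover have "mpoly_const (sum f A) = (\<Sum>a\<in>A. mpoly_const (f a) :: 'n mpoly)" for f and A :: "('n \<Rightarrow>\<^sub>0 nat) set"
        by (induction A rule: infinite_finite_induct) (auto simp: single_add)
      ultimately show ?thesis by (simp add: mult_single)
    qed
    finally have c: "coeff (shift u p) N = mpoly_const (mpoly_eval H u)" .
    then have "degree (shift u p) = N"
      using d u by (intro antisym le_degree) auto
    then show ?thesis using c u by (auto simp: good_dir_def)
  qed
  ultimately show ?thesis by blast
qed

section \<open>Irreducible polynomials are prime\<close>

text \<open>Leading coefficients multiply, and a factor of a nonzero constant is a constant. Hence a
  direction that is good for P is good for each of its irreducible factors.\<close>

lemma good_dir_mult_iff: "good_dir u (p * q) \<longleftrightarrow> good_dir u p \<and> good_dir u q"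
proof
  assume "good_dir u (p * q)"
  then obtain \<kappa> where *: "lead_coeff (shift u p) * lead_coeff (shift u q) = mpoly_const \<kappa>" "\<kappa> \<noteq> 0"
    by (auto simp: good_dir_def lead_coeff_mult)
  from mult_eq_const_imp_const[OF *] mult_eq_const_imp_const[OF *[unfolded mult.commute[of "lead_coeff (shift u p)"]]]
  show "good_dir u p \<and> good_dir u q"
    unfolding good_dir_def by metis
next
  assume "good_dir u p \<and> good_dir u q"
  then obtain \<kappa> \<mu> where "\<kappa> \<noteq> 0" "\<mu> \<noteq> 0" "lead_coeff (shift u p) = mpoly_const \<kappa>" "lead_coeff (shift u q) = mpoly_const \<mu>"
    by (auto simp: good_dir_def)
  then show "good_dir u (p * q)"
    by (auto simp: good_dir_def lead_coeff_mult mult_single intro!: exI[of _ "\<kappa> * \<mu>"])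
qed

lemma good_dir_prod: "finite A \<Longrightarrow> good_dir u (\<Prod>i\<in>A. f i) \<Longrightarrow> i \<in> A \<Longrightarrow> good_dir u (f i)"
  by (subst (asm) prod.remove) (auto simp: good_dir_mult_iff)

section \<open>Division by polynomials in z with constant leading coefficient\<close>

lemma lead_const_evp:
  assumes "lead_coeff g = mpoly_const \<kappa>" "\<kappa> \<noteq> 0"
  shows "degree (evp g x) = degree g" "lead_coeff (evp g x) = \<kappa>"
proof -
  have "coeff (evp g x) (degree g) = \<kappa>" using assms by simp
  then show "degree (evp g x) = degree g"
    using le_degree[of "evp g x" "degree g"] degree_evp_le[of g x] assms(2) by auto
  then show "lead_coeff (evp g x) = \<kappa>" using assms by simp
qed

text \<open>Pseudo-division multiplies \<open>f\<close> by a power of the leading coefficient of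
  \<open>g\<close>; here that power is a nonzero constant and can be divided out again.\<close>

lemma division_by_unit_lead:
  fixes f g :: "'n::{finite,linorder} mpoly poly"
  assumes "lead_coeff g = mpoly_const \<kappa>" "\<kappa> \<noteq> 0"
  obtains q r where "f = g * q + r" "r = 0 \<or> degree r < degree g"
proof -
  have "g \<noteq> 0" using assms by auto
  obtain q r where qr: "pseudo_divmod f g = (q, r)" by fastforce
  define n where "n = Suc (degree f) - degree g"
  have 1: "smult (mpoly_const (\<kappa> ^ n)) f = g * q + r"
    using pseudo_divmod(1)[OF \<open>g \<noteq> 0\<close> qr] assms by (simp add: mpoly_const_power n_def)
  have "f = smult (mpoly_const (1 / \<kappa> ^ n)) (smult (mpoly_const (\<kappa> ^ n)) f)"
    using assms by (simp add: mult_single)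
  also have "\<dots> = g * smult (mpoly_const (1 / \<kappa> ^ n)) q + smult (mpoly_const (1 / \<kappa> ^ n)) r"
    by (simp add: 1 smult_add_right)
  finally show ?thesis
    using pseudo_divmod(2)[OF \<open>g \<noteq> 0\<close> qr] assms
    by (intro that[of "smult (mpoly_const (1 / \<kappa> ^ n)) q" "smult (mpoly_const (1 / \<kappa> ^ n)) r"]) auto
qed

lemma mpoly_eq_0_if_generic:
  fixes c D :: "'n::{finite,linorder} mpoly"
  assumes "D \<noteq> 0" "\<And>x. mpoly_eval D x \<noteq> 0 \<Longrightarrow> mpoly_eval c x = 0"
  shows "c = 0"
proof -
  have "c * D = 0"
    using assms(2) by (intro mpoly_eval_inject) auto
  with assms(1) show ?thesis by simp
qed

text \<open>The degree of \<open>evp g x\<close> does not depend on x, so the remainder of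
  \<open>f\<close> modulo \<open>g\<close> specialises to the remainder of \<open>evp f x\<close>.
  It vanishes off the zeros of \<open>D\<close>, hence identically.\<close>

lemma dvd_if_generic_evp_dvd:
  fixes f g :: "'n::{finite,linorder} mpoly poly"
  assumes g: "lead_coeff g = mpoly_const \<kappa>" "\<kappa> \<noteq> 0" and D: "D \<noteq> 0"
    and dvd: "\<And>x. mpoly_eval D x \<noteq> 0 \<Longrightarrow> evp g x dvd evp f x"
  shows "g dvd f"
proof -
  obtain q r where f: "f = g * q + r" and r: "r = 0 \<or> degree r < degree g"
    by (rule division_by_unit_lead[OF g, of f])
  have "evp r x = 0" if "mpoly_eval D x \<noteq> 0" for x
  proof (rule ccontr)
    assume *: "evp r x \<noteq> 0"
    have "evp f x = evp g x * evp q x + evp r x" by (simp add: f)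
    with dvd[OF that] have "evp g x dvd evp r x"
      by (simp add: dvd_add_right_iff)
    then have "degree g \<le> degree (evp r x)"
      using dvd_imp_degree_le[OF _ *] lead_const_evp(1)[OF g] by metis
    with r degree_evp_le[of r x] * show False by auto
  qed
  then have "coeff r n = 0" for n
    by (intro mpoly_eq_0_if_generic[OF D]) (metis coeff_0 coeff_evp)
  then have "r = 0" by (intro poly_eqI) simp
  then show ?thesis using f by simp
qed

lemma dvd_if_shift_dvd:
  assumes "shift u c dvd shift u a"
  shows "c dvd a"
proof -
  obtain k where "shift u a = shift u c * k" using assms by (rule dvdE)
  then have "poly (shift u a) 0 = poly (shift u c) 0 * poly k 0" by simp
  then show ?thesis by simp
qed

text \<open>Growth decides divisibility: on a line in a good direction the bound has a continuous
  majorant, so the case of one variable applies there and lifts. This is used where a quotient is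
  known only through estimates on its values.\<close>

lemma mpoly_dvd_if_bounded:
  fixes a c :: "'n::{finite,linorder} mpoly"
  assumes "c \<noteq> 0" "poly_growth C" "\<And>x. norm (mpoly_eval a x) \<le> C x * norm (mpoly_eval c x)"
  shows "c dvd a"
proof -
  obtain K N where C: "\<And>x. \<bar>C x\<bar> \<le> K * (1 + norm x ^ 2) ^ N"
    using assms(2) unfolding poly_growth_def by blast
  obtain u where "good_dir u c"
    using good_dir_exists[OF assms(1)] mpoly_eval_inject[of _ 0] by force
  then obtain \<kappa> where \<kappa>: "lead_coeff (shift u c) = mpoly_const \<kappa>" "\<kappa> \<noteq> 0"
    by (auto simp: good_dir_def)
  have "evp (shift u c) x dvd evp (shift u a) x" for x
  proof (rule poly_dvd_if_bounded)
    show "evp (shift u c) x \<noteq> 0"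
      using lead_const_evp(2)[OF \<kappa>, of x] \<kappa>(2) by (metis leading_coeff_0_iff)
    show "continuous_on UNIV (\<lambda>z. K * (1 + norm (x + z *s u) ^ 2) ^ N)"
      by (intro continuous_intros)
    fix z
    have "norm (mpoly_eval a (x + z *s u)) \<le> C (x + z *s u) * norm (mpoly_eval c (x + z *s u))"
      by (rule assms(3))
    also have "\<dots> \<le> (K * (1 + norm (x + z *s u) ^ 2) ^ N) * norm (mpoly_eval c (x + z *s u))"
      using C[of "x + z *s u"] by (intro mult_right_mono) auto
    finally show "norm (poly (evp (shift u a) x) z) \<le>
       (K * (1 + norm (x + z *s u) ^ 2) ^ N) * norm (poly (evp (shift u c) x) z)"
      by (simp add: poly_evp)
  qed
  then have "shift u c dvd shift u a"
    by (intro dvd_if_generic_evp_dvd[OF \<kappa>, of 1]) auto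
  then show ?thesis by (rule dvd_if_shift_dvd)
qed

lemma ev2_altdef: "ev2 f x z = (\<Sum>k\<le>degree f. mpoly_eval (coeff f k) x * z ^ k)"
  unfolding ev2_def poly_altdef by (simp add: mpoly_const_power)

text \<open>Cauchy's bound: for |z| > 1 the lower terms are at most their coefficients times |z|^(d
  - 1), and they have to balance the leading term. As the leading coefficient is constant, the bound
  grows polynomially in x.\<close>

lemma roots_bound:
  fixes g :: "'n::{finite,linorder} mpoly poly"
  assumes g: "lead_coeff g = mpoly_const \<kappa>" "\<kappa> \<noteq> 0"
  shows "\<exists>K N. K \<ge> 0 \<and> (\<forall>x z. ev2 g x z = 0 \<longrightarrow> norm z \<le> K * (1 + norm x ^ 2) ^ N)"
proof -
  define C where "C = (\<lambda>x. 1 + (1 / norm \<kappa>) * (\<Sum>k<degree g. norm (mpoly_eval (coeff g k) x)))"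
  have "poly_growth C"
    unfolding C_def by (intro poly_growth_add poly_growth_mult poly_growth_sum poly_growth_mpoly poly_growth_const)
  then obtain K N where K: "K \<ge> 0" "\<And>x. \<bar>C x\<bar> \<le> K * (1 + norm x ^ 2) ^ N"
    unfolding poly_growth_def by blast
  have "norm z \<le> C x" if z: "ev2 g x z = 0" for x z
  proof (cases "norm z \<le> 1")
    case True
    have "0 \<le> (1 / norm \<kappa>) * (\<Sum>k<degree g. norm (mpoly_eval (coeff g k) x))"
      by (intro mult_nonneg_nonneg sum_nonneg) auto
    with True show ?thesis unfolding C_def by linarith
  next
    case False
    define d where "d = degree g"
    have "0 = (\<Sum>k<d. mpoly_eval (coeff g k) x * z ^ k) + \<kappa> * z ^ d"
      using z g unfolding ev2_altdef d_def by (simp flip: lessThan_Suc_atMost)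
    then have eq: "\<kappa> * z ^ d = - (\<Sum>k<d. mpoly_eval (coeff g k) x * z ^ k)"
      by (simp add: eq_neg_iff_add_eq_0 add.commute)
    have "d \<noteq> 0" using eq g by (intro notI) simp
    have "norm \<kappa> * norm z ^ d = norm (\<Sum>k<d. mpoly_eval (coeff g k) x * z ^ k)"
      using arg_cong[OF eq, of norm] by (simp add: norm_mult norm_power)
    also have "\<dots> \<le> (\<Sum>k<d. norm (mpoly_eval (coeff g k) x) * norm z ^ (d - 1))"
      using False by (intro order_trans[OF norm_sum] sum_mono)
        (auto simp: norm_mult norm_power intro!: mult_left_mono power_increasing)
    also have "\<dots> = (\<Sum>k<d. norm (mpoly_eval (coeff g k) x)) * norm z ^ (d - 1)"
      by (simp add: sum_distrib_right)
    finally have "norm \<kappa> * norm z * norm z ^ (d - 1) \<le> (\<Sum>k<d. norm (mpoly_eval (coeff g k) x)) * norm z ^ (d - 1)"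
      using \<open>d \<noteq> 0\<close> by (simp add: power_eq_if mult_ac)
    moreover have "norm z ^ (d - 1) > 0" using False by (intro zero_less_power) linarith
    ultimately have "norm \<kappa> * norm z \<le> (\<Sum>k<d. norm (mpoly_eval (coeff g k) x))"
      by simp
    then show ?thesis using g by (simp add: C_def d_def field_simps add_increasing)
  qed
  then show ?thesis using K by (meson abs_ge_self order_trans)
qed

text \<open>For fixed \<open>x\<close> the product of \<open>f(x - t u, t)\<close> and \<open>g(x - t u, t)\<close> is the constant \<open>Q(x)\<close>, so both are
  constant in \<open>t\<close>.\<close>

lemma shift_factor:
  fixes Q :: "'n::{finite,linorder} mpoly"
  assumes fg: "f * g = shift u Q" and Q: "Q \<noteq> 0"
  shows "f = shift u (poly f 0)"
proof -
  have poly: "\<exists>F. \<forall>t. poly F t = ev2 h (x - t *s u) t" for h :: "'n mpoly poly" and x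
  proof -
    \<comment> \<open>Along x - t u each coefficient of \<open>h\<close> is a polynomial in t, so
      the whole expression is one.\<close>
    have "poly (\<Sum>k\<le>degree h. evp (shift (- u) (coeff h k)) x * monom 1 k) t = ev2 h (x - t *s u) t" for t
    proof -
      have "x + t *s (- u) = x - t *s u" by (simp add: vec_eq_iff)
      then show ?thesis unfolding ev2_altdef by (simp add: poly_sum poly_evp poly_monom)
    qed
    then show ?thesis by blast
  qed
  have const: "ev2 f (x - t *s u) t = ev2 f x 0" if x: "mpoly_eval Q x \<noteq> 0" for x t
  proof -
    obtain F where F: "\<And>t. poly F t = ev2 f (x - t *s u) t" using poly by blast
    obtain G where G: "\<And>t. poly G t = ev2 g (x - t *s u) t" using poly by blast
    have "F * G = [:mpoly_eval Q x:]"
    proof (rule poly_ext)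
      fix t
      have "poly (F * G) t = ev2 (shift u Q) (x - t *s u) t"
        by (simp add: F G flip: fg)
      then show "poly (F * G) t = poly [:mpoly_eval Q x:] t" by simp
    qed
    then have "F dvd [:mpoly_eval Q x:]" by (metis dvd_triv_left)
    then have "degree F = 0"
      using x dvd_imp_degree_le by fastforce
    then have "poly F t = poly F 0"
      by (metis degree_0_id poly_const_conv)
    then show ?thesis by (simp add: F)
  qed
  \<comment> \<open>The factor \<open>shift u Q\<close> makes the identity trivial at the points
    where \<open>Q\<close> vanishes and constancy in t is not known.\<close>
  have "(f - shift u (poly f 0)) * shift u Q = 0"
  proof (rule ev2_inject)
    fix y t
    have "ev2 f y t = mpoly_eval (poly f 0) (y + t *s u)" if "mpoly_eval Q (y + t *s u) \<noteq> 0"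
      using const[OF that, of t] by (simp add: ev2_def)
    then show "ev2 ((f - shift u (poly f 0)) * shift u Q) y t = ev2 0 y t" by auto
  qed
  moreover have "shift u Q \<noteq> 0" using Q by (metis poly_0 poly_shift_0)
  ultimately show ?thesis by simp
qed

lemma degree_shift_pos:
  assumes "irreducible Q" "good_dir u Q"
  shows "degree (shift u Q) > 0"
proof (rule ccontr)
  assume "\<not> degree (shift u Q) > 0"
  then have *: "degree (shift u Q) = 0" by simp
  obtain \<kappa> where \<kappa>: "lead_coeff (shift u Q) = mpoly_const \<kappa>" "\<kappa> \<noteq> 0"
    using assms(2) by (auto simp: good_dir_def)
  have "shift u Q = [:mpoly_const \<kappa>:]"
    using * \<kappa> by (metis degree_0_id)
  then have "Q = mpoly_const \<kappa>" by (metis poly_shift_0 poly_const_conv)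
  then show False using assms(1) \<kappa>(2) const_dvd_one by (metis irreducible_not_unit)
qed

text \<open>Take a nonzero element \<open>h\<close> of minimal degree in the ideal generated by the two shifted polynomials.
  If \<open>h\<close> is not constant in \<open>z\<close>, its roots are among those of the shifted \<open>Q\<close>; the resulting bound on
  its coefficients shows that the leading coefficient divides \<open>h\<close>. This replaces the lemma of Gauss.\<close>

lemma dichotomy:
  fixes Q B :: "'n::{finite,linorder} mpoly"
  assumes irr: "irreducible Q" and good: "good_dir u Q"
  shows "Q dvd B \<or> (\<exists>U W D. D \<noteq> 0 \<and> [:D:] = U * shift u Q + W * shift u B)"
proof -
  define q where "q = shift u Q"
  define b where "b = shift u B"
  obtain \<kappa> where \<kappa>: "lead_coeff q = mpoly_const \<kappa>" "\<kappa> \<noteq> 0"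
    using good by (auto simp: good_dir_def q_def)
  have "Q \<noteq> 0" using irr by auto
  have "q \<noteq> 0" using \<kappa> by auto
  define I where "I = {U * q + W * b | U W. True}"
  have Ismult: "f - k * h \<in> I" if fh: "f \<in> I" "h \<in> I" for f h k
  proof -
    obtain U W U' W' where "f = U * q + W * b" "h = U' * q + W' * b"
      using fh by (auto simp: I_def)
    then have "f - k * h = (U - k * U') * q + (W - k * W') * b"
      by (simp add: algebra_simps)
    then show ?thesis unfolding I_def by blast
  qed
  have qI: "q \<in> I"
    unfolding I_def by (rule CollectI, rule exI[of _ 1], rule exI[of _ 0]) simp
  have bI: "b \<in> I"
    unfolding I_def by (rule CollectI, rule exI[of _ 0], rule exI[of _ 1]) simp
  have 0: "0 \<in> I"
    unfolding I_def by (rule CollectI, rule exI[of _ 0], rule exI[of _ 0]) simp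
  obtain h where h: "h \<in> I" "h \<noteq> 0" and min: "\<And>f. f \<in> I \<Longrightarrow> f \<noteq> 0 \<Longrightarrow> degree h \<le> degree f"
    using ex_has_least_nat[of "\<lambda>f. f \<in> I \<and> f \<noteq> 0" q degree] qI \<open>q \<noteq> 0\<close> by auto
  show ?thesis
  proof (cases "degree h = 0")
    case True
    then obtain D where "h = [:D:]" by (metis degree_0_id)
    then show ?thesis using h by (auto simp: I_def q_def b_def)
  next
    case False
    define lh where "lh = lead_coeff h"
    have lh: "lh \<noteq> 0" using h by (simp add: lh_def)
    \<comment> \<open>The pseudo-remainder stays in the ideal and has smaller degree than
      \<open>h\<close>, so it is 0 by minimality: \<open>h\<close> divides each element of the ideal
      up to a nonzero factor free of z.\<close>
    have div: "\<exists>c k. c \<noteq> 0 \<and> smult c f = h * k" if f: "f \<in> I" for f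
    proof -
      obtain k r where kr: "pseudo_divmod f h = (k, r)" by fastforce
      define n where "n = Suc (degree f) - degree h"
      have 1: "smult (lh ^ n) f = h * k + r"
        using pseudo_divmod(1)[OF h(2) kr] by (simp add: n_def lh_def)
      have "[:lh ^ n:] * f \<in> I"
        using Ismult[OF 0 f, of "- [:lh ^ n:]"] by simp
      from Ismult[OF this h(1), of k] have "r \<in> I"
        using 1 by (simp add: algebra_simps)
      then have "r = 0" using pseudo_divmod(2)[OF h(2) kr] min by force
      then show ?thesis using 1 lh by (intro exI[of _ "lh ^ n"] exI[of _ k]) auto
    qed
    obtain c k where c: "c \<noteq> 0" "smult c q = h * k" using div[OF qI] by blast
    obtain c' k' where c': "c' \<noteq> 0" "smult c' b = h * k'" using div[OF bI] by blast
    have evq: "evp h x dvd evp q x" if "mpoly_eval c x \<noteq> 0" for x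
      using arg_cong[OF c(2), of "\<lambda>f. evp f x"] that by (metis dvd_smult_iff dvd_triv_left evp_mult evp_smult)
    have evb: "evp h x dvd evp b x" if "mpoly_eval c' x \<noteq> 0" for x
      using arg_cong[OF c'(2), of "\<lambda>f. evp f x"] that by (metis dvd_smult_iff dvd_triv_left evp_mult evp_smult)
    obtain K N where K: "K \<ge> 0" "\<And>x z. ev2 q x z = 0 \<Longrightarrow> norm z \<le> K * (1 + norm x ^ 2) ^ N"
      using roots_bound[OF \<kappa>] by blast
    have "lh dvd coeff h i" for i
    proof -
      \<comment> \<open>With the extra factor \<open>c * lh\<close> both sides vanish at the points
        where the degree of \<open>evp h x\<close> may drop or its roots may not be roots of
        \<open>evp q x\<close>.\<close>
      have "c * lh * lh dvd c * lh * coeff h i"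
      proof (rule mpoly_dvd_if_bounded)
        show "poly_growth (\<lambda>x::complex^'n::{finite,linorder}. (1 + K * (1 + norm x ^ 2) ^ N) ^ degree h)"
          by (intro poly_growth_power poly_growth_add poly_growth_mult poly_growth_const poly_growth_nu)
        fix x
        show "norm (mpoly_eval (c * lh * coeff h i) x) \<le> (1 + K * (1 + norm x ^ 2) ^ N) ^ degree h * norm (mpoly_eval (c * lh * lh) x)"
        proof (cases "mpoly_eval (c * lh) x = 0")
          case True
          then show ?thesis by auto
        next
          case False
          then have deg: "degree (evp h x) = degree h"
            using degree_evp_le[of h x] le_degree[of "evp h x" "degree h"] by (auto simp: lh_def)
          have "norm (coeff (evp h x) i) \<le> norm (lead_coeff (evp h x)) * (1 + K * (1 + norm x ^ 2) ^ N) ^ degree (evp h x)"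
          proof (rule coeff_le_roots_bound)
            fix z assume "poly (evp h x) z = 0"
            then have "poly (evp q x) z = 0"
              using evq[of x] False by (auto simp: dvd_def)
            then show "norm z \<le> K * (1 + norm x ^ 2) ^ N" using K(2) by (simp add: poly_evp)
          qed (use K in auto)
          from mult_left_mono[OF this, of "norm (mpoly_eval (c * lh) x)"] show ?thesis
            unfolding deg by (simp add: norm_mult lh_def mult_ac)
        qed
      qed (use c lh in auto)
      then show ?thesis using c lh by (simp add: dvd_times_left_cancel_iff mult.assoc)
    qed
    then have "[:lh:] dvd h" by (simp add: const_poly_dvd_iff)
    then obtain g where g: "h = [:lh:] * g" by (rule dvdE)
    then have hg: "h = smult lh g" by simp
    have "lead_coeff h = lh * lead_coeff g" by (simp add: hg lh)
    then have "lh * lead_coeff g = lh" by (simp add: lh_def)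
    then have lg: "lead_coeff g = mpoly_const 1" using lh by simp
    have gq: "g dvd q"
    proof (rule dvd_if_generic_evp_dvd[OF lg])
      show "c * lh \<noteq> 0" using c lh by simp
      fix x assume "mpoly_eval (c * lh) x \<noteq> 0"
      then show "evp g x dvd evp q x" using evq[of x] by (simp add: hg smult_dvd_iff)
    qed simp
    have gb: "g dvd b"
    proof (rule dvd_if_generic_evp_dvd[OF lg])
      show "c' * lh \<noteq> 0" using c' lh by simp
      fix x assume "mpoly_eval (c' * lh) x \<noteq> 0"
      then show "evp g x dvd evp b x" using evb[of x] by (simp add: hg smult_dvd_iff)
    qed simp
    obtain k1 where k1: "q = g * k1" using gq by (rule dvdE)
    obtain k2 where k2: "b = g * k2" using gb by (rule dvdE)
    \<comment> \<open>A factor of a shifted polynomial is itself shifted, so \<open>g\<close> comes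
      from a factor \<open>poly g 0\<close> of both \<open>Q\<close> and \<open>B\<close>. It is not
      a unit, so irreducibility makes it an associate of \<open>Q\<close>.\<close>
    have sg: "g = shift u (poly g 0)"
      by (rule shift_factor[of g k1 u Q]) (use k1 \<open>Q \<noteq> 0\<close> in \<open>auto simp: q_def\<close>)
    have Qg: "Q = poly g 0 * poly k1 0" and Bg: "B = poly g 0 * poly k2 0"
      using arg_cong[OF k1, of "\<lambda>f. poly f 0"] arg_cong[OF k2, of "\<lambda>f. poly f 0"] by (auto simp: q_def b_def)
    have "\<not> poly g 0 dvd 1"
    proof
      assume "poly g 0 dvd 1"
      then obtain e where "poly g 0 * e = mpoly_const 1" by (auto elim!: dvdE)
      then obtain a where "poly g 0 = mpoly_const a" using mult_eq_const_imp_const by (metis zero_neq_one)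
      then have "degree g = 0" by (subst sg) simp
      then show False using False hg lh by simp
    qed
    then have "poly k1 0 dvd 1"
      using irr Qg by (meson irreducibleD)
    then obtain e where "1 = poly k1 0 * e" by (rule dvdE)
    then have "poly g 0 = Q * e" by (metis Qg mult.assoc mult.right_neutral)
    then have "Q dvd B" by (metis Bg dvd_triv_left mult.assoc)
    then show ?thesis by blast
  qed
qed

text \<open>If \<open>Q\<close> divided neither \<open>A\<close> nor \<open>B\<close>, then
  \<open>dichotomy\<close> would give nonzero \<open>D\<close> and \<open>D'\<close> free of z whose
  product is a multiple of \<open>shift u Q\<close>, a polynomial of positive degree in z.\<close>

lemma irreducible_mpoly_prime:
  fixes Q :: "'n::{finite,linorder} mpoly"
  assumes irr: "irreducible Q" and AB: "Q dvd A * B"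
  shows "Q dvd A \<or> Q dvd B"
proof (rule ccontr)
  assume *: "\<not> (Q dvd A \<or> Q dvd B)"
  have "Q \<noteq> 0" using irr by auto
  then obtain u where u: "good_dir u Q"
    using good_dir_exists mpoly_eval_inject[of _ 0] by force
  obtain U W D where 1: "D \<noteq> 0" "[:D:] = U * shift u Q + W * shift u A"
    using dichotomy[OF irr u] * by blast
  obtain U' W' D' where 2: "D' \<noteq> 0" "[:D':] = U' * shift u Q + W' * shift u B"
    using dichotomy[OF irr u] * by blast
  obtain k where k: "A * B = Q * k" using AB by (rule dvdE)
  have kk: "shift u A * shift u B = shift u Q * shift u k"
    using arg_cong[OF k, of "shift u"] by simp
  have "[:D * D':] = [:D:] * [:D':]" by simp
  also have "\<dots> = shift u Q * (U * U' * shift u Q + U * W' * shift u B + U' * W * shift u A)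
    + W * W' * (shift u A * shift u B)"
    unfolding 1(2) 2(2) by (simp add: algebra_simps)
  finally have "shift u Q dvd [:D * D':]" unfolding kk by (metis dvd_add dvd_mult dvd_triv_left)
  then have "degree (shift u Q) \<le> 0"
    using dvd_imp_degree_le[of "shift u Q" "[:D * D':]"] 1 2 by simp
  then show False using degree_shift_pos[OF irr u] by simp
qed

section \<open>Primitives of 1-forms\<close>

definition primitive_on :: "'a::real_normed_vector set \<Rightarrow> 'a form1 \<Rightarrow> ('a \<Rightarrow> complex) \<Rightarrow> bool" where
  "primitive_on S \<omega> F \<longleftrightarrow> (\<forall>x\<in>S. (F has_derivative \<omega> x) (at x))"

definition exact_on :: "'a::real_normed_vector set \<Rightarrow> 'a form1 \<Rightarrow> bool" where
  "exact_on S \<omega> \<longleftrightarrow> (\<exists>F. primitive_on S \<omega> F)"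

text \<open>This replaces closedness throughout: it mentions no derivative of
  \<open>\<omega>\<close>, passes to pullbacks along differentiable maps, and suffices for
  gluing.\<close>

definition loc_exact :: "'a::real_normed_vector set \<Rightarrow> 'a form1 \<Rightarrow> bool" where
  "loc_exact S \<omega> \<longleftrightarrow> (\<forall>x\<in>S. \<exists>r>0. exact_on (ball x r) \<omega>)"

lemma primitive_on_subset: "primitive_on S \<omega> F \<Longrightarrow> T \<subseteq> S \<Longrightarrow> primitive_on T \<omega> F"
  unfolding primitive_on_def by blast

lemma exact_on_subset: "exact_on S \<omega> \<Longrightarrow> T \<subseteq> S \<Longrightarrow> exact_on T \<omega>"
  unfolding exact_on_def using primitive_on_subset by blast

lemma loc_exact_subset: "loc_exact S \<omega> \<Longrightarrow> T \<subseteq> S \<Longrightarrow> loc_exact T \<omega>"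
  unfolding loc_exact_def by blast

lemma primitive_on_diff:
  assumes "primitive_on S \<omega> F" "primitive_on S \<eta> G"
  shows "primitive_on S (\<lambda>x v. \<omega> x v - \<eta> x v) (\<lambda>x. F x - G x)"
  using assms unfolding primitive_on_def by (auto intro: has_derivative_diff)

lemma exact_on_diff: "exact_on S \<omega> \<Longrightarrow> exact_on S \<eta> \<Longrightarrow> exact_on S (\<lambda>x v. \<omega> x v - \<eta> x v)"
  unfolding exact_on_def using primitive_on_diff by blast

lemma loc_exact_diff:
  assumes "loc_exact S \<omega>" "loc_exact S \<eta>"
  shows "loc_exact S (\<lambda>x v. \<omega> x v - \<eta> x v)"
  unfolding loc_exact_def
proof
  fix x assume "x \<in> S"
  then obtain r q where "r > 0" "exact_on (ball x r) \<omega>" "q > 0" "exact_on (ball x q) \<eta>"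
    using assms unfolding loc_exact_def by blast
  then have "exact_on (ball x (min r q)) (\<lambda>x v. \<omega> x v - \<eta> x v)"
    by (intro exact_on_diff) (auto elim!: exact_on_subset)
  then show "\<exists>r>0. exact_on (ball x r) (\<lambda>x v. \<omega> x v - \<eta> x v)"
    using \<open>r > 0\<close> \<open>q > 0\<close> by (intro exI[of _ "min r q"]) auto
qed

lemma primitive_on_cong:
  assumes "open S" "primitive_on S \<omega> F" "\<And>x. x \<in> S \<Longrightarrow> G x = F x"
  shows "primitive_on S \<omega> G"
  using assms unfolding primitive_on_def
  by (metis has_derivative_transform_within_open)

lemma primitive_on_add_const: "primitive_on S \<omega> F \<Longrightarrow> primitive_on S \<omega> (\<lambda>x. F x + c)"
  unfolding primitive_on_def using has_derivative_add_const by blast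

section \<open>Gluing of primitives\<close>

lemma primitive_on_unique:
  assumes "open S" "connected S" "primitive_on S \<omega> F" "primitive_on S \<omega> G"
  obtains c where "\<And>x. x \<in> S \<Longrightarrow> F x = G x + c"
proof (cases "S = {}")
  case False
  then obtain a where a: "a \<in> S" by blast
  have d: "((\<lambda>x. F x - G x) has_derivative (\<lambda>v. 0)) (at x)" if "x \<in> S" for x
    using primitive_on_diff[OF assms(3,4)] that by (simp add: primitive_on_def)
  have "F x - G x = F a - G a" if "x \<in> S" for x
    by (rule has_derivative_zero_unique_connected[OF assms(1,2) d that a])
  then have "F x = G x + (F a - G a)" if "x \<in> S" for x
    using that by (metis diff_add_cancel add.commute)
  then show ?thesis using that by blast
qed (use that in auto)

text \<open>On the connected overlap the two primitives differ by a single constant, which is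
  absorbed into one of them.\<close>

lemma exact_on_Un:
  assumes "open A" "open B" "connected (A \<inter> B)" "A \<inter> B \<noteq> {}" "exact_on A \<omega>" "exact_on B \<omega>"
  shows "exact_on (A \<union> B) \<omega>"
proof -
  obtain F G where FG: "primitive_on A \<omega> F" "primitive_on B \<omega> G"
    using assms unfolding exact_on_def by blast
  obtain c where c: "\<And>x. x \<in> A \<inter> B \<Longrightarrow> F x = G x + c"
    using primitive_on_unique[of "A \<inter> B" \<omega> F G] assms FG primitive_on_subset by (metis Int_lower1 Int_lower2 open_Int)
  define H where "H = (\<lambda>x. if x \<in> A then F x else G x + c)"
  have "primitive_on A \<omega> H"
    by (rule primitive_on_cong[OF assms(1) FG(1)]) (simp add: H_def)
  moreover have "primitive_on B \<omega> H"
    by (rule primitive_on_cong[OF assms(2) primitive_on_add_const[OF FG(2), of c]]) (auto simp: H_def c)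
  ultimately show ?thesis
    unfolding exact_on_def primitive_on_def by (intro exI[of _ H]) blast
qed

text \<open>Continuation of a primitive along the segment from \<open>a\<close> to \<open>x\<close>. All sets that occur contain \<open>a\<close>
  and are convex, so their intersections stay connected after removing \<open>V\<close>.\<close>

lemma exact_on_chain:
  fixes S V :: "'a::euclidean_space set"
  assumes S: "open S" "convex S" and V: "closed V"
    and conn: "\<And>W. open W \<Longrightarrow> convex W \<Longrightarrow> W \<noteq> {} \<Longrightarrow> W \<subseteq> S \<Longrightarrow> connected (W - V) \<and> W - V \<noteq> {}"
    and loc: "\<And>x. x \<in> S \<Longrightarrow> \<exists>r>0. exact_on (ball x r - V) \<omega>"
    and ax: "a \<in> S" "x \<in> S"
  shows "\<exists>U. open U \<and> convex U \<and> U \<subseteq> S \<and> a \<in> U \<and> x \<in> U \<and> exact_on (U - V) \<omega>"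
proof -
  \<comment> \<open>A Lebesgue number \<open>\<delta>\<close> of this cover of the segment makes the
    \<open>\<delta>\<close>-balls around all its points admissible.\<close>
  define \<G> where "\<G> = {ball y r | y r. y \<in> S \<and> r > 0 \<and> ball y r \<subseteq> S \<and> exact_on (ball y r - V) \<omega>}"
  have cover: "\<exists>G\<in>\<G>. y \<in> G" if y: "y \<in> S" for y
  proof -
    obtain r where r: "r > 0" "exact_on (ball y r - V) \<omega>" using loc[OF y] by blast
    obtain q where q: "q > 0" "ball y q \<subseteq> S" using S(1) y by (meson openE)
    have "ball y (min r q) \<in> \<G>"
      unfolding \<G>_def using r q y exact_on_subset[OF r(2), of "ball y (min r q) - V"] by fastforce
    then show ?thesis using r q by (intro bexI[of _ "ball y (min r q)"]) auto
  qed
  have seg: "closed_segment a x \<subseteq> S"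
    using S(2) ax by (simp add: closed_segment_subset)
  have "closed_segment a x \<subseteq> \<Union>\<G>" using seg cover by blast
  then obtain \<delta> where \<delta>: "\<delta> > 0" "\<And>y. y \<in> closed_segment a x \<Longrightarrow> \<exists>G\<in>\<G>. ball y \<delta> \<subseteq> G"
  proof (rule Heine_Borel_lemma[OF compact_segment])
    show "open G" if "G \<in> \<G>" for G using that by (auto simp: \<G>_def)
  qed blast
  have ball: "ball y \<delta> \<subseteq> S" "exact_on (ball y \<delta> - V) \<omega>" if y: "y \<in> closed_segment a x" for y
  proof -
    obtain G where G: "G \<in> \<G>" "ball y \<delta> \<subseteq> G" using \<delta>(2)[OF y] by blast
    then show "ball y \<delta> \<subseteq> S" by (auto simp: \<G>_def)
    from G have "exact_on (G - V) \<omega>" by (auto simp: \<G>_def)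
    then show "exact_on (ball y \<delta> - V) \<omega>" using G(2) by (auto elim!: exact_on_subset)
  qed
  obtain N where N: "norm (x - a) / \<delta> < real N" using reals_Archimedean2 by blast
  have "0 \<le> norm (x - a) / \<delta>" using \<delta>(1) by simp
  with N have Npos: "0 < N" by (metis not_gr_zero of_nat_0 not_less)
  define c where "c = (\<lambda>k. a + (real k / real N) *\<^sub>R (x - a))"
  have cseg: "c k \<in> closed_segment a x" if "k \<le> N" for k
    using that Npos unfolding c_def closed_segment_image_interval
    by (intro image_eqI[of _ _ "real k / real N"]) (auto simp: algebra_simps)
  have "\<exists>U. open U \<and> convex U \<and> U \<subseteq> S \<and> a \<in> U \<and> c k \<in> U \<and> exact_on (U - V) \<omega>" if "k \<le> N" for k
    using that
  proof (induction k)
    case 0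
    have "c 0 = a" by (simp add: c_def)
    then show ?case using ball[OF cseg[OF 0]] \<delta>(1) by (intro exI[of _ "ball a \<delta>"]) auto
  next
    case (Suc k)
    then obtain U where U: "open U" "convex U" "U \<subseteq> S" "a \<in> U" "c k \<in> U" "exact_on (U - V) \<omega>" by auto
    define B where "B = ball (c k) \<delta>"
    have kseg: "c k \<in> closed_segment a x" using cseg Suc by simp
    have B: "B \<subseteq> S" "exact_on (B - V) \<omega>" using ball[OF kseg] by (auto simp: B_def)
    have "dist (c k) (c (Suc k)) = norm ((real k / real N - real (Suc k) / real N) *\<^sub>R (x - a))"
      by (simp add: c_def dist_norm scaleR_diff_left)
    also have "\<dots> = norm (x - a) / real N"
      using Npos by (simp add: diff_divide_distrib[symmetric])
    also have "\<dots> < \<delta>" using N Npos \<delta>(1) by (simp add: field_simps)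
    finally have cB: "c (Suc k) \<in> B" by (simp add: B_def)
    have ckB: "c k \<in> B" using \<delta> by (simp add: B_def)
    have UB: "connected ((U \<inter> B) - V) \<and> (U \<inter> B) - V \<noteq> {}"
      by (rule conn) (use U B ckB in \<open>auto simp: B_def convex_Int\<close>)
    have "(U - V) \<inter> (B - V) = (U \<inter> B) - V" by auto
    then have ex: "exact_on ((U - V) \<union> (B - V)) \<omega>"
      using U B UB V by (intro exact_on_Un) (auto simp: B_def open_Diff)
    have mid: "c k \<in> closed_segment a (c (Suc k))"
    proof -
      have "c k = a + (real k / real (Suc k)) *\<^sub>R (c (Suc k) - a)"
        by (simp add: c_def del: of_nat_Suc)
      then have "c k = (1 - real k / real (Suc k)) *\<^sub>R a + (real k / real (Suc k)) *\<^sub>R c (Suc k)"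
        by (simp add: algebra_simps)
      then show ?thesis
        unfolding closed_segment_image_interval
        by (intro image_eqI[of _ _ "real k / real (Suc k)"]) auto
    qed
    have "closed_segment a (c k) \<subseteq> U" using U by (simp add: closed_segment_subset)
    moreover have "closed_segment (c k) (c (Suc k)) \<subseteq> B"
      using ckB cB by (intro closed_segment_subset) (auto simp: B_def)
    ultimately have "closed_segment a (c (Suc k)) \<subseteq> U \<union> B"
      using Un_closed_segment[OF mid] by blast
    moreover have "open (U \<union> B)" using U by (auto simp: B_def)
    ultimately obtain \<epsilon> where \<epsilon>: "\<epsilon> > 0" "(\<Union>y\<in>closed_segment a (c (Suc k)). ball y \<epsilon>) \<subseteq> U \<union> B"
      using compact_subset_open_imp_ball_epsilon_subset[OF compact_segment] by metis
    \<comment> \<open>The union of \<open>U\<close> and \<open>B\<close> need not be convex. An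
      \<open>\<epsilon>\<close>-neighbourhood of the segment is a Minkowski sum of two convex sets,
      which restores convexity for the next step.\<close>
    define U' where "U' = (\<Union>y\<in>closed_segment a (c (Suc k)). ball y \<epsilon>)"
    have "U' = (\<Union>y\<in>closed_segment a (c (Suc k)). \<Union>z\<in>ball 0 \<epsilon>. {y + z})"
    proof (intro equalityI subsetI)
      fix w assume "w \<in> U'"
      then obtain y where y: "y \<in> closed_segment a (c (Suc k))" "w \<in> ball y \<epsilon>" by (auto simp: U'_def)
      then have "w = y + (w - y)" "w - y \<in> ball 0 \<epsilon>" by (auto simp: dist_norm norm_minus_commute)
      with y(1) show "w \<in> (\<Union>y\<in>closed_segment a (c (Suc k)). \<Union>z\<in>ball 0 \<epsilon>. {y + z})" by blast
    next
      fix w assume "w \<in> (\<Union>y\<in>closed_segment a (c (Suc k)). \<Union>z\<in>ball 0 \<epsilon>. {y + z})"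
      then obtain y z where yz: "y \<in> closed_segment a (c (Suc k))" "norm z < \<epsilon>" "w = y + z" by auto
      then have "w \<in> ball y \<epsilon>" by (simp add: dist_norm)
      with yz(1) show "w \<in> U'" unfolding U'_def by blast
    qed
    then have "convex U'" by (simp add: convex_sums)
    moreover have "open U'" by (auto simp: U'_def)
    moreover have "U' \<subseteq> S" using \<epsilon> U B by (auto simp: U'_def)
    moreover have "a \<in> U'" "c (Suc k) \<in> U'" using \<epsilon>(1) by (auto simp: U'_def intro: bexI[of _ a] bexI[of _ "c (Suc k)"])
    moreover have "exact_on (U' - V) \<omega>"
      using \<epsilon>(2) by (intro exact_on_subset[OF ex]) (auto simp: U'_def)
    ultimately show ?case by blast
  qed
  from this[of N] show ?thesis using Npos by (simp add: c_def)
qed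

text \<open>The primitives on the sets \<open>U x\<close> are normalised against the one on
  \<open>U a\<close>. Any of these sets contain \<open>a\<close>, so triple intersections stay
  nonempty after removing \<open>V\<close> and fix the constants consistently. Allowing
  \<open>V\<close> admits points around which a primitive exists on a punctured ball only.\<close>

lemma exact_on_glue:
  fixes S V :: "'a::euclidean_space set"
  assumes S: "open S" "convex S" and V: "closed V"
    and conn: "\<And>W. open W \<Longrightarrow> convex W \<Longrightarrow> W \<noteq> {} \<Longrightarrow> W \<subseteq> S \<Longrightarrow> connected (W - V) \<and> W - V \<noteq> {}"
    and loc: "\<And>x. x \<in> S \<Longrightarrow> \<exists>r>0. exact_on (ball x r - V) \<omega>"
  shows "exact_on (S - V) \<omega>"
proof (cases "S = {}")
  case True
  then show ?thesis by (auto simp: exact_on_def primitive_on_def)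
next
  case False
  then obtain a where a: "a \<in> S" by blast
  have "\<forall>x\<in>S. \<exists>U h. open U \<and> convex U \<and> U \<subseteq> S \<and> a \<in> U \<and> x \<in> U \<and> primitive_on (U - V) \<omega> h"
  proof
    fix x assume x: "x \<in> S"
    have "\<exists>U. open U \<and> convex U \<and> U \<subseteq> S \<and> a \<in> U \<and> x \<in> U \<and> exact_on (U - V) \<omega>"
      by (rule exact_on_chain[OF S V _ _ a x]) (fact conn loc)+
    then show "\<exists>U h. open U \<and> convex U \<and> U \<subseteq> S \<and> a \<in> U \<and> x \<in> U \<and> primitive_on (U - V) \<omega> h"
      unfolding exact_on_def by blast
  qed
  then obtain U h where Uh: "\<And>x. x \<in> S \<Longrightarrow> open (U x) \<and> convex (U x) \<and> U x \<subseteq> S \<and> a \<in> U x \<and> x \<in> U x \<and> primitive_on (U x - V) \<omega> (h x)"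
    by metis
  have diff: "\<exists>c. \<forall>z\<in>(U x \<inter> U y) - V. h x z = h y z + c" if xy: "x \<in> S" "y \<in> S" for x y
  proof -
    have "connected ((U x \<inter> U y) - V) \<and> (U x \<inter> U y) - V \<noteq> {}"
      by (rule conn) (use Uh xy in \<open>auto simp: convex_Int\<close>)
    moreover have "open ((U x \<inter> U y) - V)" using Uh xy V by (auto intro: open_Diff)
    moreover have "primitive_on ((U x \<inter> U y) - V) \<omega> (h x)"
      by (rule primitive_on_subset[of "U x - V"]) (use Uh xy in auto)
    moreover have "primitive_on ((U x \<inter> U y) - V) \<omega> (h y)"
      by (rule primitive_on_subset[of "U y - V"]) (use Uh xy in auto)
    ultimately show ?thesis using primitive_on_unique by metis
  qed
  then have "\<forall>x\<in>S. \<exists>c. \<forall>z\<in>(U x \<inter> U a) - V. h x z = h a z + c" using a by blast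
  then obtain k where k: "\<And>x z. x \<in> S \<Longrightarrow> z \<in> (U x \<inter> U a) - V \<Longrightarrow> h x z = h a z + k x" by metis
  \<comment> \<open>Each point uses its own primitive, shifted so that it agrees with
    \<open>h a\<close>; the next fact shows that this agrees on \<open>U x\<close> with a single
    shifted primitive.\<close>
  define F where "F = (\<lambda>z. h z z - k z)"
  have F: "F z = h x z + (- k x)" if x: "x \<in> S" and z: "z \<in> U x - V" for x z
  proof -
    have zS: "z \<in> S" using Uh x z by blast
    obtain c where c: "\<And>y. y \<in> (U z \<inter> U x) - V \<Longrightarrow> h z y = h x y + c" using diff[OF zS x] by blast
    have "(U z \<inter> U x \<inter> U a) - V \<noteq> {}"
      by (rule conjunct2[OF conn]) (use Uh x zS a in \<open>auto intro!: convex_Int\<close>)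
    then obtain p where "p \<in> U z" "p \<in> U x" "p \<in> U a" "p \<notin> V" by blast
    with c[of p] k[OF x, of p] k[OF zS, of p] have "c = k z - k x" by (simp add: algebra_simps)
    moreover have "h z z = h x z + c" using c[of z] Uh zS z by auto
    ultimately show ?thesis by (simp add: F_def)
  qed
  have "primitive_on (U x - V) \<omega> F" if x: "x \<in> S" for x
    by (rule primitive_on_cong[OF _ primitive_on_add_const F[OF x]]) (use Uh[OF x] V in \<open>auto intro: open_Diff\<close>)
  then have "primitive_on (S - V) \<omega> F"
    using Uh unfolding primitive_on_def by blast
  then show ?thesis by (auto simp: exact_on_def)
qed

lemma exact_on_convex:
  fixes S :: "'a::euclidean_space set"
  assumes "open S" "convex S" "loc_exact S \<omega>"
  shows "exact_on S \<omega>"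
proof -
  have "exact_on (S - {}) \<omega>"
    by (rule exact_on_glue) (use assms in \<open>auto simp: loc_exact_def convex_connected\<close>)
  then show ?thesis by simp
qed

text \<open>The convex factor contributes no cohomology, so exactness on one slice decides, whatever
  the topology of \<open>Y\<close>. Over a small ball in \<open>Y\<close> a primitive exists on the
  product with all of \<open>X\<close>, by convexity.\<close>

lemma exact_on_tube:
  fixes X :: "'a::euclidean_space set" and Y :: "'b::euclidean_space set"
  assumes X: "open X" "convex X" and Y: "open Y" and loc: "loc_exact (X \<times> Y) \<theta>" and x1: "x1 \<in> X"
    and ex: "exact_on Y (\<lambda>z w. \<theta> (x1, z) (0, w))"
  shows "exact_on (X \<times> Y) \<theta>"
proof -
  obtain F where F: "primitive_on Y (\<lambda>z w. \<theta> (x1, z) (0, w)) F" using ex by (auto simp: exact_on_def)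
  have "\<forall>y\<in>Y. \<exists>r G. r > 0 \<and> ball y r \<subseteq> Y \<and> primitive_on (X \<times> ball y r) \<theta> G"
  proof
    fix y assume "y \<in> Y"
    then obtain r where r: "r > 0" "ball y r \<subseteq> Y" using Y by (meson openE)
    have "exact_on (X \<times> ball y r) \<theta>"
      using X r by (intro exact_on_convex loc_exact_subset[OF loc]) (auto intro: open_Times convex_Times)
    with r show "\<exists>r G. r > 0 \<and> ball y r \<subseteq> Y \<and> primitive_on (X \<times> ball y r) \<theta> G"
      by (auto simp: exact_on_def)
  qed
  then obtain r G where rG: "\<And>y. y \<in> Y \<Longrightarrow> r y > 0 \<and> ball y (r y) \<subseteq> Y \<and> primitive_on (X \<times> ball y (r y)) \<theta> (G y)"
    by metis
  \<comment> \<open>The increment of \<open>G z\<close> from \<open>x1\<close> to \<open>x\<close>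
    does not depend on the constant in \<open>G z\<close>, and \<open>F\<close> supplies the value
    on the slice.\<close>
  define h where "h = (\<lambda>(x, z). F z + G z (x, z) - G z (x1, z))"
  have "primitive_on (X \<times> ball y (r y)) \<theta> h" if y: "y \<in> Y" for y
  proof -
    have op: "open (X \<times> ball y (r y))" using X by (auto intro: open_Times)
    have 1: "h (x, z) = G y (x, z) + (F z - G y (x1, z))" if x: "x \<in> X" and z: "z \<in> ball y (r y)" for x z
    proof -
      have zY: "z \<in> Y" using rG y z by blast
      let ?W = "X \<times> (ball z (r z) \<inter> ball y (r y))"
      have "primitive_on ?W \<theta> (G z)" "primitive_on ?W \<theta> (G y)"
        using rG[OF zY] rG[OF y] by (auto elim!: primitive_on_subset)
      moreover have "open ?W" "connected ?W"
        using X by (auto intro!: open_Times convex_connected convex_Times convex_Int)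
      ultimately obtain c where c: "\<And>p. p \<in> ?W \<Longrightarrow> G z p = G y p + c"
        using primitive_on_unique by metis
      have "z \<in> ball z (r z)" using rG[OF zY] by simp
      with c[of "(x, z)"] c[of "(x1, z)"] x x1 z show ?thesis by (simp add: h_def)
    qed
    have "primitive_on (ball y (r y)) (\<lambda>z w. \<theta> (x1, z) (0, w)) (\<lambda>z. G y (x1, z))"
      unfolding primitive_on_def
    proof
      fix z assume "z \<in> ball y (r y)"
      then have "(G y has_derivative \<theta> (x1, z)) (at (x1, z))"
        using rG[OF y] x1 by (auto simp: primitive_on_def)
      then show "((\<lambda>z. G y (x1, z)) has_derivative (\<lambda>w. \<theta> (x1, z) (0, w))) (at z)"
        by (rule has_derivative_compose[rotated]) (auto intro!: derivative_eq_intros)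
    qed
    moreover have "primitive_on (ball y (r y)) (\<lambda>z w. \<theta> (x1, z) (0, w)) F"
      using F rG[OF y] primitive_on_subset by blast
    ultimately obtain c where c: "\<And>z. z \<in> ball y (r y) \<Longrightarrow> F z = G y (x1, z) + c"
      using primitive_on_unique[of "ball y (r y)"] by (metis open_ball connected_ball)
    show ?thesis
    proof (rule primitive_on_cong[OF op primitive_on_add_const[of _ _ "G y" c]])
      show "primitive_on (X \<times> ball y (r y)) \<theta> (G y)" using rG[OF y] by blast
      fix p assume "p \<in> X \<times> ball y (r y)"
      then show "h p = G y p + c" using 1 c by (cases p) auto
    qed
  qed
  then have "primitive_on (X \<times> Y) \<theta> h"
    using rG unfolding primitive_on_def by (fastforce simp: mem_Times_iff)
  then show ?thesis by (auto simp: exact_on_def)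
qed

section \<open>Pullbacks, and residues in one complex variable\<close>

lemma primitive_on_pullback:
  assumes "primitive_on T \<omega> F" "\<And>x. x \<in> S \<Longrightarrow> g x \<in> T \<and> (g has_derivative g' x) (at x)"
  shows "primitive_on S (\<lambda>x v. \<omega> (g x) (g' x v)) (\<lambda>x. F (g x))"
  unfolding primitive_on_def
proof
  fix x assume "x \<in> S"
  with assms(2) have "g x \<in> T" "(g has_derivative g' x) (at x)" by auto
  with assms(1) show "((\<lambda>x. F (g x)) has_derivative (\<lambda>v. \<omega> (g x) (g' x v))) (at x)"
    using has_derivative_compose[of g "g' x" x UNIV F "\<omega> (g x)"] by (auto simp: primitive_on_def)
qed

lemma loc_exact_pullback:
  assumes "loc_exact T \<omega>" "open S" "\<And>x. x \<in> S \<Longrightarrow> g x \<in> T \<and> (g has_derivative g' x) (at x)"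
  shows "loc_exact S (\<lambda>x v. \<omega> (g x) (g' x v))"
  unfolding loc_exact_def
proof
  fix x assume x: "x \<in> S"
  then obtain r where r: "r > 0" "exact_on (ball (g x) r) \<omega>" using assms by (meson loc_exact_def)
  then obtain F where F: "primitive_on (ball (g x) r) \<omega> F" by (auto simp: exact_on_def)
  have "continuous_on S g"
    using assms(3) by (meson continuous_at_imp_continuous_on has_derivative_continuous)
  then have "open (g -` ball (g x) r \<inter> S)" using assms(2) by (simp add: continuous_open_preimage Int_commute)
  moreover have "x \<in> g -` ball (g x) r \<inter> S" using x r by simp
  ultimately obtain q where q: "q > 0" "ball x q \<subseteq> g -` ball (g x) r \<inter> S" by (meson openE)
  have "primitive_on (ball x q) (\<lambda>x v. \<omega> (g x) (g' x v)) (\<lambda>x. F (g x))"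
    by (rule primitive_on_pullback[OF F]) (use q assms(3) in blast)
  then show "\<exists>r>0. exact_on (ball x r) (\<lambda>x v. \<omega> (g x) (g' x v))"
    using q by (auto simp: exact_on_def)
qed

lemma exact_on_holomorphic:
  assumes "open S" "convex S" "g holomorphic_on S"
  shows "exact_on S (\<lambda>z w. g z * w)"
proof -
  obtain F where "\<And>z. z \<in> S \<Longrightarrow> (F has_field_derivative g z) (at z within S)"
    using holomorphic_convex_primitive'[OF assms(2,1,3)] by blast
  then have "primitive_on S (\<lambda>z w. g z * w) F"
    using assms(1) unfolding primitive_on_def has_field_derivative_def by (metis at_within_open)
  then show ?thesis by (auto simp: exact_on_def)
qed

lemma loc_exact_holomorphic:
  assumes "open S" "g holomorphic_on S"
  shows "loc_exact S (\<lambda>z w. g z * w)"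
  unfolding loc_exact_def
proof
  fix x assume "x \<in> S"
  then obtain r where r: "r > 0" "ball x r \<subseteq> S" using assms(1) by (meson openE)
  then have "g holomorphic_on ball x r" using assms(2) holomorphic_on_subset by blast
  then have "exact_on (ball x r) (\<lambda>z w. g z * w)" by (intro exact_on_holomorphic) auto
  with r show "\<exists>r>0. exact_on (ball x r) (\<lambda>z w. g z * w)" by blast
qed

text \<open>The integral of an exact form over the circle is 0, while Cauchy's formula gives 2 pi i
  f(s').\<close>

lemma exact_on_simple_pole:
  assumes "f holomorphic_on cball s \<rho>" "\<rho> > 0" and ex: "exact_on T (\<lambda>z w. f z / (z - s') * w)"
    and T: "sphere s \<rho> \<subseteq> T" and s': "dist s s' < \<rho>"
  shows "f s' = 0"
proof -
  obtain F where F: "primitive_on T (\<lambda>z w. f z / (z - s') * w) F" using ex by (auto simp: exact_on_def)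
  have "((\<lambda>z. f z / (z - s')) has_contour_integral (F (pathfinish (circlepath s \<rho>)) - F (pathstart (circlepath s \<rho>)))) (circlepath s \<rho>)"
  proof (rule contour_integral_primitive)
    show "(F has_field_derivative f z / (z - s')) (at z within T)" if "z \<in> T" for z
      using F that unfolding primitive_on_def has_field_derivative_def by (blast intro: has_derivative_at_withinI)
    show "path_image (circlepath s \<rho>) \<subseteq> T" using T assms(2) by simp
  qed simp
  then have "((\<lambda>z. f z / (z - s')) has_contour_integral 0) (circlepath s \<rho>)" by simp
  moreover have "((\<lambda>z. f z / (z - s')) has_contour_integral 2 * of_real pi * \<i> * f s') (circlepath s \<rho>)"
    using Cauchy_integral_circlepath_simple[OF assms(1), of s'] s' by (simp add: dist_norm norm_minus_commute)
  ultimately have "2 * of_real pi * \<i> * f s' = 0" by (metis has_contour_integral_unique)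
  then show ?thesis by simp
qed

text \<open>On the pullback along \<open>w \<mapsto> s + exp w\<close> the form has a primitive, which changes by a constant
  under the period of \<open>exp\<close>.\<close>

lemma residue_exists:
  assumes loc: "loc_exact (ball s \<epsilon> - {s}) \<eta>" and "\<epsilon> > 0"
  shows "\<exists>r. exact_on (ball s \<epsilon> - {s}) (\<lambda>z w. \<eta> z w - r / (z - s) * w)"
proof -
  define T where "T = ball s \<epsilon> - {s}"
  \<comment> \<open>This half plane is convex, and w \<mapsto> s + exp w maps it onto the punctured
    disc.\<close>
  define H where "H = {w. Re w < ln \<epsilon>}"
  have "open H" unfolding H_def by (rule open_halfspace_Re_lt)
  have "convex H" unfolding H_def by (rule convex_halfspace_Re_lt)
  define \<psi> where "\<psi> = (\<lambda>w. s + exp w)"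
  have \<psi>T: "\<psi> w \<in> T" if "w \<in> H" for w
  proof -
    have "exp (Re w) < \<epsilon>" using that \<open>\<epsilon> > 0\<close> by (metis H_def exp_less_cancel_iff exp_ln mem_Collect_eq)
    then show ?thesis by (simp add: \<psi>_def T_def dist_norm)
  qed
  have \<psi>D: "(\<psi> has_derivative (\<lambda>v. exp w * v)) (at w)" for w
    unfolding \<psi>_def by (auto intro!: derivative_eq_intros)
  have "loc_exact H (\<lambda>w v. \<eta> (\<psi> w) (exp w * v))"
    by (rule loc_exact_pullback[of T]) (use loc \<open>open H\<close> \<psi>T \<psi>D in \<open>auto simp: T_def\<close>)
  then have "exact_on H (\<lambda>w v. \<eta> (\<psi> w) (exp w * v))"
    using \<open>open H\<close> \<open>convex H\<close> by (intro exact_on_convex)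
  then obtain h where h: "primitive_on H (\<lambda>w v. \<eta> (\<psi> w) (exp w * v)) h"
    by (auto simp: exact_on_def)
  define p where "p = 2 * of_real pi * \<i>"
  have "p \<noteq> 0" by (simp add: p_def)
  have p: "exp (w + p) = exp w" for w by (simp add: p_def exp_add)
  have Hp: "w + p \<in> H \<longleftrightarrow> w \<in> H" for w by (simp add: H_def p_def)
  have "primitive_on H (\<lambda>w v. \<eta> (\<psi> (w + p)) (exp (w + p) * v)) (\<lambda>w. h (w + p))"
    by (rule primitive_on_pullback[OF h, of H "\<lambda>w. w + p" "\<lambda>w v. v"]) (auto simp: Hp intro!: derivative_eq_intros)
  then have "primitive_on H (\<lambda>w v. \<eta> (\<psi> w) (exp w * v)) (\<lambda>w. h (w + p))"
    by (simp add: p \<psi>_def)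
  from primitive_on_unique[OF \<open>open H\<close> convex_connected[OF \<open>convex H\<close>] this h]
  obtain c where c: "\<And>w. w \<in> H \<Longrightarrow> h (w + p) = h w + c" by blast
  \<comment> \<open>The form dz / (z - s) pulls back to dw, so subtracting \<open>r * w\<close>
    removes the increment \<open>c\<close> over one period \<open>p\<close>.\<close>
  define r where "r = c / p"
  define k where "k = (\<lambda>w. h w - r * w)"
  have k1: "k (w + p) = k w" if "w \<in> H" for w
    using c[OF that] \<open>p \<noteq> 0\<close> by (simp add: k_def r_def field_simps)
  have kn: "k (w + of_nat n * p) = k w \<and> w + of_nat n * p \<in> H" if "w \<in> H" for w n
  proof (induction n)
    case (Suc n)
    have eq: "w + of_nat (Suc n) * p = (w + of_nat n * p) + p" by (simp add: algebra_simps)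
    show ?case unfolding eq using Suc k1[of "w + of_nat n * p"] Hp[of "w + of_nat n * p"] by metis
  qed (use that in simp)
  have ki: "k (w + of_int n * p) = k w" if "w \<in> H" for w n
  proof (cases "n \<ge> 0")
    case True
    then show ?thesis using kn[OF that, of "nat n"] by simp
  next
    case False
    define m where "m = nat (- n)"
    have n: "of_int n = - (of_nat m :: complex)" using False by (simp add: m_def)
    have "w - of_nat m * p \<in> H" using that by (simp add: H_def p_def)
    from kn[OF this, of m] show ?thesis by (simp add: n)
  qed
  define F where "F = (\<lambda>z. k (Ln (z - s)))"
  have "(F has_derivative (\<lambda>v. \<eta> z0 v - r / (z0 - s) * v)) (at z0)" if z0: "z0 \<in> T" for z0
  proof -
    define w0 where "w0 = Ln (z0 - s)"
    have z0s: "z0 \<noteq> s" "norm (z0 - s) < \<epsilon>" using z0 by (auto simp: T_def dist_norm norm_minus_commute)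
    have ew0: "exp w0 = z0 - s" using z0s by (simp add: w0_def)
    have Hln: "Ln (z - s) \<in> H" if "z \<in> T" for z
      using that \<open>\<epsilon> > 0\<close> by (auto simp: T_def H_def dist_norm norm_minus_commute)
    then have w0H: "w0 \<in> H" using z0 by (simp add: w0_def)
    \<comment> \<open>\<open>F\<close> is built from the principal logarithm, which jumps across a
      ray. \<open>L\<close> is a logarithm that is differentiable at \<open>z0\<close>; the two
      differ by a multiple of the period, so \<open>k\<close> does not distinguish them.\<close>
    define L where "L = (\<lambda>z. w0 + Ln ((z - s) / (z0 - s)))"
    have L0: "L z0 = w0" using z0s by (simp add: L_def)
    have LD: "(L has_derivative (\<lambda>v. v / (z0 - s))) (at z0)"
    proof -
      have "(L has_field_derivative 1 / (z0 - s)) (at z0)"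
        unfolding L_def using z0s by (auto intro!: derivative_eq_intros simp: divide_simps)
      moreover have "(\<lambda>v. v / (z0 - s)) = (*) (1 / (z0 - s))" by auto
      ultimately show ?thesis by (simp only: has_field_derivative_def)
    qed
    have "(h has_derivative (\<lambda>v. \<eta> (\<psi> w0) (exp w0 * v))) (at w0)"
      using h w0H by (auto simp: primitive_on_def)
    then have "(k has_derivative (\<lambda>v. \<eta> (\<psi> w0) (exp w0 * v) - r * v)) (at w0)"
      unfolding k_def by (auto intro!: derivative_eq_intros)
    then have kD: "(k has_derivative (\<lambda>v. \<eta> (\<psi> w0) (exp w0 * v) - r * v)) (at (L z0))"
      by (simp only: L0)
    have "((\<lambda>z. k (L z)) has_derivative (\<lambda>v. \<eta> (\<psi> w0) (exp w0 * (v / (z0 - s))) - r * (v / (z0 - s)))) (at z0)"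
      by (rule has_derivative_compose[OF LD kD])
    then have D: "((\<lambda>z. k (L z)) has_derivative (\<lambda>v. \<eta> z0 v - r / (z0 - s) * v)) (at z0)"
      using z0s by (simp add: ew0 \<psi>_def)
    have eq: "k (L z) = F z" if z: "z \<in> T" for z
    proof -
      have zs: "z \<noteq> s" using z by (auto simp: T_def)
      have "exp (L z) = exp (Ln (z - s))" using zs z0s by (simp add: L_def exp_add ew0)
      then obtain n where "L z = Ln (z - s) + complex_of_real (real_of_int (2 * n) * pi) * \<i>"
        unfolding exp_eq by blast
      then have "L z = Ln (z - s) + of_int n * p" by (simp add: p_def)
      with ki[OF Hln[OF z], of n] show ?thesis by (simp add: F_def)
    qed
    have "open T" by (auto simp: T_def)
    from has_derivative_transform_within_open[OF D this z0 eq] show ?thesis .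
  qed
  then have "primitive_on T (\<lambda>z w. \<eta> z w - r / (z - s) * w) F" by (auto simp: primitive_on_def)
  then show ?thesis by (auto simp: exact_on_def T_def)
qed

text \<open>Poincare lemma: the primitive is the integral of \<open>\<omega>\<close> along the
  segment from \<open>a\<close> to x, differentiated under the integral sign. Closedness turns the
  resulting integrand into the t-derivative of t times \<open>\<omega> (Y x t) v\<close>.\<close>

lemma closed_form_loc_exact:
  fixes U :: "'a::euclidean_space set"
  assumes U: "open U" and \<omega>: "\<omega> \<in> closed_forms1 U"
  shows "loc_exact U \<omega>"
  unfolding loc_exact_def
proof
  fix a assume "a \<in> U"
  then obtain r where r: "r > 0" "ball a r \<subseteq> U" using U by (meson openE)
  have lin: "linear (\<omega> x)" if "x \<in> U" for x
    using \<omega> that by (auto simp: closed_forms1_def smooth_forms1_def)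
  have C1: "C_k_on (Suc 0) (\<lambda>x. \<omega> x v) U" for v
    using \<omega> unfolding closed_forms1_def smooth_forms1_def smooth_on_def by blast
  define D where "D = (\<lambda>y b. frechet_derivative (\<lambda>y. \<omega> y b) (at y))"
  have der: "((\<lambda>x. \<omega> x b) has_derivative D x b) (at x)" if "x \<in> U" for x b
    using C1[of b] that by (auto simp: D_def frechet_derivative_works[symmetric])
  have contD: "continuous_on U (\<lambda>x. D x b v)" for b v
    using C1[of b] by (simp add: D_def)
  have cont\<omega>: "continuous_on U (\<lambda>x. \<omega> x b)" for b
    using der by (meson continuous_at_imp_continuous_on has_derivative_continuous)
  have sym: "D x b v = D x v b" if "x \<in> U" for x b v
    using \<omega> that by (auto simp: closed_forms1_def ext_deriv1_def D_def)
  \<comment> \<open>Differentiability is known for each fixed tangent vector. Expansion in the basis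
    handles the vector x - a, which moves together with x.\<close>
  have expand: "\<omega> x w = (\<Sum>b\<in>Basis. (w \<bullet> b) *\<^sub>R \<omega> x b)" if "x \<in> U" for x w
  proof -
    have "\<omega> x w = \<omega> x (\<Sum>b\<in>Basis. (w \<bullet> b) *\<^sub>R b)" by (simp add: euclidean_representation)
    also have "\<dots> = (\<Sum>b\<in>Basis. (w \<bullet> b) *\<^sub>R \<omega> x b)"
      using lin[OF that] by (simp add: linear_sum linear_scale)
    finally show ?thesis .
  qed
  have D_lin: "D y w v = (\<Sum>b\<in>Basis. (w \<bullet> b) *\<^sub>R D y b v)" if y: "y \<in> U" for y w v
  proof -
    have "((\<lambda>x. \<Sum>b\<in>Basis. (w \<bullet> b) *\<^sub>R \<omega> x b) has_derivative (\<lambda>v. \<Sum>b\<in>Basis. (w \<bullet> b) *\<^sub>R D y b v)) (at y)"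
      using der[OF y] by (auto intro!: derivative_eq_intros)
    from has_derivative_transform_within_open[OF this U y] have
      "((\<lambda>x. \<omega> x w) has_derivative (\<lambda>v. \<Sum>b\<in>Basis. (w \<bullet> b) *\<^sub>R D y b v)) (at y)"
      using expand by simp
    from has_derivative_unique[OF der[OF y, of w] this] show ?thesis by (rule fun_cong)
  qed
  define Y where "Y = (\<lambda>x t. a + t *\<^sub>R (x - a))"
  have YU: "Y x t \<in> U" if "x \<in> ball a r" "t \<in> {0..1}" for x t
  proof -
    have "norm (t *\<^sub>R (x - a)) \<le> norm (x - a)" using that(2) by (auto simp: mult_left_le_one_le)
    also have "\<dots> < r" using that(1) by (simp add: dist_norm norm_minus_commute)
    finally have "Y x t \<in> ball a r" by (simp add: Y_def dist_norm)
    then show ?thesis using r by blast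
  qed
  define f where "f = (\<lambda>x t. \<omega> (Y x t) (x - a))"
  define l where "l = (\<lambda>x t v. \<omega> (Y x t) v + t *\<^sub>R D (Y x t) (x - a) v)"
  have l_lin: "bounded_linear (l x t)" if "x \<in> ball a r" "t \<in> {0..1}" for x t
  proof -
    have "bounded_linear (\<omega> (Y x t))" using lin[OF YU[OF that]] by (simp add: linear_conv_bounded_linear)
    moreover have "bounded_linear (D (Y x t) (x - a))" using der[OF YU[OF that]] has_derivative_bounded_linear by blast
    ultimately show ?thesis unfolding l_def
      by (intro bounded_linear_add bounded_linear_compose[OF bounded_linear_scaleR_right])
  qed
  \<comment> \<open>The Leibniz rule asks for a derivative that is continuous as an operator; as a
    \<open>Blinfun\<close> it can be checked on basis vectors.\<close>
  define L where "L = (\<lambda>x t. Blinfun (l x t))"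
  have Lapp: "blinfun_apply (L x t) = l x t" if "x \<in> ball a r" "t \<in> {0..1}" for x t
    unfolding L_def by (rule bounded_linear_Blinfun_apply[OF l_lin[OF that]])
  have fD: "((\<lambda>x. f x t) has_derivative blinfun_apply (L x t)) (at x within ball a r)"
    if x: "x \<in> ball a r" and t: "t \<in> cbox 0 1" for x t
  proof -
    have t': "t \<in> {0..1}" using t by simp
    have Yd: "((\<lambda>x. Y x t) has_derivative (\<lambda>v. t *\<^sub>R v)) (at x)"
      unfolding Y_def by (auto intro!: derivative_eq_intros)
    have "((\<lambda>x. \<omega> (Y x t) b) has_derivative (\<lambda>v. D (Y x t) b (t *\<^sub>R v))) (at x)" for b
      using has_derivative_compose[OF Yd der[OF YU[OF x t']]] .
    then have "((\<lambda>x. \<Sum>b\<in>Basis. ((x - a) \<bullet> b) *\<^sub>R \<omega> (Y x t) b) has_derivative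
       (\<lambda>v. \<Sum>b\<in>Basis. ((x - a) \<bullet> b) *\<^sub>R D (Y x t) b (t *\<^sub>R v) + (v \<bullet> b) *\<^sub>R \<omega> (Y x t) b)) (at x)"
      by (auto intro!: derivative_eq_intros)
    moreover have "(\<lambda>v. \<Sum>b\<in>Basis. ((x - a) \<bullet> b) *\<^sub>R D (Y x t) b (t *\<^sub>R v) + (v \<bullet> b) *\<^sub>R \<omega> (Y x t) b) = l x t"
    proof
      fix v
      have "linear (D (Y x t) b)" for b
        using der[OF YU[OF x t']] has_derivative_linear by blast
      then show "(\<Sum>b\<in>Basis. ((x - a) \<bullet> b) *\<^sub>R D (Y x t) b (t *\<^sub>R v) + (v \<bullet> b) *\<^sub>R \<omega> (Y x t) b) = l x t v"
        using YU[OF x t'] by (simp add: l_def D_lin[of _ "x - a"] expand[of _ v] sum.distrib linear_scale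
            scaleR_sum_right mult.commute)
    qed
    ultimately have "((\<lambda>x. \<Sum>b\<in>Basis. ((x - a) \<bullet> b) *\<^sub>R \<omega> (Y x t) b) has_derivative blinfun_apply (L x t)) (at x)"
      using Lapp[OF x t'] by simp
    then have "((\<lambda>x. f x t) has_derivative blinfun_apply (L x t)) (at x)"
      by (rule has_derivative_transform_within_open[OF _ open_ball x])
         (use YU t' in \<open>auto simp: f_def expand[of _ "_ - a"]\<close>)
    then show ?thesis by (rule has_derivative_at_withinI)
  qed
  have Ycont: "continuous_on (ball a r \<times> {0..1}) (\<lambda>p. Y (fst p) (snd p))"
    unfolding Y_def by (intro continuous_intros)
  have Ysub: "(\<lambda>p. Y (fst p) (snd p)) ` (ball a r \<times> {0..1}) \<subseteq> U" using YU by force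
  have Lcont: "continuous_on (ball a r \<times> cbox 0 1) (\<lambda>(x, t). L x t)"
  proof (rule continuous_on_blinfun_componentwise)
    fix c :: 'a assume "c \<in> Basis"
    have "continuous_on (ball a r \<times> {0..1}) (\<lambda>p. \<omega> (Y (fst p) (snd p)) c +
       snd p *\<^sub>R (\<Sum>b\<in>Basis. ((fst p - a) \<bullet> b) *\<^sub>R D (Y (fst p) (snd p)) b c))"
      by (intro continuous_intros continuous_on_compose2[OF cont\<omega> Ycont Ysub] continuous_on_compose2[OF contD Ycont Ysub])
    then show "continuous_on (ball a r \<times> cbox 0 1) (\<lambda>p. blinfun_apply (case p of (x, t) \<Rightarrow> L x t) c)"
      unfolding cbox_interval by (rule continuous_on_eq) (auto simp: Lapp l_def D_lin[OF YU])
  qed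
  define F where "F = (\<lambda>x. integral (cbox 0 1) (f x))"
  have "(F has_derivative \<omega> x) (at x)" if x: "x \<in> ball a r" for x
  proof -
    have int: "f x integrable_on cbox 0 1" if x: "x \<in> ball a r" for x
    proof (rule integrable_continuous)
      show "continuous_on (cbox 0 1) (f x)"
        unfolding f_def
        by (rule continuous_on_compose2[OF cont\<omega>]) (use YU[OF x] in \<open>auto simp: Y_def intro!: continuous_intros\<close>)
    qed
    have "(F has_derivative blinfun_apply (integral (cbox 0 1) (L x))) (at x within ball a r)"
      unfolding F_def
    proof (rule leibniz_rule[where f = f and fx = L and U = "ball a r" and a = 0 and b = 1])
      show "((\<lambda>x. f x t) has_derivative blinfun_apply (L x t)) (at x within ball a r)"
        if "x \<in> ball a r" "t \<in> cbox 0 1" for x t using that by (rule fD)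
    qed (use int Lcont x in auto)
    then have 1: "(F has_derivative blinfun_apply (integral (cbox 0 1) (L x))) (at x)"
      by (simp only: at_within_open[OF x open_ball])
    have "blinfun_apply (integral (cbox 0 1) (L x)) v = \<omega> x v" for v
    proof -
      have "continuous_on (cbox 0 1) (\<lambda>t. (\<lambda>(x, t). L x t) (x, t))"
        by (rule continuous_on_compose2[OF Lcont]) (use x in \<open>auto intro!: continuous_intros\<close>)
      then have Lint: "L x integrable_on cbox 0 1"
        by (intro integrable_continuous) simp
      have "blinfun_apply (integral (cbox 0 1) (L x)) v = integral (cbox 0 1) (\<lambda>t. blinfun_apply (L x t) v)"
        using integral_linear[OF Lint, of "\<lambda>f. blinfun_apply f v"] blinfun.bounded_linear_left
        by (auto simp: o_def)
      also have "\<dots> = integral {0..1} (\<lambda>t. \<omega> (Y x t) v + t *\<^sub>R D (Y x t) v (x - a))"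
        unfolding cbox_interval
      proof (rule Henstock_Kurzweil_Integration.integral_cong)
        fix t :: real assume t: "t \<in> {0..1}"
        show "blinfun_apply (L x t) v = \<omega> (Y x t) v + t *\<^sub>R D (Y x t) v (x - a)"
          using sym[OF YU[OF x t], of "x - a" v] by (simp add: Lapp[OF x t] l_def)
      qed
      also have "\<dots> = 1 *\<^sub>R \<omega> (Y x 1) v - 0 *\<^sub>R \<omega> (Y x 0) v"
      proof (rule integral_unique, rule fundamental_theorem_of_calculus)
        fix t :: real assume t: "t \<in> {0..1}"
        have "(Y x has_derivative (\<lambda>h. h *\<^sub>R (x - a))) (at t within {0..1})"
          unfolding Y_def by (auto intro!: derivative_eq_intros)
        from has_derivative_compose[OF this der[OF YU[OF x t], of v]]
        have "((\<lambda>t. \<omega> (Y x t) v) has_derivative (\<lambda>h. D (Y x t) v (h *\<^sub>R (x - a)))) (at t within {0..1})" .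
        moreover have "linear (D (Y x t) v)" using der[OF YU[OF x t]] has_derivative_linear by blast
        ultimately have "((\<lambda>t. \<omega> (Y x t) v) has_vector_derivative D (Y x t) v (x - a)) (at t within {0..1})"
          by (simp add: has_vector_derivative_def linear_scale)
        then show "((\<lambda>t. t *\<^sub>R \<omega> (Y x t) v) has_vector_derivative (\<omega> (Y x t) v + t *\<^sub>R D (Y x t) v (x - a))) (at t within {0..1})"
          by (auto intro!: derivative_eq_intros)
      qed simp
      finally show ?thesis by (simp add: Y_def)
    qed
    then have "blinfun_apply (integral (cbox 0 1) (L x)) = \<omega> x" by auto
    with 1 show ?thesis by simp
  qed
  then have "exact_on (ball a r) \<omega>" unfolding exact_on_def primitive_on_def by blast
  with r show "\<exists>r>0. exact_on (ball a r) \<omega>" by blast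
qed

section \<open>Functions that are polynomial on lines\<close>

lemma norm_vector_smult_complex: "norm (c *s v) = norm c * norm v" for v :: "complex ^ 'n"
  unfolding norm_vec_def vector_scalar_mult_def
  by (simp add: norm_mult L2_set_right_distrib)

lemma has_derivative_vector_smult [derivative_intros]:
  fixes u :: "complex ^ 'n"
  assumes "(f has_derivative f') (at x within S)"
  shows "((\<lambda>x. f x *s u) has_derivative (\<lambda>v. f' v *s u)) (at x within S)"
proof -
  have "bounded_linear (\<lambda>c. c *s u)"
    by (rule bounded_linear_intro[of _ "norm u"])
       (auto simp: vec_eq_iff algebra_simps norm_vector_smult_complex)
  from bounded_linear.has_derivative[OF this assms] show ?thesis .
qed

text \<open>Interpolation at the nodes 0, ..., n. One basis works for all \<open>g\<close>, so it
  can be kept fixed while the other coordinates vary.\<close>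

lemma lagrange_basis:
  "\<exists>L :: nat \<Rightarrow> complex poly. \<forall>g. degree g \<le> n \<longrightarrow> g = (\<Sum>l\<le>n. smult (poly g (of_nat l)) (L l))"
proof -
  define L where "L = (\<lambda>l. \<Prod>j\<in>{..n} - {l}. smult (1 / (of_nat l - of_nat j)) [:- of_nat j, 1:] :: complex poly)"
  have deg: "degree (L l) \<le> n" if "l \<le> n" for l
  proof -
    have "degree (L l) \<le> sum (degree \<circ> (\<lambda>j. smult (1 / (of_nat l - of_nat j)) [:- of_nat j, 1:] :: complex poly)) ({..n} - {l})"
      unfolding L_def by (rule degree_prod_sum_le) simp
    also have "\<dots> \<le> (\<Sum>j\<in>{..n} - {l}. 1)"
      by (intro sum_mono) (auto intro: order_trans[OF degree_smult_le])
    also have "\<dots> = n" using that by simp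
    finally show ?thesis .
  qed
  have val: "poly (L l) (of_nat m) = (if l = m then 1 else 0)" if "m \<le> n" for l m
  proof (cases "l = m")
    case True
    then show ?thesis by (auto simp: L_def poly_prod diff_divide_distrib[symmetric] intro!: prod.neutral)
  next
    case False
    then show ?thesis using that by (auto simp: L_def poly_prod intro!: prod_zero bexI[of _ m])
  qed
  have "g = (\<Sum>l\<le>n. smult (poly g (of_nat l)) (L l))" if g: "degree g \<le> n" for g
  proof (rule poly_eqI_degree)
    let ?A = "of_nat ` {..n} :: complex set"
    have card: "card ?A = Suc n" by (subst card_image) (auto simp: inj_on_def)
    show "poly g x = poly (\<Sum>l\<le>n. smult (poly g (of_nat l)) (L l)) x" if "x \<in> ?A" for x
      using that by (auto simp: poly_sum val if_distrib cong: if_cong)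
    show "degree g < card ?A" using g card by simp
    have "degree (\<Sum>l\<le>n. smult (poly g (of_nat l)) (L l)) \<le> n"
      by (intro degree_sum_le) (auto intro!: order_trans[OF degree_smult_le] deg)
    then show "degree (\<Sum>l\<le>n. smult (poly g (of_nat l)) (L l)) < card ?A" using card by simp
  qed
  then show ?thesis by blast
qed

text \<open>Induction on the set of coordinates on which \<open>e\<close> depends: freezing
  coordinate \<open>i\<close> at the nodes 0, ..., n leaves functions of fewer coordinates, and
  interpolation in \<open>x $ i\<close> recombines them. The degree bound \<open>n\<close> is
  uniform in x, so finitely many nodes suffice.\<close>

lemma mpoly_if_poly_on_lines_aux:
  fixes e :: "complex ^ 'n::{finite,linorder} \<Rightarrow> complex" and I :: "'n set"
  assumes "finite I" "\<And>x i. \<exists>g. degree g \<le> n \<and> (\<forall>t. e (x + t *s axis i 1) = poly g t)"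
    and "\<And>x y. (\<forall>i\<in>I. x $ i = y $ i) \<Longrightarrow> e x = e y"
  shows "\<exists>G. \<forall>x. e x = mpoly_eval G x"
  using assms
proof (induction I arbitrary: e rule: finite_induct)
  case empty
  have "e x = e 0" for x by (rule empty(2)) blast
  then have "\<forall>x. e x = mpoly_eval (mpoly_const (e 0)) x" unfolding mpoly_eval_const by blast
  then show ?case by (rule exI)
next
  case (insert i I)
  obtain L :: "nat \<Rightarrow> complex poly" where
    L0: "\<forall>g. degree g \<le> n \<longrightarrow> g = (\<Sum>l\<le>n. smult (poly g (of_nat l)) (L l))"
    using exE[OF lagrange_basis[of n]] .
  have L: "g = (\<Sum>l\<le>n. smult (poly g (of_nat l)) (L l))" if "degree g \<le> n" for g
    by (rule mp[OF spec[OF L0] that])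
  define sub where "sub = (\<lambda>c (x :: complex ^ 'n::{finite,linorder}). \<chi> j. if j = i then c else x $ j)"
  have "\<exists>G. \<forall>x. e (sub c x) = mpoly_eval G x" for c
  proof (rule insert.IH)
    fix x j
    show "\<exists>g. degree g \<le> n \<and> (\<forall>t. e (sub c (x + t *s axis j 1)) = poly g t)"
    proof (cases "j = i")
      case True
      then have "sub c (x + t *s axis j 1) = sub c x" for t
        by (auto simp: sub_def vec_eq_iff axis_def)
      then show ?thesis by (intro exI[of _ "[:e (sub c x):]"]) auto
    next
      case False
      then have "sub c (x + t *s axis j 1) = sub c x + t *s axis j 1" for t
        by (auto simp: sub_def vec_eq_iff axis_def)
      then show ?thesis using insert.prems(1)[of "sub c x" j] by simp
    qed
  next
    fix x y :: "complex ^ 'n::{finite,linorder}" assume "\<forall>i\<in>I. x $ i = y $ i"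
    then show "e (sub c x) = e (sub c y)" by (intro insert.prems(2)) (auto simp: sub_def)
  qed
  then obtain G where G: "\<And>c x. e (sub c x) = mpoly_eval (G c) x" by metis
  define Li where "Li = (\<lambda>l. \<Sum>k\<le>degree (L l). mpoly_const (coeff (L l) k) * mpoly_X i ^ k :: 'n mpoly)"
  have Li: "mpoly_eval (Li l) x = poly (L l) (x $ i)" for l x
    by (simp add: Li_def poly_altdef)
  have "e x = mpoly_eval (\<Sum>l\<le>n. G (of_nat l) * Li l) x" for x
  proof -
    obtain g where g: "degree g \<le> n" "\<And>t. e (sub 0 x + t *s axis i 1) = poly g t"
      using insert.prems(1) by blast
    have eq: "sub 0 x + t *s axis i 1 = sub t x" for t
      by (auto simp: sub_def vec_eq_iff axis_def)
    have x: "sub (x $ i) x = x" by (auto simp: sub_def vec_eq_iff)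
    have "e x = poly g (x $ i)" using g(2)[of "x $ i"] by (simp add: eq x)
    also have "\<dots> = (\<Sum>l\<le>n. poly g (of_nat l) * poly (L l) (x $ i))"
      by (subst L[OF g(1)]) (simp add: poly_sum)
    also have "\<dots> = mpoly_eval (\<Sum>l\<le>n. G (of_nat l) * Li l) x"
      by (simp add: Li G[symmetric] g(2)[symmetric] eq)
    finally show ?thesis .
  qed
  then show ?case by blast
qed

lemma mpoly_if_poly_on_lines:
  fixes e :: "complex ^ 'n::{finite,linorder} \<Rightarrow> complex"
  assumes "\<And>x i. \<exists>g. degree g \<le> n \<and> (\<forall>t. e (x + t *s axis i 1) = poly g t)"
  shows "\<exists>G. \<forall>x. e x = mpoly_eval G x"
  by (rule mpoly_if_poly_on_lines_aux[of UNIV n e]) (use assms in \<open>auto simp: vec_eq_iff[symmetric]\<close>)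

lemma poly_if_entire_bounded:
  assumes "h holomorphic_on UNIV" "\<And>z. 1 \<le> norm z \<Longrightarrow> norm (h z) \<le> B * norm z ^ n"
  shows "\<exists>g. degree g \<le> n \<and> (\<forall>z. h z = poly g z)"
proof (intro exI conjI allI)
  show "degree (\<Sum>k\<le>n. monom ((deriv ^^ k) h 0 / fact k) k) \<le> n"
    by (intro degree_sum_le) (auto intro!: order_trans[OF degree_monom_le])
  show "h z = poly (\<Sum>k\<le>n. monom ((deriv ^^ k) h 0 / fact k) k) z" for z
    using Liouville_polynomial[OF assms(1), of 1 B n z] assms(2) by (simp add: poly_sum poly_monom)
qed

text \<open>Liouville's theorem on coordinate lines: growth of order (1 + |x|^2)^N gives degree at
  most 2 N on each of them, a bound independent of the line.\<close>

lemma mpoly_if_entire_on_lines: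
  fixes e :: "complex ^ 'n::{finite,linorder} \<Rightarrow> complex"
  assumes hol: "\<And>x v. (\<lambda>t. e (x + t *s v)) holomorphic_on UNIV"
    and gr: "poly_growth (\<lambda>x. norm (e x))"
  shows "\<exists>G. \<forall>x. e x = mpoly_eval G x"
proof -
  obtain K N where K: "K \<ge> 0" "\<And>x. norm (e x) \<le> K * (1 + norm x ^ 2) ^ N"
    using gr unfolding poly_growth_def by auto
  show ?thesis
  proof (rule mpoly_if_poly_on_lines)
    fix x i
    define v where "v = (axis i 1 :: complex ^ 'n::{finite,linorder})"
    show "\<exists>g. degree g \<le> 2 * N \<and> (\<forall>t. e (x + t *s v) = poly g t)"
    proof (rule poly_if_entire_bounded[OF hol])
      fix t :: complex assume t: "1 \<le> norm t"
      have "norm (x + t *s v) \<le> norm x + norm t * norm v"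
        using norm_triangle_ineq[of x "t *s v"] by (simp add: norm_vector_smult_complex)
      also have "\<dots> \<le> norm t * (norm x + norm v)"
        using t by (simp add: distrib_left mult_left_mono mult_le_cancel_right1)
      finally have "norm (x + t *s v) ^ 2 \<le> (norm t * (norm x + norm v)) ^ 2"
        by (intro power_mono) auto
      moreover have "1 \<le> norm t ^ 2" using t by simp
      ultimately have "1 + norm (x + t *s v) ^ 2 \<le> norm t ^ 2 * (1 + (norm x + norm v) ^ 2)"
        unfolding power_mult_distrib distrib_left[of "norm t ^ 2"] mult_1_right by (rule add_mono[rotated])
      then have "(1 + norm (x + t *s v) ^ 2) ^ N \<le> (norm t ^ 2 * (1 + (norm x + norm v) ^ 2)) ^ N"
        by (intro power_mono) auto
      then have "K * (1 + norm (x + t *s v) ^ 2) ^ N \<le> K * (norm t ^ 2 * (1 + (norm x + norm v) ^ 2)) ^ N"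
        using K(1) by (rule mult_left_mono)
      from order_trans[OF K(2)[of "x + t *s v"] this] show "norm (e (x + t *s v)) \<le> (K * (1 + (norm x + norm v) ^ 2) ^ N) * norm t ^ (2 * N)"
        unfolding power_mult_distrib power_mult by (simp only: mult_ac)
    qed
  qed
qed

section \<open>Roots along a line\<close>

definition mpoly_dd :: "complex ^ 'n::{finite,linorder} \<Rightarrow> 'n mpoly \<Rightarrow> 'n mpoly" where
  "mpoly_dd u p = (\<Sum>i\<in>UNIV. mpoly_const (u $ i) * mpoly_pd i p)"

lemma mpoly_dd_mult: "mpoly_dd u (p * q) = mpoly_dd u p * q + p * mpoly_dd u q"
  by (simp add: mpoly_dd_def mpoly_pd_mult distrib_left sum.distrib sum_distrib_left sum_distrib_right mult_ac)

lemma has_field_derivative_mpoly_line: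
  "((\<lambda>z. mpoly_eval p (x + z *s u)) has_field_derivative mpoly_eval (mpoly_dd u p) (x + z *s u)) (at z within A)"
proof -
  have "((\<lambda>z. x + z *s u) has_derivative (\<lambda>h. h *s u)) (at z within A)"
    by (auto intro!: derivative_eq_intros)
  from has_derivative_in_compose[OF this has_derivative_mpoly_eval[of p]]
  have "((\<lambda>z. mpoly_eval p (x + z *s u)) has_derivative
     (\<lambda>h. \<Sum>i\<in>UNIV. mpoly_eval (mpoly_pd i p) (x + z *s u) * (h *s u) $ i)) (at z within A)" .
  moreover have "(\<lambda>h. \<Sum>i\<in>UNIV. mpoly_eval (mpoly_pd i p) (x + z *s u) * (h *s u) $ i) =
     (*) (mpoly_eval (mpoly_dd u p) (x + z *s u))"
    by (rule ext) (simp add: mpoly_dd_def sum_distrib_left mult_ac)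
  ultimately show ?thesis by (simp add: has_field_derivative_def)
qed

lemma evp_shift_dd: "evp (shift u (mpoly_dd u p)) x = pderiv (evp (shift u p) x)"
proof (rule poly_ext)
  fix z
  have "((\<lambda>z. poly (evp (shift u p) x) z) has_field_derivative mpoly_eval (mpoly_dd u p) (x + z *s u)) (at z)"
    unfolding poly_evp ev2_shift by (rule has_field_derivative_mpoly_line)
  with poly_DERIV have "poly (pderiv (evp (shift u p) x)) z = mpoly_eval (mpoly_dd u p) (x + z *s u)"
    by (rule DERIV_unique)
  then show "poly (evp (shift u (mpoly_dd u p)) x) z = poly (pderiv (evp (shift u p) x)) z"
    by (simp add: poly_evp)
qed

text \<open>The modulus of q(s) is that of the leading coefficient times the product of the
  distances from s to the roots, with multiplicity.\<close>

lemma poly_lower_bound: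
  fixes q :: "complex poly"
  assumes "\<And>z. poly q z = 0 \<Longrightarrow> \<delta> \<le> norm (s - z)" "\<delta> \<ge> 0"
  shows "norm (lead_coeff q) * \<delta> ^ degree q \<le> norm (poly q s)"
  using assms(1)
proof (induction "degree q" arbitrary: q)
  case 0
  then obtain c where "q = [:c:]" by (metis degree_0_id)
  then show ?case by simp
next
  case (Suc n)
  obtain a where a: "poly q a = 0"
    using Suc(2) Fundamental_Theorem_Algebra.fundamental_theorem_of_algebra[of q] by (auto simp: constant_degree)
  then obtain g where g: "q = [:- a, 1:] * g" by (auto simp: poly_eq_0_iff_dvd)
  have "g \<noteq> 0" using Suc(2) g by auto
  then have deg: "n = degree g" using Suc(2) unfolding g by (subst (asm) degree_mult_eq) auto
  have IH: "norm (lead_coeff g) * \<delta> ^ n \<le> norm (poly g s)"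
    using Suc(1)[OF deg] Suc(3) deg by (simp add: g)
  have lc: "lead_coeff q = lead_coeff g" unfolding g by (subst lead_coeff_mult) simp
  have "\<delta> * (norm (lead_coeff g) * \<delta> ^ n) \<le> norm (s - a) * norm (poly g s)"
    using IH Suc(3)[OF a] assms(2) by (intro mult_mono) auto
  moreover have "poly q s = (s - a) * poly g s" by (simp add: g algebra_simps)
  ultimately show ?case unfolding lc unfolding Suc(2)[symmetric] by (simp add: norm_mult mult_ac)
qed

text \<open>The branch \<open>\<phi>\<close> is given and continuous at 0; only its derivative is at
  stake. Since P vanishes along the branch, t a + (\<phi>(t) - s) b is small compared with |t| +
  |\<phi>(t) - s|, and division by b yields the derivative - a / b.\<close>

lemma implicit_has_field_derivative:
  fixes P :: "'n::{finite,linorder} mpoly"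
  assumes B: "mpoly_eval (mpoly_dd u P) (x + s *s u) \<noteq> 0" and s: "mpoly_eval P (x + s *s u) = 0"
    and \<phi>0: "\<phi> 0 = s" and cont: "(\<phi> \<longlongrightarrow> s) (at 0)"
    and root: "eventually (\<lambda>t. mpoly_eval P (x + t *s v + \<phi> t *s u) = 0) (at 0)"
  shows "\<phi> field_differentiable (at 0)"
proof -
  define a where "a = mpoly_eval (mpoly_dd v P) (x + s *s u)"
  define b where "b = mpoly_eval (mpoly_dd u P) (x + s *s u)"
  have "b \<noteq> 0" using B by (simp add: b_def)
  have "((\<lambda>p. x + fst p *s v + snd p *s u) has_derivative (\<lambda>h. fst h *s v + snd h *s u)) (at (0, s))"
    by (auto intro!: derivative_eq_intros)
  from has_derivative_compose[OF this has_derivative_mpoly_eval[of P]]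
  have D: "((\<lambda>p. mpoly_eval P (x + fst p *s v + snd p *s u)) has_derivative
     (\<lambda>h. \<Sum>i\<in>UNIV. mpoly_eval (mpoly_pd i P) (x + s *s u) * (fst h *s v + snd h *s u) $ i)) (at (0, s))"
    by simp
  have "(\<lambda>h. \<Sum>i\<in>UNIV. mpoly_eval (mpoly_pd i P) (x + s *s u) * (fst h *s v + snd h *s u) $ i) =
     (\<lambda>h. fst h * a + snd h * b)"
    by (rule ext) (simp add: a_def b_def mpoly_dd_def sum_distrib_left distrib_left sum.distrib mult_ac)
  with D have D: "((\<lambda>p. mpoly_eval P (x + fst p *s v + snd p *s u)) has_derivative (\<lambda>h. fst h * a + snd h * b)) (at (0, s))"
    by simp
  define c where "c = norm (a / b)"
  have "c \<ge> 0" by (simp add: c_def)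
  have "(\<phi> has_derivative (\<lambda>t. - (a / b) * t)) (at 0)"
    unfolding has_derivative_at_alt
  proof (intro conjI allI impI)
    show "bounded_linear (\<lambda>t. - (a / b) * t)" by (rule bounded_linear_mult_right)
    fix e :: real assume "e > 0"
    \<comment> \<open>The bound 1/2 absorbs the term in \<open>\<psi>\<close> and yields |\<psi>|
      \<le> (1 + 2 c) |t|; the other bound then makes the total error at most e |t|.\<close>
    define e1 where "e1 = min (1 / 2) (e / (2 + 2 * c))"
    have "e1 > 0" using \<open>e > 0\<close> \<open>c \<ge> 0\<close> by (simp add: e1_def)
    moreover have "e1 \<le> 1 / 2" "e1 \<le> e / (2 + 2 * c)"
      unfolding e1_def by (rule min.cobounded1, rule min.cobounded2)
    ultimately have e1: "e1 > 0" "e1 \<le> 1 / 2" "e1 \<le> e / (2 + 2 * c)" .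
    then have e1': "e1 * (2 + 2 * c) \<le> e" using \<open>c \<ge> 0\<close> by (simp add: pos_le_divide_eq)
    have "e1 * norm b > 0" using e1 \<open>b \<noteq> 0\<close> by simp
    then obtain d where d: "d > 0" "\<And>p. norm (p - (0, s)) < d \<Longrightarrow>
      norm (mpoly_eval P (x + fst p *s v + snd p *s u) - mpoly_eval P (x + fst (0::complex, s) *s v + snd (0::complex, s) *s u)
         - (fst (p - (0, s)) * a + snd (p - (0, s)) * b)) \<le> e1 * norm b * norm (p - (0, s))"
      using D unfolding has_derivative_at_alt by blast
    have ev: "eventually (\<lambda>t. norm (\<phi> t - s) < d / 2 \<and> norm t < d / 2 \<and> mpoly_eval P (x + t *s v + \<phi> t *s u) = 0) (at 0)"
    proof (intro eventually_conj root)
      show "eventually (\<lambda>t. norm (\<phi> t - s) < d / 2) (at 0)"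
        using tendstoD[OF cont, of "d / 2"] d by (simp add: dist_norm)
      show "eventually (\<lambda>t::complex. norm t < d / 2) (at 0)"
        using d by (auto simp: eventually_at intro!: exI[of _ "d / 2"])
    qed
    then obtain d' where d': "d' > 0" "\<And>t. t \<noteq> 0 \<Longrightarrow> norm t < d' \<Longrightarrow>
       norm (\<phi> t - s) < d / 2 \<and> norm t < d / 2 \<and> mpoly_eval P (x + t *s v + \<phi> t *s u) = 0"
      unfolding eventually_at by (auto simp: dist_norm)
    show "\<exists>d>0. \<forall>t. norm (t - 0) < d \<longrightarrow> norm (\<phi> t - \<phi> 0 - - (a / b) * (t - 0)) \<le> e * norm (t - 0)"
    proof (intro exI[of _ d'] conjI allI impI d'(1))
      fix t :: complex assume t: "norm (t - 0) < d'"
      show "norm (\<phi> t - \<phi> 0 - - (a / b) * (t - 0)) \<le> e * norm (t - 0)"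
      proof (cases "t = 0")
        case False
        define \<psi> where "\<psi> = \<phi> t - s"
        have *: "norm \<psi> < d / 2" "norm t < d / 2" "mpoly_eval P (x + t *s v + \<phi> t *s u) = 0"
          using d'(2)[OF False] t by (auto simp: \<psi>_def)
        have n: "norm ((t, \<phi> t) - (0, s)) \<le> norm t + norm \<psi>"
          using norm_Pair_le[of t \<psi>] by (simp add: \<psi>_def)
        have "norm (t * a + \<psi> * b) \<le> e1 * norm b * norm ((t, \<phi> t) - (0, s))"
        proof -
          have "norm (- (t * a) - \<psi> * b) = norm (t * a + \<psi> * b)"
            by (metis minus_add_distrib add_uminus_conv_diff norm_minus_cancel)
          then show ?thesis
            using d(2)[of "(t, \<phi> t)"] n * s by (simp add: \<psi>_def norm_minus_commute)
        qed
        also have "\<dots> \<le> e1 * norm b * (norm t + norm \<psi>)"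
          using n e1 by (intro mult_left_mono) auto
        finally have "norm (t * a + \<psi> * b) \<le> norm b * (e1 * (norm t + norm \<psi>))"
          by (simp add: mult_ac)
        moreover have "t * a + \<psi> * b = b * (\<psi> + t * (a / b))"
          using \<open>b \<noteq> 0\<close> by (simp add: field_simps)
        ultimately have 1: "norm (\<psi> + t * (a / b)) \<le> e1 * (norm t + norm \<psi>)"
          using \<open>b \<noteq> 0\<close> by (simp add: norm_mult)
        have "norm \<psi> \<le> norm (\<psi> + t * (a / b)) + norm (t * (a / b))"
          by (metis add_diff_cancel_right' norm_triangle_ineq4)
        then have "norm \<psi> \<le> norm (\<psi> + t * (a / b)) + norm t * c" by (simp add: c_def norm_mult norm_divide)
        moreover have "e1 * (norm t + norm \<psi>) \<le> 1 / 2 * (norm t + norm \<psi>)"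
          using e1 by (intro mult_right_mono) auto
        ultimately have "norm \<psi> \<le> norm t + 2 * (norm t * c)" using 1 by (simp add: distrib_left)
        then have "e1 * (norm t + norm \<psi>) \<le> e1 * (norm t + (norm t + 2 * (norm t * c)))"
          using e1 by (intro mult_left_mono) auto
        also have "\<dots> = e1 * (2 + 2 * c) * norm t" by (simp add: algebra_simps)
        also have "\<dots> \<le> e * norm t" using e1' by (intro mult_right_mono) auto
        finally have "norm (\<psi> + t * (a / b)) \<le> e * norm t" using 1 by linarith
        then show ?thesis by (simp add: \<psi>_def \<phi>0 mult_ac)
      qed (simp add: \<phi>0)
    qed
  qed
  then show ?thesis unfolding field_differentiable_def has_field_derivative_def by blast
qed

section \<open>The roots of P on the lines in direction u\<close>

locale hyp_line =
  fixes P :: "'n::{finite,linorder} mpoly" and u :: "complex ^ 'n::{finite,linorder}" and \<kappa> :: complex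
  assumes lead: "lead_coeff (shift u P) = mpoly_const \<kappa>" and \<kappa>: "\<kappa> \<noteq> 0"
begin

definition S :: "complex ^ 'n::{finite,linorder} \<Rightarrow> complex set" where
  "S x = {z. mpoly_eval P (x + z *s u) = 0}"

text \<open>The line through x meets V(P) transversally everywhere, so \<open>pol x\<close> is
  squarefree. The condition depends on the line only, not on the point chosen on it.\<close>

definition simple :: "complex ^ 'n::{finite,linorder} \<Rightarrow> bool" where
  "simple x \<longleftrightarrow> (\<forall>z\<in>S x. mpoly_eval (mpoly_dd u P) (x + z *s u) \<noteq> 0)"

abbreviation "pol x \<equiv> evp (shift u P) x"

lemma poly_pol: "poly (pol x) z = mpoly_eval P (x + z *s u)"
  by (simp add: poly_evp)

lemma degree_pol: "degree (pol x) = degree (shift u P)"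
  by (rule lead_const_evp[OF lead \<kappa>])

lemma lead_pol: "lead_coeff (pol x) = \<kappa>"
  by (rule lead_const_evp[OF lead \<kappa>])

lemma pol_nonzero: "pol x \<noteq> 0"
  using lead_pol \<kappa> by (metis leading_coeff_0_iff)

lemma S_pol: "S x = {z. poly (pol x) z = 0}"
  by (simp add: S_def poly_pol)

lemma finite_S [simp]: "finite (S x)"
  unfolding S_pol by (rule poly_roots_finite[OF pol_nonzero])

lemma card_S_le: "card (S x) \<le> degree (shift u P)"
  unfolding S_pol using card_poly_roots_bound[OF pol_nonzero] by (simp add: degree_pol)

lemma poly_pderiv_pol: "poly (pderiv (pol x)) z = mpoly_eval (mpoly_dd u P) (x + z *s u)"
  by (simp add: evp_shift_dd[symmetric] poly_evp)

lemma simple_decompose: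
  assumes "simple x"
  shows "pol x = smult \<kappa> (\<Prod>s\<in>S x. [:- s, 1:])" and "card (S x) = degree (shift u P)"
proof -
  have "rsquarefree (pol x)"
    unfolding rsquarefree_roots using assms by (auto simp: simple_def S_pol poly_pderiv_pol)
  from complex_poly_decompose_rsquarefree[OF this, unfolded lead_pol]
  show 1: "pol x = smult \<kappa> (\<Prod>s\<in>S x. [:- s, 1:])" by (simp only: S_pol)
  have "degree (\<Prod>s\<in>S x. [:- s, 1:]) = (\<Sum>s\<in>S x. degree [:- s, 1:])"
    by (rule degree_prod_eq_sum_degree) auto
  then have "degree (\<Prod>s\<in>S x. [:- s, 1:]) = card (S x)" by simp
  then have "degree (pol x) = card (S x)"
    unfolding 1 using \<kappa> by simp
  then show "card (S x) = degree (shift u P)" by (simp add: degree_pol)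
qed

lemma S_translate: "S (x + t *s u) = (\<lambda>z. z - t) ` S x"
proof -
  have "x + t *s u + z *s u = x + (z + t) *s u" for z by (simp add: vec_eq_iff algebra_simps)
  then have 1: "z \<in> S (x + t *s u) \<longleftrightarrow> z + t \<in> S x" for z by (simp only: S_def mem_Collect_eq)
  show ?thesis
  proof (intro equalityI subsetI)
    fix z assume "z \<in> S (x + t *s u)"
    then show "z \<in> (\<lambda>z. z - t) ` S x" by (intro image_eqI[of _ _ "z + t"]) (simp_all add: 1)
  qed (auto simp: 1)
qed

lemma simple_translate: "simple (x + t *s u) \<longleftrightarrow> simple x"
proof -
  have "x + t *s u + (z - t) *s u = x + z *s u" for z by (simp add: vec_eq_iff algebra_simps)
  then show ?thesis by (simp add: simple_def S_translate)
qed

text \<open>Continuity of roots: without a root of \<open>pol x\<close> within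
  \<open>\<delta>\<close> of s, its value at s would have modulus at least |\<kappa>| \<delta>^d,
  where d is the degree; but this value tends to 0 as x approaches \<open>x0\<close>.\<close>

lemma root_near:
  assumes s: "s \<in> S x0" and \<delta>: "\<delta> > 0"
  shows "\<exists>\<eta>>0. \<forall>x. dist x0 x < \<eta> \<longrightarrow> (\<exists>s'\<in>S x. norm (s - s') < \<delta>)"
proof -
  have "continuous_on UNIV (\<lambda>x. norm (mpoly_eval P (x + s *s u)))"
    by (intro continuous_intros)
  then have "isCont (\<lambda>x. norm (mpoly_eval P (x + s *s u))) x0"
    by (simp add: continuous_on_eq_continuous_at)
  moreover have "norm \<kappa> * \<delta> ^ degree (shift u P) > 0" using \<kappa> \<delta> by simp
  ultimately obtain \<eta> where \<eta>: "\<eta> > 0" "\<And>x. dist x x0 < \<eta> \<Longrightarrow>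
     dist (norm (mpoly_eval P (x + s *s u))) (norm (mpoly_eval P (x0 + s *s u))) < norm \<kappa> * \<delta> ^ degree (shift u P)"
    unfolding continuous_at_eps_delta by blast
  show ?thesis
  proof (intro exI[of _ \<eta>] conjI allI impI \<eta>(1))
    fix x assume "dist x0 x < \<eta>"
    then have small: "norm (poly (pol x) s) < norm \<kappa> * \<delta> ^ degree (shift u P)"
      using \<eta>(2)[of x] s by (simp add: dist_commute S_def poly_pol)
    show "\<exists>s'\<in>S x. norm (s - s') < \<delta>"
    proof (rule ccontr)
      assume "\<not> (\<exists>s'\<in>S x. norm (s - s') < \<delta>)"
      then have "norm (lead_coeff (pol x)) * \<delta> ^ degree (pol x) \<le> norm (poly (pol x) s)"
        using \<delta> by (intro poly_lower_bound) (auto simp: S_pol not_less)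
      note this[unfolded lead_pol, unfolded degree_pol]
      then show False using small by linarith
    qed
  qed
qed

text \<open>The factor 2 makes the open \<open>\<epsilon>\<close>-discs around the roots disjoint,
  so a point within \<open>\<epsilon>\<close> of a root identifies it.\<close>

definition sep :: "complex ^ 'n::{finite,linorder} \<Rightarrow> real \<Rightarrow> bool" where
  "sep x \<epsilon> \<longleftrightarrow> \<epsilon> > 0 \<and> (\<forall>s\<in>S x. \<forall>s'\<in>S x. s \<noteq> s' \<longrightarrow> 2 * \<epsilon> \<le> norm (s - s'))"

lemma sep_exists: "\<exists>\<epsilon>. sep x \<epsilon>"
proof -
  define A where "A = insert 1 (\<Union>s\<in>S x. (\<lambda>s'. norm (s - s')) ` (S x - {s}))"
  have fin: "finite A" unfolding A_def by simp
  then have "Min A \<in> A" by (rule Min_in) (simp add: A_def)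
  moreover have "a > 0" if "a \<in> A" for a using that by (auto simp: A_def)
  ultimately have "Min A > 0" by blast
  moreover have "Min A \<le> norm (s - s')" if "s \<in> S x" "s' \<in> S x" "s \<noteq> s'" for s s'
  proof (rule Min_le[OF fin])
    show "norm (s - s') \<in> A" unfolding A_def using that by blast
  qed
  ultimately show ?thesis by (intro exI[of _ "Min A / 2"]) (simp add: sep_def)
qed

text \<open>Each root over \<open>x0\<close> has a root over x nearby, and separated roots get
  different ones. The number of roots over a simple \<open>x0\<close> is already the maximum, the
  degree, so the assignment is onto.\<close>

lemma sheets:
  assumes simple: "simple x0" and sep: "sep x0 \<epsilon>" and \<delta>: "\<delta> > 0" "\<delta> \<le> \<epsilon>"
  shows "\<exists>\<eta>>0. \<forall>x. dist x0 x < \<eta> \<longrightarrow> (\<exists>f. bij_betw f (S x0) (S x) \<and> (\<forall>s\<in>S x0. norm (s - f s) < \<delta>))"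
proof -
  have "\<forall>s\<in>S x0. \<exists>\<eta>>0. \<forall>x. dist x0 x < \<eta> \<longrightarrow> (\<exists>s'\<in>S x. norm (s - s') < \<delta>)"
    using root_near \<delta>(1) by blast
  then obtain h where h: "\<And>s. s \<in> S x0 \<Longrightarrow> h s > 0"
    "\<And>s x. s \<in> S x0 \<Longrightarrow> dist x0 x < h s \<Longrightarrow> \<exists>s'\<in>S x. norm (s - s') < \<delta>" by metis
  define \<eta> where "\<eta> = Min (insert 1 (h ` S x0))"
  have \<eta>: "\<eta> > 0" "\<And>s. s \<in> S x0 \<Longrightarrow> \<eta> \<le> h s"
    unfolding \<eta>_def using h(1) by (auto intro!: Min_le)
  show ?thesis
  proof (intro exI[of _ \<eta>] conjI allI impI \<eta>(1))
    fix x assume x: "dist x0 x < \<eta>"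
    have "\<forall>s\<in>S x0. \<exists>s'. s' \<in> S x \<and> norm (s - s') < \<delta>"
      using h(2) \<eta>(2) x by (meson less_le_trans)
    then obtain f where f: "\<And>s. s \<in> S x0 \<Longrightarrow> f s \<in> S x \<and> norm (s - f s) < \<delta>" by metis
    have inj: "inj_on f (S x0)"
    proof (rule inj_onI, rule ccontr)
      fix s s' assume s: "s \<in> S x0" "s' \<in> S x0" "f s = f s'" "s \<noteq> s'"
      have "norm (s - s') \<le> norm (s - f s) + norm (s' - f s')"
        using norm_triangle_ineq4[of "s - f s" "s' - f s'"] s(3) by simp
      also have "\<dots> < 2 * \<epsilon>" using f[OF s(1)] f[OF s(2)] \<delta> by linarith
      finally have "norm (s - s') < 2 * \<epsilon>" .
      moreover have "2 * \<epsilon> \<le> norm (s - s')" using sep s unfolding sep_def by blast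
      ultimately show False by linarith
    qed
    have "card (f ` S x0) = card (S x0)" by (rule card_image[OF inj])
    moreover have "f ` S x0 \<subseteq> S x" using f by blast
    moreover have "card (S x) \<le> card (S x0)"
      using card_S_le[of x] simple_decompose(2)[OF simple] by simp
    ultimately have "f ` S x0 = S x" by (metis card_seteq finite_S)
    with inj f show "\<exists>f. bij_betw f (S x0) (S x) \<and> (\<forall>s\<in>S x0. norm (s - f s) < \<delta>)"
      by (auto simp: bij_betw_def)
  qed
qed

end

section \<open>Sums over the roots, weighted by a locally constant function\<close>

lemma field_differentiable_prod:
  fixes f :: "'i \<Rightarrow> complex \<Rightarrow> complex"
  assumes "finite I" "\<And>i. i \<in> I \<Longrightarrow> f i field_differentiable (at z)"
  shows "(\<lambda>x. \<Prod>i\<in>I. f i x) field_differentiable (at z)"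
  using assms
  by (induction I rule: finite_induct) (auto intro: field_differentiable_mult field_differentiable_const)

lemma field_differentiable_sum':
  fixes f :: "'i \<Rightarrow> complex \<Rightarrow> complex"
  assumes "finite I" "\<And>i. i \<in> I \<Longrightarrow> f i field_differentiable (at z)"
  shows "(\<lambda>x. \<Sum>i\<in>I. f i x) field_differentiable (at z)"
  using assms
  by (induction I rule: finite_induct) (auto intro: field_differentiable_add field_differentiable_const)

text \<open>The residue is abstracted to a function \<open>r\<close> that enters through its local
  constancy at transverse zeros; \<open>D\<close> plays the part of a discriminant.\<close>

locale weighted_roots = hyp_line P u \<kappa>
  for P :: "'n::{finite,linorder} mpoly" and u :: "complex ^ 'n::{finite,linorder}" and \<kappa> :: complex +
  fixes r :: "complex ^ 'n::{finite,linorder} \<Rightarrow> complex" and D :: "'n mpoly"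
  assumes D: "D \<noteq> 0" and D_simple: "\<And>x. mpoly_eval D x \<noteq> 0 \<Longrightarrow> simple x"
    and r_loc: "\<And>y. mpoly_eval P y = 0 \<Longrightarrow> mpoly_eval (mpoly_dd u P) y \<noteq> 0 \<Longrightarrow>
      \<exists>\<delta>>0. \<forall>y'. dist y y' < \<delta> \<longrightarrow> mpoly_eval P y' = 0 \<longrightarrow> r y' = r y"
begin

lemma sheets_weight:
  assumes simple: "simple x0" and sep: "sep x0 \<epsilon>" and \<delta>: "\<delta> > 0" "\<delta> \<le> \<epsilon>"
  shows "\<exists>\<eta>>0. \<forall>x. dist x0 x < \<eta> \<longrightarrow> (\<exists>f. bij_betw f (S x0) (S x) \<and>
    (\<forall>s\<in>S x0. norm (s - f s) < \<delta> \<and> r (x + f s *s u) = r (x0 + s *s u)))"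
proof -
  have "\<forall>s\<in>S x0. \<exists>h>0. \<forall>y'. dist (x0 + s *s u) y' < h \<longrightarrow> mpoly_eval P y' = 0 \<longrightarrow> r y' = r (x0 + s *s u)"
  proof
    fix s assume "s \<in> S x0"
    then show "\<exists>h>0. \<forall>y'. dist (x0 + s *s u) y' < h \<longrightarrow> mpoly_eval P y' = 0 \<longrightarrow> r y' = r (x0 + s *s u)"
      using simple by (intro r_loc) (auto simp: S_def simple_def)
  qed
  then obtain h where h: "\<And>s. s \<in> S x0 \<Longrightarrow> h s > 0"
    "\<And>s y'. s \<in> S x0 \<Longrightarrow> dist (x0 + s *s u) y' < h s \<Longrightarrow> mpoly_eval P y' = 0 \<Longrightarrow> r y' = r (x0 + s *s u)"
    by metis
  define q where "q = Min (insert 1 (h ` S x0))"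
  have q: "q > 0" "\<And>s. s \<in> S x0 \<Longrightarrow> q \<le> h s"
    unfolding q_def using h(1) by (auto intro!: Min_le)
  \<comment> \<open>Half of the radius \<open>q\<close> is spent on the distance from
    \<open>x0\<close> to x, the other half on the displacement of the root along u;
    \<open>1 + norm u\<close> is a positive bound for the length of u.\<close>
  define \<delta>' where "\<delta>' = min \<delta> (q / (2 * (1 + norm u)))"
  have nu: "1 + norm u > 0" using norm_ge_zero[of u] by linarith
  have \<delta>': "\<delta>' > 0" "\<delta>' \<le> \<delta>" "\<delta>' \<le> q / (2 * (1 + norm u))"
    using q(1) \<delta>(1) nu by (simp_all add: \<delta>'_def)
  obtain \<eta> where \<eta>: "\<eta> > 0" "\<And>x. dist x0 x < \<eta> \<Longrightarrow> \<exists>f. bij_betw f (S x0) (S x) \<and> (\<forall>s\<in>S x0. norm (s - f s) < \<delta>')"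
    using sheets[OF simple sep \<delta>'(1)] \<delta>'(2) \<delta>(2) by force
  show ?thesis
  proof (intro exI[of _ "min \<eta> (q / 2)"] conjI allI impI)
    fix x assume x: "dist x0 x < min \<eta> (q / 2)"
    then obtain f where f: "bij_betw f (S x0) (S x)" "\<And>s. s \<in> S x0 \<Longrightarrow> norm (s - f s) < \<delta>'"
      using \<eta>(2)[of x] by auto
    have "r (x + f s *s u) = r (x0 + s *s u)" if s: "s \<in> S x0" for s
    proof (rule h(2)[OF s])
      have "f s \<in> S x" using f(1) s by (auto simp: bij_betw_def)
      then show "mpoly_eval P (x + f s *s u) = 0" by (simp add: S_def)
      have "dist (x0 + s *s u) (x + f s *s u) = norm ((x0 - x) + (s - f s) *s u)"
        by (simp add: dist_norm algebra_simps)
      also have "\<dots> \<le> dist x0 x + norm (s - f s) * norm u"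
        by (rule order_trans[OF norm_triangle_ineq]) (simp only: dist_norm norm_vector_smult_complex order_refl)
      also have "norm (s - f s) * norm u \<le> \<delta>' * (1 + norm u)"
        using f(2)[OF s] \<delta>'(1) by (intro mult_mono) auto
      also have "\<delta>' * (1 + norm u) \<le> q / 2"
        using \<delta>'(3) nu by (simp add: field_simps)
      finally have "dist (x0 + s *s u) (x + f s *s u) < q / 2 + q / 2" using x by simp
      then show "dist (x0 + s *s u) (x + f s *s u) < h s" using q(2)[OF s] by simp
    qed
    moreover have "norm (s - f s) < \<delta>" if "s \<in> S x0" for s using f(2)[OF that] \<delta>'(2) by linarith
    ultimately show "\<exists>f. bij_betw f (S x0) (S x) \<and>
      (\<forall>s\<in>S x0. norm (s - f s) < \<delta> \<and> r (x + f s *s u) = r (x0 + s *s u))" using f(1) by blast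
  qed (use \<eta> q in auto)
qed

text \<open>Bijections obtained for different tolerances agree, because closeness determines the
  sheet. This turns pointwise choices of bijections into continuous branches.\<close>

lemma sheet_unique:
  assumes sep: "sep x0 \<epsilon>" and f: "bij_betw f (S x0) (S x)" "\<And>s. s \<in> S x0 \<Longrightarrow> norm (s - f s) < \<epsilon>"
    and s: "s \<in> S x0" and z: "z \<in> S x" "norm (s - z) < \<epsilon>"
  shows "z = f s"
proof -
  obtain s1 where s1: "s1 \<in> S x0" "z = f s1" using f(1) z(1) by (auto simp: bij_betw_def)
  have "norm (s - s1) \<le> norm (s - z) + norm (s1 - f s1)"
    using norm_triangle_ineq4[of "s - z" "s1 - f s1"] s1(2) by simp
  also have "\<dots> < 2 * \<epsilon>" using z(2) f(2)[OF s1(1)] by linarith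
  finally have "norm (s - s1) < 2 * \<epsilon>" .
  then have "s = s1" using sep s s1(1) unfolding sep_def by force
  then show ?thesis using s1 by simp
qed

text \<open>The value at \<open>z = 0\<close> of the interpolation polynomial with the value \<open>r P'\<close> at the roots.\<close>

definition a :: "complex ^ 'n::{finite,linorder} \<Rightarrow> complex" where
  "a x = (\<Sum>s\<in>S x. r (x + s *s u) * (\<kappa> * (\<Prod>s'\<in>S x - {s}. - s')))"

text \<open>Near a simple \<open>x0\<close> the weights are constant along the sheets, so
  \<open>a\<close> is a polynomial expression in the branches \<open>\<phi> s\<close>, and each
  branch is differentiable. Summing over all roots removes the dependence on their
  labelling.\<close>

lemma a_field_differentiable:
  assumes simple: "simple x0"
  shows "(\<lambda>t. a (x0 + t *s v)) field_differentiable (at 0)"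
proof -
  obtain \<epsilon> where sep: "sep x0 \<epsilon>" using sep_exists by blast
  then have \<epsilon>: "\<epsilon> > 0" by (simp add: sep_def)
  obtain \<eta> where \<eta>: "\<eta> > 0" "\<And>x. dist x0 x < \<eta> \<Longrightarrow> \<exists>f. bij_betw f (S x0) (S x) \<and>
    (\<forall>s\<in>S x0. norm (s - f s) < \<epsilon> \<and> r (x + f s *s u) = r (x0 + s *s u))"
    using sheets_weight[OF simple sep \<epsilon>] by auto
  then obtain f where f: "\<And>x. dist x0 x < \<eta> \<Longrightarrow> bij_betw (f x) (S x0) (S x)"
    "\<And>x s. dist x0 x < \<eta> \<Longrightarrow> s \<in> S x0 \<Longrightarrow> norm (s - f x s) < \<epsilon>"
    "\<And>x s. dist x0 x < \<eta> \<Longrightarrow> s \<in> S x0 \<Longrightarrow> r (x + f x s *s u) = r (x0 + s *s u)"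
    by metis
  define \<phi> where "\<phi> = (\<lambda>s t. f (x0 + t *s v) s)"
  have near: "\<exists>\<rho>>0. \<forall>t. norm t < \<rho> \<longrightarrow> dist x0 (x0 + t *s v) < \<eta>'" if "\<eta>' > 0" for \<eta>'
  proof (intro exI[of _ "\<eta>' / (1 + norm v)"] conjI allI impI)
    have nv: "1 + norm v > 0" using norm_ge_zero[of v] by linarith
    then show "\<eta>' / (1 + norm v) > 0" using that by simp
    fix t :: complex assume "norm t < \<eta>' / (1 + norm v)"
    then have "norm t * (1 + norm v) < \<eta>'" using nv by (simp add: pos_less_divide_eq)
    moreover have "norm t * norm v \<le> norm t * (1 + norm v)" by (intro mult_left_mono) auto
    ultimately show "dist x0 (x0 + t *s v) < \<eta>'" by (simp add: dist_norm norm_vector_smult_complex)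
  qed
  obtain \<rho> where \<rho>: "\<rho> > 0" "\<And>t. norm t < \<rho> \<Longrightarrow> dist x0 (x0 + t *s v) < \<eta>" using near[OF \<eta>(1)] by blast
  have \<phi>0: "\<phi> s 0 = s" if s: "s \<in> S x0" for s
    using sheet_unique[OF sep f(1) f(2) s, of x0 s] s \<eta>(1) \<epsilon> by (simp add: \<phi>_def)
  have diff: "\<phi> s field_differentiable (at 0)" if s: "s \<in> S x0" for s
  proof (rule implicit_has_field_derivative)
    show "mpoly_eval (mpoly_dd u P) (x0 + s *s u) \<noteq> 0" "mpoly_eval P (x0 + s *s u) = 0"
      using simple s by (auto simp: simple_def S_def)
    show "\<phi> s 0 = s" by (rule \<phi>0[OF s])
    show "eventually (\<lambda>t. mpoly_eval P (x0 + t *s v + \<phi> s t *s u) = 0) (at 0)"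
      unfolding eventually_at
    proof (intro exI[of _ \<rho>] conjI ballI impI \<rho>(1))
      fix t :: complex assume "t \<noteq> 0 \<and> dist t 0 < \<rho>"
      then have "\<phi> s t \<in> S (x0 + t *s v)"
        using f(1)[OF \<rho>(2), of t] s by (auto simp: \<phi>_def bij_betw_def)
      then show "mpoly_eval P (x0 + t *s v + \<phi> s t *s u) = 0" by (simp add: S_def)
    qed
    show "(\<phi> s \<longlongrightarrow> s) (at 0)"
    proof (rule tendstoI)
      fix e :: real assume e: "e > 0"
      \<comment> \<open>\<open>\<phi> s\<close> was chosen with tolerance \<open>\<epsilon>\<close>
        only. A bijection with the finer tolerance \<open>\<delta>\<close> has to coincide with it,
        which gives continuity.\<close>
      define \<delta> where "\<delta> = min e \<epsilon>"
      have \<delta>: "\<delta> > 0" "\<delta> \<le> \<epsilon>" using e \<epsilon> by (auto simp: \<delta>_def)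
      obtain \<eta>' where \<eta>': "\<eta>' > 0" "\<And>x. dist x0 x < \<eta>' \<Longrightarrow> \<exists>f. bij_betw f (S x0) (S x) \<and> (\<forall>s\<in>S x0. norm (s - f s) < \<delta>)"
        using sheets[OF simple sep \<delta>] by blast
      obtain \<rho>' where \<rho>': "\<rho>' > 0" "\<And>t. norm t < \<rho>' \<Longrightarrow> dist x0 (x0 + t *s v) < \<eta>'" using near[OF \<eta>'(1)] by blast
      show "eventually (\<lambda>t. dist (\<phi> s t) s < e) (at 0)"
        unfolding eventually_at
      proof (intro exI[of _ "min \<rho> \<rho>'"] conjI ballI impI)
        fix t :: complex assume t: "t \<noteq> 0 \<and> dist t 0 < min \<rho> \<rho>'"
        then obtain g where g: "bij_betw g (S x0) (S (x0 + t *s v))" "\<forall>s\<in>S x0. norm (s - g s) < \<delta>"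
          using \<eta>'(2)[OF \<rho>'(2), of t] by auto
        have near_t: "dist x0 (x0 + t *s v) < \<eta>" using \<rho>(2) t by simp
        have "g s = f (x0 + t *s v) s"
        proof (rule sheet_unique[OF sep f(1)[OF near_t] f(2)[OF near_t] s])
          show "g s \<in> S (x0 + t *s v)" using g(1) s by (auto simp: bij_betw_def)
          show "norm (s - g s) < \<epsilon>" using g(2) s \<delta>(2) by force
        qed
        then have "norm (s - \<phi> s t) < \<delta>" using g(2) s by (auto simp: \<phi>_def)
        then show "dist (\<phi> s t) s < e" by (simp add: dist_norm norm_minus_commute \<delta>_def)
      qed (use \<rho> \<rho>' in auto)
    qed
  qed
  define b where "b = (\<lambda>t. \<Sum>s\<in>S x0. r (x0 + s *s u) * (\<kappa> * (\<Prod>s'\<in>S x0 - {s}. - \<phi> s' t)))"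
  have bd: "b field_differentiable (at 0)"
    unfolding b_def using diff
    by (intro field_differentiable_sum' field_differentiable_mult field_differentiable_prod
        field_differentiable_minus field_differentiable_const) auto
  have eq: "b t = a (x0 + t *s v)" if t: "dist t 0 < \<rho>" for t
  proof -
    have near_t: "dist x0 (x0 + t *s v) < \<eta>" using \<rho>(2) t by simp
    let ?x = "x0 + t *s v"
    have bij: "bij_betw (f ?x) (S x0) (S ?x)" by (rule f(1)[OF near_t])
    have "a ?x = (\<Sum>s\<in>S x0. r (?x + f ?x s *s u) * (\<kappa> * (\<Prod>s'\<in>S ?x - {f ?x s}. - s')))"
      unfolding a_def by (rule sum.reindex_bij_betw[OF bij, symmetric])
    also have "\<dots> = b t"
      unfolding b_def
    proof (rule sum.cong[OF refl])
      fix s assume s: "s \<in> S x0"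
      have "bij_betw (f ?x) (S x0 - {s}) (S ?x - {f ?x s})"
        using bij s by (intro bij_betw_DiffI) (auto simp: bij_betw_def)
      then have "(\<Prod>s'\<in>S x0 - {s}. - f ?x s') = (\<Prod>s'\<in>S ?x - {f ?x s}. - s')"
        by (rule prod.reindex_bij_betw)
      with f(3)[OF near_t s] show "r (?x + f ?x s *s u) * (\<kappa> * (\<Prod>s'\<in>S ?x - {f ?x s}. - s')) =
        r (x0 + s *s u) * (\<kappa> * (\<Prod>s'\<in>S x0 - {s}. - \<phi> s' t))" by (simp add: \<phi>_def)
    qed
    finally show ?thesis by simp
  qed
  show ?thesis
    by (rule field_differentiable_transform_within[OF \<rho>(1) UNIV_I eq bd])
qed

lemma a_field_differentiable':
  assumes "simple (x0 + t *s v)"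
  shows "(\<lambda>t. a (x0 + t *s v)) field_differentiable (at t)"
proof -
  have "(\<lambda>h. a (x0 + t *s v + h *s v)) field_differentiable (at 0)"
    by (rule a_field_differentiable[OF assms])
  then obtain d where d: "((\<lambda>h. a (x0 + t *s v + h *s v)) has_field_derivative d) (at 0)"
    by (auto simp: field_differentiable_def)
  have "x0 + t *s v + h *s v = x0 + (h + t) *s v" for h by (simp add: vec_eq_iff algebra_simps)
  with d have "((\<lambda>h. a (x0 + (h + t) *s v)) has_field_derivative d) (at 0)" by simp
  then have "((\<lambda>t. a (x0 + t *s v)) has_field_derivative d) (at (0 + t))"
    by (subst DERIV_shift)
  then show ?thesis by (auto simp: field_differentiable_def)
qed

text \<open>The sum of |r| over the roots is locally constant where \<open>D\<close> does not
  vanish. That set is connected, so the sum is a constant there, which bounds the weights;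
  \<open>roots_bound\<close> controls the products of roots.\<close>

lemma a_growth: "\<exists>C. poly_growth C \<and> (\<forall>x. C x \<ge> 0) \<and> (\<forall>x. mpoly_eval D x \<noteq> 0 \<longrightarrow> norm (a x) \<le> C x) \<and>
   (\<forall>x v. continuous_on UNIV (\<lambda>t. C (x + t *s v)))"
proof -
  define \<rho> where "\<rho> = (\<lambda>x. \<Sum>s\<in>S x. norm (r (x + s *s u)))"
  let ?A = "UNIV - {x. mpoly_eval D x = 0}"
  have "\<rho> x = \<rho> y" if "x \<in> ?A" "y \<in> ?A" for x y
  proof (rule connected_local_const[of ?A])
    show "connected ?A" by (rule convex_diff_zeros(1)[OF D]) auto
    show "\<forall>x\<in>?A. eventually (\<lambda>y. \<rho> x = \<rho> y) (at x within ?A)"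
    proof
      fix x assume "x \<in> ?A"
      then have simple: "simple x" using D_simple by blast
      obtain \<epsilon> where sep: "sep x \<epsilon>" using sep_exists by blast
      then have \<epsilon>: "\<epsilon> > 0" by (simp add: sep_def)
      obtain \<eta> where \<eta>: "\<eta> > 0" "\<And>y. dist x y < \<eta> \<Longrightarrow> \<exists>f. bij_betw f (S x) (S y) \<and>
        (\<forall>s\<in>S x. norm (s - f s) < \<epsilon> \<and> r (y + f s *s u) = r (x + s *s u))"
        using sheets_weight[OF simple sep \<epsilon>] by auto
      have "\<rho> x = \<rho> y" if y: "dist x y < \<eta>" for y
      proof -
        obtain f where f: "bij_betw f (S x) (S y)" "\<And>s. s \<in> S x \<Longrightarrow> r (y + f s *s u) = r (x + s *s u)"
          using \<eta>(2)[OF y] by blast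
        have "\<rho> y = (\<Sum>s\<in>S x. norm (r (y + f s *s u)))"
          unfolding \<rho>_def by (rule sum.reindex_bij_betw[OF f(1), symmetric])
        also have "\<dots> = \<rho> x" unfolding \<rho>_def by (rule sum.cong) (auto simp: f(2))
        finally show ?thesis by simp
      qed
      then show "eventually (\<lambda>y. \<rho> x = \<rho> y) (at x within ?A)"
        unfolding eventually_at using \<eta>(1) by (auto simp: dist_commute)
    qed
  qed (use that in auto)
  then obtain c where c: "\<And>x. mpoly_eval D x \<noteq> 0 \<Longrightarrow> \<rho> x = c"
    by (metis (mono_tags, lifting) DiffI UNIV_I mem_Collect_eq)
  obtain K N where K: "K \<ge> 0" "\<And>x z. ev2 (shift u P) x z = 0 \<Longrightarrow> norm z \<le> K * (1 + norm x ^ 2) ^ N"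
    using roots_bound[OF lead \<kappa>] by blast
  define B where "B = (\<lambda>x::complex^'n::{finite,linorder}. 1 + K * (1 + norm x ^ 2) ^ N)"
  have B1: "B x \<ge> 1" for x using K(1) by (simp add: B_def)
  have SB: "norm s \<le> B x" if "s \<in> S x" for s x
    using K(2)[of x s] that by (simp add: B_def S_def)
  define d where "d = degree (shift u P)"
  define C where "C = (\<lambda>x. \<bar>c\<bar> * (norm \<kappa> * B x ^ d))"
  have "poly_growth C"
    unfolding C_def B_def
    by (intro poly_growth_mult poly_growth_power poly_growth_add poly_growth_const poly_growth_nu)
  moreover have "C x \<ge> 0" for x using B1[of x] by (auto simp: C_def intro!: mult_nonneg_nonneg)
  moreover have "norm (a x) \<le> C x" if x: "mpoly_eval D x \<noteq> 0" for x
  proof -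
    have "norm (a x) \<le> (\<Sum>s\<in>S x. norm (r (x + s *s u)) * (norm \<kappa> * B x ^ d))"
      unfolding a_def
    proof (rule sum_norm_le)
      fix s assume s: "s \<in> S x"
      have "norm (\<Prod>s'\<in>S x - {s}. - s') \<le> (\<Prod>s'\<in>S x - {s}. B x)"
        unfolding prod_norm[symmetric] using SB by (intro prod_mono) auto
      also have "\<dots> = B x ^ card (S x - {s})" by simp
      also have "\<dots> \<le> B x ^ d"
      proof (rule power_increasing[OF _ B1])
        show "card (S x - {s}) \<le> d"
          using card_S_le[of x] card_Diff1_le[of "S x" s] by (simp add: d_def)
      qed
      finally show "norm (r (x + s *s u) * (\<kappa> * (\<Prod>s'\<in>S x - {s}. - s'))) \<le> norm (r (x + s *s u)) * (norm \<kappa> * B x ^ d)"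
        by (simp add: norm_mult mult_left_mono)
    qed
    also have "\<dots> = \<rho> x * (norm \<kappa> * B x ^ d)" by (simp add: \<rho>_def sum_distrib_right)
    also have "\<dots> \<le> C x"
      using c[OF x] B1[of x] by (auto simp: C_def intro!: mult_right_mono)
    finally show ?thesis .
  qed
  moreover have "continuous_on UNIV (\<lambda>t. C (x + t *s v))" for x v
    unfolding C_def B_def by (intro continuous_intros)
  ultimately show ?thesis by blast
qed

text \<open>The factor \<open>D\<^sup>2\<close> makes the function differentiable, with derivative \<open>0\<close>, also at the zeros of \<open>D\<close>.\<close>

lemma a_poly: "\<exists>A. \<forall>x. mpoly_eval D x \<noteq> 0 \<longrightarrow> a x = mpoly_eval A x"
proof -
  obtain C where C: "poly_growth C" "\<And>x. C x \<ge> 0" "\<And>x. mpoly_eval D x \<noteq> 0 \<Longrightarrow> norm (a x) \<le> C x"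
    "\<And>x v. continuous_on UNIV (\<lambda>t. C (x + t *s v))" using a_growth by blast
  define G where "G = (\<lambda>x. mpoly_eval D x ^ 2 * a x)"
  have bound: "norm (G x) \<le> C x * norm (mpoly_eval D x ^ 2)" for x
  proof (cases "mpoly_eval D x = 0")
    case False
    then show ?thesis using C(3)[of x] by (simp add: G_def norm_mult mult.commute mult_right_mono)
  qed (simp add: G_def)
  have "poly_growth (\<lambda>x. norm (G x))"
  proof (rule poly_growth_mono)
    have "poly_growth (\<lambda>x. norm (mpoly_eval (D ^ 2) x))" by (rule poly_growth_mpoly)
    then show "poly_growth (\<lambda>x. C x * norm (mpoly_eval (D ^ 2) x))" by (rule poly_growth_mult[OF C(1)])
    show "\<bar>norm (G x)\<bar> \<le> \<bar>C x * norm (mpoly_eval (D ^ 2) x)\<bar>" for x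
      using bound[of x] C(2)[of x] by simp
  qed
  moreover have "(\<lambda>t. G (x + t *s v)) holomorphic_on UNIV" for x v
    unfolding holomorphic_on_def
  proof
    fix t
    have Dd: "((\<lambda>t. mpoly_eval D (x + t *s v)) has_field_derivative mpoly_eval (mpoly_dd v D) (x + t *s v)) (at t)"
      by (rule has_field_derivative_mpoly_line)
    show "(\<lambda>t. G (x + t *s v)) field_differentiable (at t)"
    proof (cases "mpoly_eval D (x + t *s v) = 0")
      case False
      then have "(\<lambda>t. a (x + t *s v)) field_differentiable (at t)"
        by (intro a_field_differentiable' D_simple)
      moreover have "(\<lambda>t. mpoly_eval D (x + t *s v) ^ 2) field_differentiable (at t)"
        using field_differentiable_power Dd field_differentiable_def by blast
      ultimately show ?thesis unfolding G_def by (intro field_differentiable_mult)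
    next
      case True
      let ?D2 = "\<lambda>t. mpoly_eval D (x + t *s v) ^ 2"
      have "(?D2 has_field_derivative 0) (at t)"
        using DERIV_power[OF Dd, of 2] True by simp
      then have lim: "(\<lambda>h. ?D2 (t + h) / h) \<midarrow>0\<rightarrow> 0" using True by (simp add: DERIV_def)
      have "isCont (\<lambda>h. C (x + (t + h) *s v)) 0"
        using continuous_on_compose2[OF C(4)[of x v], of UNIV "\<lambda>h. t + h"]
        by (simp add: continuous_on_eq_continuous_at continuous_on_add)
      then have "(\<lambda>h. C (x + (t + h) *s v)) \<midarrow>0\<rightarrow> C (x + (t + 0) *s v)" by (rule isContD)
      from tendsto_mult[OF this tendsto_norm[OF lim]]
      have lim2: "(\<lambda>h. C (x + (t + h) *s v) * norm (?D2 (t + h) / h)) \<midarrow>0\<rightarrow> 0" by simp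
      have "(\<lambda>h. G (x + (t + h) *s v) / h) \<midarrow>0\<rightarrow> 0"
      proof (rule Lim_null_comparison[OF _ lim2])
        show "eventually (\<lambda>h. norm (G (x + (t + h) *s v) / h) \<le> C (x + (t + h) *s v) * norm (?D2 (t + h) / h)) (at 0)"
          using bound by (intro always_eventually allI) (simp add: norm_divide divide_right_mono)
      qed
      then have "((\<lambda>t. G (x + t *s v)) has_field_derivative 0) (at t)"
        using True by (simp add: DERIV_def G_def)
      then show ?thesis by (auto simp: field_differentiable_def)
    qed
  qed
  ultimately obtain G' where G': "\<And>x. G x = mpoly_eval G' x"
    using mpoly_if_entire_on_lines[of G] by blast
  \<comment> \<open>The quotient of \<open>G'\<close> by D^2 is dominated by \<open>C\<close>, so it
    is a polynomial, and it equals \<open>a\<close> off the zeros of \<open>D\<close>.\<close>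
  have "D ^ 2 dvd G'"
  proof (rule mpoly_dvd_if_bounded[OF _ C(1)])
    show "norm (mpoly_eval G' x) \<le> C x * norm (mpoly_eval (D ^ 2) x)" for x
      using bound[of x] by (simp add: G')
  qed (use D in simp)
  then obtain A where A: "G' = D ^ 2 * A" by (rule dvdE)
  have "a x = mpoly_eval A x" if "mpoly_eval D x \<noteq> 0" for x
    using G'[of x] that by (simp add: A G_def)
  then show ?thesis by blast
qed

text \<open>For y on V(P) the parameter 0 is itself a root. In \<open>a y\<close> every summand of
  another root contains the factor - 0, and what remains is the residue times the derivative along
  u. Simple points over D = 0 are reached by continuity along a line on which \<open>D\<close> is
  not identically 0.\<close>

lemma weight_poly:
  "\<exists>A. \<forall>y. simple y \<longrightarrow> mpoly_eval P y = 0 \<longrightarrow> mpoly_eval A y = r y * mpoly_eval (mpoly_dd u P) y"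
proof -
  obtain A where A: "\<And>x. mpoly_eval D x \<noteq> 0 \<Longrightarrow> a x = mpoly_eval A x" using a_poly by blast
  have "mpoly_eval A y = r y * mpoly_eval (mpoly_dd u P) y" if y: "simple y" "mpoly_eval P y = 0" for y
  proof -
    obtain w where w: "mpoly_eval D w \<noteq> 0" using mpoly_nonzero_dense[OF D, of 1 0] by auto
    define v where "v = w - y"
    have "mpoly_eval D (y + 1 *s v) \<noteq> 0" using w by (simp add: v_def)
    then have fin: "finite {t. mpoly_eval D (y + t *s v) = 0}" by (rule evp_shift_eq_0_finite)
    have "isCont (\<lambda>t. a (y + t *s v)) 0"
      by (rule field_differentiable_imp_continuous_at[OF a_field_differentiable[OF y(1)]])
    then have 1: "((\<lambda>t. a (y + t *s v)) \<longlongrightarrow> a y) (at 0)" by (simp add: isCont_def)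
    have "continuous_on UNIV (\<lambda>t. mpoly_eval A (y + t *s v))" by (intro continuous_intros)
    then have "isCont (\<lambda>t. mpoly_eval A (y + t *s v)) 0" by (simp add: continuous_on_eq_continuous_at)
    then have 2: "((\<lambda>t. mpoly_eval A (y + t *s v)) \<longlongrightarrow> mpoly_eval A y) (at 0)" by (simp add: isCont_def)
    have "open (- ({t. mpoly_eval D (y + t *s v) = 0} - {0}))"
      by (intro open_Compl finite_imp_closed finite_Diff fin)
    then have "eventually (\<lambda>t. t \<notin> {t. mpoly_eval D (y + t *s v) = 0}) (at 0)"
      unfolding eventually_at_topological by (intro exI[of _ "- ({t. mpoly_eval D (y + t *s v) = 0} - {0})"]) auto
    then have "eventually (\<lambda>t. mpoly_eval A (y + t *s v) = a (y + t *s v)) (at 0)"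
      by eventually_elim (simp add: A)
    then have "((\<lambda>t. a (y + t *s v)) \<longlongrightarrow> mpoly_eval A y) (at 0)"
      using 2 by (rule Lim_transform_eventually[rotated])
    from tendsto_unique[OF _ 1 this] have aA: "a y = mpoly_eval A y" by simp
    have 0: "0 \<in> S y" using y by (simp add: S_def)
    have "a y = r (y + 0 *s u) * (\<kappa> * (\<Prod>s'\<in>S y - {0}. - s'))"
    proof -
      have "(\<Sum>s\<in>S y - {0}. r (y + s *s u) * (\<kappa> * (\<Prod>s'\<in>S y - {s}. - s'))) = 0"
        using 0 by (intro sum.neutral ballI) (auto intro!: prod_zero bexI[of _ 0])
      then show ?thesis unfolding a_def by (subst sum.remove[OF finite_S 0]) simp
    qed
    moreover have "poly (pderiv (pol y)) 0 = \<kappa> * (\<Prod>s'\<in>S y - {0}. - s')"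
    proof -
      have "pol y = [:0, 1:] * smult \<kappa> (\<Prod>s\<in>S y - {0}. [:- s, 1:])"
        by (subst simple_decompose(1)[OF y(1)], subst prod.remove[OF finite_S 0]) simp
      then show ?thesis by (simp add: pderiv_mult pderiv_pCons poly_prod)
    qed
    moreover have "poly (pderiv (pol y)) 0 = mpoly_eval (mpoly_dd u P) y"
      using poly_pderiv_pol[of y 0] by simp
    ultimately show ?thesis using aA by simp
  qed
  then show ?thesis by blast
qed

end

section \<open>Residues along a line\<close>

locale form_along_line = hyp_line P u \<kappa>
  for P :: "'n::{finite,linorder} mpoly" and u :: "complex ^ 'n::{finite,linorder}" and \<kappa> :: complex +
  fixes \<omega> :: "(complex ^ 'n::{finite,linorder}) form1"
  assumes loc: "loc_exact {x. mpoly_eval P x \<noteq> 0} \<omega>"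
begin

definition lf :: "complex ^ 'n::{finite,linorder} \<Rightarrow> complex form1" where
  "lf x = (\<lambda>z w. \<omega> (x + z *s u) (w *s u))"

text \<open>The residue is taken at z = 0 on the line through y, on a punctured disc of unspecified
  radius; y may be a multiple zero of P on that line.\<close>

definition residue_at :: "complex ^ 'n::{finite,linorder} \<Rightarrow> complex \<Rightarrow> bool" where
  "residue_at y c \<longleftrightarrow> (\<exists>\<epsilon>>0. exact_on (ball 0 \<epsilon> - {0}) (\<lambda>z w. lf y z w - c / z * w))"

lemma lf_translate: "lf (x + t *s u) z = lf x (z + t)"
proof -
  have "x + t *s u + z *s u = x + (z + t) *s u" by (simp add: vec_eq_iff algebra_simps)
  then show ?thesis by (simp only: lf_def)
qed

lemma lf_loc_exact:
  assumes "open Y" "\<And>z. z \<in> Y \<Longrightarrow> mpoly_eval P (x + z *s u) \<noteq> 0"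
  shows "loc_exact Y (lf x)"
  unfolding lf_def
  by (rule loc_exact_pullback[OF loc assms(1)]) (use assms(2) in \<open>auto intro!: derivative_eq_intros\<close>)

lemma punctured_nbhd: "\<exists>\<epsilon>>0. \<forall>z. norm z < \<epsilon> \<longrightarrow> z \<noteq> 0 \<longrightarrow> mpoly_eval P (y + z *s u) \<noteq> 0"
proof -
  have "open (- (S y - {0}))"
    by (intro open_Compl finite_imp_closed finite_Diff finite_S)
  then obtain \<epsilon> where "\<epsilon> > 0" "ball 0 \<epsilon> \<subseteq> - (S y - {0})"
    by (rule openE[of _ 0]) auto
  then show ?thesis by (intro exI[of _ \<epsilon>]) (auto simp: S_def subset_iff)
qed

lemma residue_on:
  assumes "\<epsilon> > 0" "\<And>z. norm z < \<epsilon> \<Longrightarrow> z \<noteq> 0 \<Longrightarrow> mpoly_eval P (y + z *s u) \<noteq> 0"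
  shows "\<exists>c. exact_on (ball 0 \<epsilon> - {0}) (\<lambda>z w. lf y z w - c / z * w)"
proof -
  have "loc_exact (ball 0 \<epsilon> - {0}) (lf y)"
    by (rule lf_loc_exact) (use assms in auto)
  from residue_exists[OF this assms(1)] show ?thesis by simp
qed

lemma residue_at_exists: "\<exists>c. residue_at y c"
  using punctured_nbhd[of y] residue_on[of _ y] unfolding residue_at_def by metis

lemma tube_nbhd:
  assumes K: "compact K" and "\<And>z. z \<in> K \<Longrightarrow> mpoly_eval P (x0 + z *s u) \<noteq> 0"
  shows "\<exists>\<delta>>0. \<forall>x z. dist x0 x < \<delta> \<longrightarrow> z \<in> K \<longrightarrow> mpoly_eval P (x + z *s u) \<noteq> 0"
proof -
  define O' where "O' = {p. mpoly_eval P (fst p + snd p *s u) \<noteq> 0}"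
  have "open O'"
    unfolding O'_def by (intro open_Collect_neq continuous_intros)
  moreover have "compact ({x0} \<times> K)" using K by (intro compact_Times) auto
  moreover have "{x0} \<times> K \<subseteq> O'" using assms(2) by (auto simp: O'_def)
  ultimately obtain \<epsilon> where \<epsilon>: "\<epsilon> > 0" "(\<Union>p\<in>{x0} \<times> K. ball p \<epsilon>) \<subseteq> O'"
    using compact_subset_open_imp_ball_epsilon_subset by metis
  have "mpoly_eval P (x + z *s u) \<noteq> 0" if "dist x0 x < \<epsilon>" "z \<in> K" for x z
  proof -
    have "(x, z) \<in> ball (x0, z) \<epsilon>" using that by (simp add: dist_Pair_Pair)
    then have "(x, z) \<in> O'" using \<epsilon>(2) that(2) by blast
    then show ?thesis by (simp add: O'_def)
  qed
  with \<epsilon>(1) show ?thesis by blast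
qed

text \<open>The pullback of \<open>\<omega>\<close> under (x, z) \<mapsto> x + z u, minus c dz / z,
  is locally exact on the product, so exactness on the single line over \<open>x1\<close> suffices.
  The condition on \<open>c\<close> keeps c / z holomorphic on \<open>Y\<close>.\<close>

lemma tube_exact:
  assumes X: "open X" "convex X" and Y: "open Y"
    and XY: "\<And>x z. x \<in> X \<Longrightarrow> z \<in> Y \<Longrightarrow> mpoly_eval P (x + z *s u) \<noteq> 0"
    and x1: "x1 \<in> X" and ex: "exact_on Y (\<lambda>z w. lf x1 z w - c / z * w)" and c: "c = 0 \<or> 0 \<notin> Y"
  shows "exact_on (X \<times> Y) (\<lambda>p h. \<omega> (fst p + snd p *s u) (fst h + snd h *s u) - c / snd p * snd h)"
proof (rule exact_on_tube[OF X Y _ x1])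
  have op: "open (X \<times> Y)" using X Y by (intro open_Times)
  have "loc_exact (X \<times> Y) (\<lambda>p h. \<omega> (fst p + snd p *s u) (fst h + snd h *s u))"
    by (rule loc_exact_pullback[OF loc op]) (use XY in \<open>auto intro!: derivative_eq_intros\<close>)
  moreover have "loc_exact (X \<times> Y) (\<lambda>p h. c / snd p * snd h)"
  proof -
    have "(\<lambda>z. c / z) holomorphic_on Y"
      using c by (cases "c = 0") (auto intro!: holomorphic_intros)
    then have "loc_exact Y (\<lambda>z w. c / z * w)" by (rule loc_exact_holomorphic[OF Y])
    show ?thesis
    proof (rule loc_exact_pullback[OF \<open>loc_exact Y (\<lambda>z w. c / z * w)\<close> op, of snd "\<lambda>_. snd"])
      show "snd x \<in> Y \<and> (snd has_derivative snd) (at x)" if "x \<in> X \<times> Y" for x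
        using that bounded_linear_imp_has_derivative[OF bounded_linear_snd] by auto
    qed
  qed
  ultimately show "loc_exact (X \<times> Y) (\<lambda>p h. \<omega> (fst p + snd p *s u) (fst h + snd h *s u) - c / snd p * snd h)"
    by (rule loc_exact_diff)
  show "exact_on Y (\<lambda>z w. \<omega> (fst (x1, z) + snd (x1, z) *s u) (fst (0::complex^'n::{finite,linorder}, w) + snd (0::complex^'n::{finite,linorder}, w) *s u)
     - c / snd (x1, z) * snd (0::complex^'n::{finite,linorder}, w))"
    using ex by (simp add: lf_def)
qed

lemma primitive_slice:
  assumes "primitive_on (X \<times> Y) (\<lambda>p h. \<omega> (fst p + snd p *s u) (fst h + snd h *s u) - c / snd p * snd h) H" "x \<in> X"
  shows "primitive_on Y (\<lambda>z w. lf x z w - c / z * w) (\<lambda>z. H (x, z))"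
proof -
  have "primitive_on Y (\<lambda>z w. \<omega> (fst (x, z) + snd (x, z) *s u) (fst (0::complex^'n::{finite,linorder}, w) + snd (0::complex^'n::{finite,linorder}, w) *s u)
     - c / snd (x, z) * snd (0::complex^'n::{finite,linorder}, w)) (\<lambda>z. H (x, z))"
    by (rule primitive_on_pullback[OF assms(1), of Y "\<lambda>z. (x, z)" "\<lambda>z w. (0, w)"])
       (use assms(2) in \<open>auto intro!: derivative_eq_intros\<close>)
  then show ?thesis by (simp add: lf_def)
qed

lemma tube_slice:
  assumes X: "open X" "convex X" and Y: "open Y"
    and XY: "\<And>x z. x \<in> X \<Longrightarrow> z \<in> Y \<Longrightarrow> mpoly_eval P (x + z *s u) \<noteq> 0"
    and x1: "x1 \<in> X" and ex: "exact_on Y (\<lambda>z w. lf x1 z w - c / z * w)" and c: "c = 0 \<or> 0 \<notin> Y"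
    and x: "x \<in> X"
  shows "exact_on Y (\<lambda>z w. lf x z w - c / z * w)"
  using tube_exact[OF X Y XY x1 ex c] primitive_slice[OF _ x] unfolding exact_on_def by blast

text \<open>The annulus avoids V(P) for all x in \<open>X\<close>, so the correction that works at
  \<open>x1\<close> also works at \<open>x2\<close>, and the difference (c1 - c2) dz / z can be
  exact only if it is 0. Zeros inside the inner circle may split or merge as x moves; their total
  residue is what is compared.\<close>

lemma annulus_residue_eq:
  assumes \<epsilon>: "\<epsilon> > 0" and X: "open X" "convex X"
    and XY: "\<And>x z. x \<in> X \<Longrightarrow> \<epsilon> / 4 < norm z \<Longrightarrow> norm z < \<epsilon> / 2 \<Longrightarrow> mpoly_eval P (x + z *s u) \<noteq> 0"
    and x: "x1 \<in> X" "x2 \<in> X"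
    and ex1: "exact_on {z. \<epsilon> / 4 < norm z \<and> norm z < \<epsilon> / 2} (\<lambda>z w. lf x1 z w - c1 / z * w)"
    and ex2: "exact_on {z. \<epsilon> / 4 < norm z \<and> norm z < \<epsilon> / 2} (\<lambda>z w. lf x2 z w - c2 / z * w)"
  shows "c1 = c2"
proof -
  let ?Y = "{z::complex. \<epsilon> / 4 < norm z \<and> norm z < \<epsilon> / 2}"
  have "open ?Y" by (intro open_Collect_conj open_Collect_less continuous_intros)
  have "exact_on ?Y (\<lambda>z w. lf x2 z w - c1 / z * w)"
    by (rule tube_slice[OF X \<open>open ?Y\<close> _ x(1) ex1 _ x(2)]) (use XY \<epsilon> in auto)
  from exact_on_diff[OF ex2 this]
  have "exact_on ?Y (\<lambda>z w. (\<lambda>_. c1 - c2) z / (z - 0) * w)" by (simp add: diff_divide_distrib algebra_simps)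
  then have "(\<lambda>_. c1 - c2) 0 = 0"
    \<comment> \<open>3 \<epsilon> / 8 is the middle radius of the annulus.\<close>
    by (rule exact_on_simple_pole[of _ 0 "3 * \<epsilon> / 8", rotated 2]) (use \<epsilon> in auto)
  then show ?thesis by simp
qed

lemma residue_at_unique:
  assumes "residue_at y c1" "residue_at y c2"
  shows "c1 = c2"
proof -
  obtain \<epsilon>1 \<epsilon>2 where *: "\<epsilon>1 > 0" "exact_on (ball 0 \<epsilon>1 - {0}) (\<lambda>z w. lf y z w - c1 / z * w)"
    "\<epsilon>2 > 0" "exact_on (ball 0 \<epsilon>2 - {0}) (\<lambda>z w. lf y z w - c2 / z * w)"
    using assms unfolding residue_at_def by blast
  define \<epsilon> where "\<epsilon> = min \<epsilon>1 \<epsilon>2"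
  have \<epsilon>: "\<epsilon> > 0" using * by (simp add: \<epsilon>_def)
  have e1: "exact_on (ball 0 \<epsilon> - {0}) (\<lambda>z w. lf y z w - c1 / z * w)"
    by (rule exact_on_subset[OF *(2)]) (auto simp: \<epsilon>_def)
  have e2: "exact_on (ball 0 \<epsilon> - {0}) (\<lambda>z w. lf y z w - c2 / z * w)"
    by (rule exact_on_subset[OF *(4)]) (auto simp: \<epsilon>_def)
  from exact_on_diff[OF e1 e2]
  have "exact_on (ball 0 \<epsilon> - {0}) (\<lambda>z w. (\<lambda>_. c2 - c1) z / (z - 0) * w)" by (simp add: diff_divide_distrib algebra_simps)
  then have "(\<lambda>_. c2 - c1) 0 = 0"
    by (rule exact_on_simple_pole[of _ 0 "\<epsilon> / 2", rotated 2]) (use \<epsilon> in auto)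
  then show ?thesis by simp
qed

section \<open>The residue as a function on V(P)\<close>

definition res :: "complex ^ 'n::{finite,linorder} \<Rightarrow> complex" where
  "res y = (SOME c. residue_at y c)"

lemma residue_at_res: "residue_at y (res y)"
  unfolding res_def using residue_at_exists by (rule someI_ex)

lemma residue_at_iff: "residue_at y c \<longleftrightarrow> res y = c"
  using residue_at_res residue_at_unique by blast

lemma compact_annulus: "compact {z::complex. a \<le> norm z \<and> norm z \<le> b}"
proof -
  have "closed {z::complex. a \<le> norm z \<and> norm z \<le> b}"
    by (intro closed_Collect_conj closed_Collect_le continuous_intros)
  moreover have "bounded {z::complex. a \<le> norm z \<and> norm z \<le> b}"
    by (rule boundedI[of _ b]) auto
  ultimately show ?thesis by (simp add: compact_eq_bounded_closed)
qed

text \<open>Near \<open>y0\<close> the function P(y + z u) - b z has z-derivative of modulus at most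
  |b| / 2, so a second zero at z would give |b z| \<le> |b z| / 2.\<close>

lemma line_injective_nbhd:
  assumes "mpoly_eval (mpoly_dd u P) y0 \<noteq> 0"
  shows "\<exists>\<rho>>0. \<forall>y z. dist y0 y < \<rho> \<longrightarrow> norm z < \<rho> \<longrightarrow> z \<noteq> 0 \<longrightarrow> mpoly_eval P y = 0 \<longrightarrow> mpoly_eval P (y + z *s u) \<noteq> 0"
proof -
  define b where "b = mpoly_eval (mpoly_dd u P) y0"
  have "b \<noteq> 0" using assms by (simp add: b_def)
  define g where "g = (\<lambda>p. mpoly_eval (mpoly_dd u P) (fst p + snd p *s u))"
  have "continuous_on UNIV g" unfolding g_def by (intro continuous_intros)
  then have "isCont g (y0, 0)" by (simp add: continuous_on_eq_continuous_at)
  moreover have "norm b / 2 > 0" using \<open>b \<noteq> 0\<close> by simp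
  ultimately obtain d where d: "d > 0" "\<And>p. dist p (y0, 0) < d \<Longrightarrow> dist (g p) (g (y0, 0)) < norm b / 2"
    unfolding continuous_at_eps_delta by blast
  define \<rho> where "\<rho> = d / 2"
  have close: "norm (mpoly_eval (mpoly_dd u P) (y + z *s u) - b) \<le> norm b / 2" if "dist y0 y < \<rho>" "norm z < \<rho>" for y z
  proof -
    have "dist (y, z) (y0, 0) \<le> dist y y0 + norm z"
      using norm_Pair_le[of "y - y0" z] by (simp add: dist_norm)
    also have "\<dots> < d" using that by (simp add: \<rho>_def dist_commute)
    finally have "dist (g (y, z)) (g (y0, 0)) < norm b / 2" by (rule d(2))
    then show ?thesis by (simp add: g_def b_def dist_norm)
  qed
  show ?thesis
  proof (intro exI[of _ \<rho>] conjI allI impI notI)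
    show "\<rho> > 0" using d by (simp add: \<rho>_def)
    fix y z assume y: "dist y0 y < \<rho>" and z: "norm z < \<rho>" "z \<noteq> 0" and P0: "mpoly_eval P y = 0" "mpoly_eval P (y + z *s u) = 0"
    define k where "k = (\<lambda>z. mpoly_eval P (y + z *s u) - b * z)"
    have "norm (k z - k 0) \<le> norm b / 2 * norm (z - 0)"
    proof (rule field_differentiable_bound)
      show "convex (ball (0::complex) \<rho>)" by simp
      show "(k has_field_derivative mpoly_eval (mpoly_dd u P) (y + z *s u) - b) (at z within ball 0 \<rho>)" for z
        unfolding k_def by (auto intro!: derivative_eq_intros has_field_derivative_mpoly_line)
      show "norm (mpoly_eval (mpoly_dd u P) (y + z *s u) - b) \<le> norm b / 2" if "z \<in> ball 0 \<rho>" for z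
        using close[OF y, of z] that by simp
    qed (use z d in \<open>auto simp: \<rho>_def\<close>)
    moreover have "k z - k 0 = - (b * z)" using P0 by (simp add: k_def)
    ultimately show False using \<open>b \<noteq> 0\<close> z by (simp add: norm_mult)
  qed
qed

text \<open>Near a transverse zero each zero y of P is the only one on its line within a fixed
  radius, so all these residues can be read off on one common annulus around z = 0.\<close>

lemma res_loc_const:
  assumes "mpoly_eval P y0 = 0" "mpoly_eval (mpoly_dd u P) y0 \<noteq> 0"
  shows "\<exists>\<delta>>0. \<forall>y. dist y0 y < \<delta> \<longrightarrow> mpoly_eval P y = 0 \<longrightarrow> res y = res y0"
proof -
  obtain \<rho> where \<rho>: "\<rho> > 0" "\<And>y z. dist y0 y < \<rho> \<Longrightarrow> norm z < \<rho> \<Longrightarrow> z \<noteq> 0 \<Longrightarrow> mpoly_eval P y = 0 \<Longrightarrow> mpoly_eval P (y + z *s u) \<noteq> 0"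
    using line_injective_nbhd[OF assms(2)] by blast
  obtain \<epsilon>1 where \<epsilon>1: "\<epsilon>1 > 0" "exact_on (ball 0 \<epsilon>1 - {0}) (\<lambda>z w. lf y0 z w - res y0 / z * w)"
    using residue_at_res[of y0] unfolding residue_at_def by blast
  define \<epsilon> where "\<epsilon> = min \<rho> \<epsilon>1"
  have \<epsilon>: "\<epsilon> > 0" "\<epsilon> \<le> \<rho>" "\<epsilon> \<le> \<epsilon>1" using \<rho> \<epsilon>1 by (auto simp: \<epsilon>_def)
  let ?K = "{z::complex. \<epsilon> / 4 \<le> norm z \<and> norm z \<le> \<epsilon> / 2}"
  have nz: "mpoly_eval P (y0 + z *s u) \<noteq> 0" if "z \<in> ?K" for z
    using that \<epsilon> \<rho>(1) assms(1) by (intro \<rho>(2)) auto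
  have "\<exists>\<delta>>0. \<forall>x z. dist y0 x < \<delta> \<longrightarrow> z \<in> ?K \<longrightarrow> mpoly_eval P (x + z *s u) \<noteq> 0"
    by (rule tube_nbhd[OF compact_annulus]) (rule nz)
  then obtain \<delta> where
    \<delta>: "\<delta> > 0" "\<forall>x z. dist y0 x < \<delta> \<longrightarrow> z \<in> ?K \<longrightarrow> mpoly_eval P (x + z *s u) \<noteq> 0"
    by (elim exE conjE)
  have "res y = res y0" if y: "dist y0 y < min \<delta> \<rho>" and Py: "mpoly_eval P y = 0" for y
  proof -
    have "mpoly_eval P (y + z *s u) \<noteq> 0" if "norm z < \<epsilon>" "z \<noteq> 0" for z
      using \<rho>(2)[of y z] y Py that \<epsilon> by simp
    then obtain c where c: "exact_on (ball 0 \<epsilon> - {0}) (\<lambda>z w. lf y z w - c / z * w)"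
      using residue_on[OF \<epsilon>(1)] by blast
    then have "res y = c" using residue_at_iff \<epsilon>(1) unfolding residue_at_def by blast
    moreover have "c = res y0"
    proof (rule annulus_residue_eq[OF \<epsilon>(1), of "ball y0 \<delta>" y y0])
      show "exact_on {z. \<epsilon> / 4 < norm z \<and> norm z < \<epsilon> / 2} (\<lambda>z w. lf y z w - c / z * w)"
        by (rule exact_on_subset[OF c]) (use \<epsilon> in auto)
      show "exact_on {z. \<epsilon> / 4 < norm z \<and> norm z < \<epsilon> / 2} (\<lambda>z w. lf y0 z w - res y0 / z * w)"
        by (rule exact_on_subset[OF \<epsilon>1(2)]) (use \<epsilon> in auto)
    qed (use \<delta> y in auto)
    ultimately show ?thesis by simp
  qed
  then show ?thesis using \<delta>(1) \<rho>(1) by (intro exI[of _ "min \<delta> \<rho>"]) auto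
qed

end

section \<open>Vanishing residues imply exactness\<close>

lemma finite_conn_complex:
  fixes W :: "complex set"
  assumes "finite F" "open W" "convex W" "W \<noteq> {}"
  shows "connected (W - F) \<and> W - F \<noteq> {}"
proof
  show "connected (W - F)"
    using assms by (intro connected_open_delete_finite) (auto simp: convex_connected)
  have "infinite W" using assms finite_imp_not_open by blast
  then show "W - F \<noteq> {}" using assms(1) by (metis Diff_eq_empty_iff finite_subset)
qed

context form_along_line
begin

text \<open>The plane is convex and the roots are finitely many, so the primitives on discs and on
  punctured discs around the roots glue.\<close>

lemma exact_fibre_glue:
  assumes "\<And>s. s \<in> S x \<Longrightarrow> \<exists>\<epsilon>>0. exact_on (ball 0 \<epsilon> - {0}) (lf (x + s *s u))"
  shows "exact_on (- S x) (lf x)"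
proof -
  have "exact_on (UNIV - S x) (lf x)"
  proof (rule exact_on_glue)
    show "closed (S x)" by (rule finite_imp_closed[OF finite_S])
    show "connected (W - S x) \<and> W - S x \<noteq> {}" if "open W" "convex W" "W \<noteq> {}" for W
      using finite_conn_complex[OF finite_S that] .
    fix z0 :: complex
    show "\<exists>r>0. exact_on (ball z0 r - S x) (lf x)"
    proof (cases "z0 \<in> S x")
      case True
      then obtain \<epsilon> where \<epsilon>: "\<epsilon> > 0" "exact_on (ball 0 \<epsilon> - {0}) (lf (x + z0 *s u))" using assms by blast
      then obtain F where F: "primitive_on (ball 0 \<epsilon> - {0}) (lf (x + z0 *s u)) F" by (auto simp: exact_on_def)
      have "primitive_on (ball z0 \<epsilon> - S x) (\<lambda>z w. lf (x + z0 *s u) (z - z0) w) (\<lambda>z. F (z - z0))"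
        by (rule primitive_on_pullback[OF F, of _ "\<lambda>z. z - z0" "\<lambda>z w. w"])
           (use True in \<open>auto simp: dist_norm norm_minus_commute intro!: derivative_eq_intros\<close>)
      then have "exact_on (ball z0 \<epsilon> - S x) (lf x)"
        by (auto simp: lf_translate exact_on_def)
      with \<epsilon>(1) show ?thesis by blast
    next
      case False
      have "loc_exact (- S x) (lf x)"
        by (rule lf_loc_exact) (auto simp: S_def open_Compl finite_imp_closed[OF finite_S, unfolded S_def])
      then obtain r where "r > 0" "exact_on (ball z0 r) (lf x)"
        using False by (auto simp: loc_exact_def)
      then show ?thesis using exact_on_subset[of "ball z0 r" "lf x" "ball z0 r - S x"] by blast
    qed
  qed auto
  then show ?thesis by (simp add: Compl_eq_Diff_UNIV)
qed

lemma exact_fibre_generic: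
  assumes "simple x" and "\<And>y. mpoly_eval P y = 0 \<Longrightarrow> simple y \<Longrightarrow> residue_at y 0"
  shows "exact_on (- S x) (lf x)"
proof (rule exact_fibre_glue)
  fix s assume "s \<in> S x"
  then have "residue_at (x + s *s u) 0"
    using assms by (intro assms(2)) (auto simp: S_def simple_translate)
  then show "\<exists>\<epsilon>>0. exact_on (ball 0 \<epsilon> - {0}) (lf (x + s *s u))"
    by (auto simp: residue_at_def)
qed

text \<open>On a line with colliding zeros \<open>res0\<close> says nothing. A generic line nearby
  is exact off its zeros, in particular on an annulus around the collision, and the vanishing of the
  residue is transferred from there.\<close>

lemma exact_fibre:
  assumes D: "D \<noteq> 0" "\<And>x. mpoly_eval D x \<noteq> 0 \<Longrightarrow> simple x"
    and res0: "\<And>y. mpoly_eval P y = 0 \<Longrightarrow> simple y \<Longrightarrow> residue_at y 0"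
  shows "exact_on (- S x) (lf x)"
proof (rule exact_fibre_glue)
  fix s assume s: "s \<in> S x"
  define y where "y = x + s *s u"
  have Py: "mpoly_eval P y = 0" using s by (simp add: S_def y_def)
  obtain \<epsilon> where \<epsilon>: "\<epsilon> > 0" "\<And>z. norm z < \<epsilon> \<Longrightarrow> z \<noteq> 0 \<Longrightarrow> mpoly_eval P (y + z *s u) \<noteq> 0"
    using punctured_nbhd[of y] by blast
  obtain c where c: "exact_on (ball 0 \<epsilon> - {0}) (\<lambda>z w. lf y z w - c / z * w)"
    using residue_on[OF \<epsilon>] by blast
  let ?K = "{z::complex. \<epsilon> / 4 \<le> norm z \<and> norm z \<le> \<epsilon> / 2}"
  have nz: "mpoly_eval P (y + z *s u) \<noteq> 0" if "z \<in> ?K" for z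
    using that \<epsilon>(1) by (intro \<epsilon>(2)) auto
  have "\<exists>\<delta>>0. \<forall>x z. dist y x < \<delta> \<longrightarrow> z \<in> ?K \<longrightarrow> mpoly_eval P (x + z *s u) \<noteq> 0"
    by (rule tube_nbhd[OF compact_annulus]) (rule nz)
  then obtain \<delta> where
    \<delta>: "\<delta> > 0" "\<forall>x z. dist y x < \<delta> \<longrightarrow> z \<in> ?K \<longrightarrow> mpoly_eval P (x + z *s u) \<noteq> 0"
    by (elim exE conjE)
  obtain x1 where x1: "dist y x1 < \<delta>" "mpoly_eval D x1 \<noteq> 0"
    using mpoly_nonzero_dense[OF D(1) \<delta>(1)] by blast
  let ?Y = "{z::complex. \<epsilon> / 4 < norm z \<and> norm z < \<epsilon> / 2}"
  have "exact_on (- S x1) (lf x1)"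
    by (rule exact_fibre_generic[OF D(2)[OF x1(2)] res0])
  moreover have "?Y \<subseteq> - S x1" using \<delta>(2) x1(1) by (auto simp: S_def)
  ultimately have "exact_on ?Y (lf x1)" by (rule exact_on_subset)
  then have ex1: "exact_on ?Y (\<lambda>z w. lf x1 z w - 0 / z * w)" by simp
  have "c = 0"
  proof (rule annulus_residue_eq[OF \<epsilon>(1), of "ball y \<delta>" y x1])
    show "exact_on ?Y (\<lambda>z w. lf y z w - c / z * w)"
      by (rule exact_on_subset[OF c]) (use \<epsilon> in auto)
    show "exact_on ?Y (\<lambda>z w. lf x1 z w - 0 / z * w)" by (rule ex1)
  qed (use \<delta> x1 in auto)
  with c \<epsilon>(1) show "\<exists>\<epsilon>>0. exact_on (ball 0 \<epsilon> - {0}) (lf (x + s *s u))"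
    by (auto simp: y_def)
qed

text \<open>The section \<open>x \<mapsto> x + R(x) u\<close> avoids the zeros of \<open>P\<close>; it fixes the constants of the primitives
  on the lines.\<close>

lemma exact_global:
  assumes D: "D \<noteq> 0" "\<And>x. mpoly_eval D x \<noteq> 0 \<Longrightarrow> simple x"
    and res0: "\<And>y. mpoly_eval P y = 0 \<Longrightarrow> simple y \<Longrightarrow> residue_at y 0"
  shows "exact_on {x. mpoly_eval P x \<noteq> 0} \<omega>"
proof -
  have "\<forall>x. \<exists>F. primitive_on (- S x) (lf x) F"
    using exact_fibre[OF D res0] unfolding exact_on_def by blast
  then obtain F where F: "\<And>x. primitive_on (- S x) (lf x) (F x)" by metis
  obtain K N where K: "K \<ge> 0" "\<And>x z. ev2 (shift u P) x z = 0 \<Longrightarrow> norm z \<le> K * (1 + norm x ^ 2) ^ N"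
    using roots_bound[OF lead \<kappa>] by blast
  \<comment> \<open>\<open>R\<close> exceeds the root bound by 1, and the inner product makes it
    differentiable over the reals everywhere.\<close>
  define R where "R = (\<lambda>x :: complex^'n::{finite,linorder}. 1 + K * (1 + x \<bullet> x) ^ N)"
  have RS: "complex_of_real (R x) \<notin> S x" for x
  proof
    assume "complex_of_real (R x) \<in> S x"
    then have "norm (complex_of_real (R x)) \<le> K * (1 + norm x ^ 2) ^ N"
      by (intro K(2)) (simp add: S_def)
    then have "\<bar>R x\<bar> \<le> K * (1 + norm x ^ 2) ^ N" by (simp only: norm_of_real)
    moreover have "R x = 1 + K * (1 + norm x ^ 2) ^ N" by (simp add: R_def power2_norm_eq_inner)
    moreover have "0 \<le> K * (1 + norm x ^ 2) ^ N" using K(1) by simp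
    ultimately show False by linarith
  qed
  have "\<exists>R'. (R has_derivative R') (at x)" for x
    unfolding R_def by (rule exI) (auto intro!: derivative_eq_intros)
  then obtain R' where R': "\<And>x. (R has_derivative R' x) (at x)" by metis
  define \<sigma> where "\<sigma> = (\<lambda>x. x + complex_of_real (R x) *s u)"
  define \<sigma>' where "\<sigma>' = (\<lambda>x v. v + complex_of_real (R' x v) *s u)"
  have \<sigma>D: "(\<sigma> has_derivative \<sigma>' x) (at x)" for x
    unfolding \<sigma>_def \<sigma>'_def by (auto intro!: derivative_eq_intros R')
  have "loc_exact UNIV (\<lambda>x v. \<omega> (\<sigma> x) (\<sigma>' x v))"
    by (rule loc_exact_pullback[OF loc]) (use RS \<sigma>D in \<open>auto simp: \<sigma>_def S_def\<close>)
  then have "exact_on UNIV (\<lambda>x v. \<omega> (\<sigma> x) (\<sigma>' x v))" by (intro exact_on_convex) auto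
  then obtain g where g: "primitive_on UNIV (\<lambda>x v. \<omega> (\<sigma> x) (\<sigma>' x v)) g" by (auto simp: exact_on_def)
  \<comment> \<open>The value of \<open>g\<close> at the section is carried along the line to z = 0.
    Only a difference of values of \<open>F x\<close> enters, so the arbitrary choice of
    \<open>F x\<close> does no harm.\<close>
  define f where "f = (\<lambda>x. g x + F x 0 - F x (complex_of_real (R x)))"
  have "(f has_derivative \<omega> x0) (at x0)" if Px0: "mpoly_eval P x0 \<noteq> 0" for x0
  proof -
    define z1 where "z1 = complex_of_real (R x0)"
    have clS: "closed (S x0)" by (rule finite_imp_closed[OF finite_S])
    have opS: "open (- S x0)" using clS by (rule open_Compl)
    have 0: "0 \<in> - S x0" using Px0 by (simp add: S_def)
    have z1: "z1 \<in> - S x0" using RS[of x0] by (simp add: z1_def)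
    \<comment> \<open>The points z = 0 and \<open>z1\<close> are joined off the roots. The thickened
      path \<open>Y\<close> is connected and avoids the roots on all nearby lines, so one joint
      primitive \<open>h\<close> replaces the unrelated functions \<open>F x\<close>.\<close>
    have "connected (- S x0)"
      using finite_conn_complex[OF finite_S[of x0] open_UNIV convex_UNIV] by (simp add: Compl_eq_Diff_UNIV)
    then have "path_connected (- S x0)" using opS by (simp add: connected_open_path_connected)
    then obtain \<gamma> where \<gamma>: "path \<gamma>" "path_image \<gamma> \<subseteq> - S x0" "pathstart \<gamma> = 0" "pathfinish \<gamma> = z1"
      using 0 z1 unfolding path_connected_def by blast
    define K where "K = path_image \<gamma>"
    have K: "compact K" "connected K" "0 \<in> K" "z1 \<in> K"
      using \<gamma> pathstart_in_path_image[of \<gamma>] pathfinish_in_path_image[of \<gamma>]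
      by (auto simp: K_def compact_path_image connected_path_image)
    have "K \<subseteq> - S x0" using \<gamma>(2) by (simp add: K_def)
    then obtain \<epsilon> where \<epsilon>: "\<epsilon> > 0" "(\<Union>z\<in>K. cball z \<epsilon>) \<subseteq> - S x0"
      using compact_subset_open_imp_cball_epsilon_subset[OF K(1) opS] by blast
    define K' where "K' = (\<lambda>(a, b). a + b) ` (K \<times> cball 0 \<epsilon>)"
    define Y where "Y = (\<lambda>(a, b). a + b) ` (K \<times> ball 0 \<epsilon>)"
    have cont: "continuous_on A (\<lambda>(a, b). a + (b :: complex))" for A
      by (simp add: case_prod_unfold) (intro continuous_intros)
    have "compact K'" unfolding K'_def
      by (intro compact_continuous_image cont compact_Times K compact_cball)
    have "connected Y" unfolding Y_def
      by (intro connected_continuous_image cont connected_Times K) auto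
    have Yeq: "Y = (\<Union>z\<in>K. ball z \<epsilon>)"
    proof (intro equalityI subsetI)
      fix w assume "w \<in> (\<Union>z\<in>K. ball z \<epsilon>)"
      then obtain z where "z \<in> K" "dist z w < \<epsilon>" by auto
      then show "w \<in> Y" unfolding Y_def
        by (intro image_eqI[of _ _ "(z, w - z)"]) (auto simp: dist_norm norm_minus_commute)
    next
      fix w assume "w \<in> Y"
      then obtain a b where "a \<in> K" "norm b < \<epsilon>" "w = a + b" by (auto simp: Y_def)
      then show "w \<in> (\<Union>z\<in>K. ball z \<epsilon>)" by (intro UN_I[of a]) (auto simp: dist_norm)
    qed
    then have "open Y" by auto
    have "Y \<subseteq> K'" unfolding Y_def K'_def by (intro image_mono) auto
    have "K' \<subseteq> - S x0"
    proof (rule order_trans[OF _ \<epsilon>(2)])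
      show "K' \<subseteq> (\<Union>z\<in>K. cball z \<epsilon>)"
      proof
        fix w assume "w \<in> K'"
        then obtain a b where "a \<in> K" "norm b \<le> \<epsilon>" "w = a + b" by (auto simp: K'_def)
        then show "w \<in> (\<Union>z\<in>K. cball z \<epsilon>)" by (intro UN_I[of a]) (auto simp: dist_norm)
      qed
    qed
    have zY: "0 \<in> Y" "z1 \<in> Y" unfolding Yeq using K(3,4) \<epsilon>(1) by (auto intro: bexI[of _ 0] bexI[of _ z1])
    have nz: "mpoly_eval P (x0 + z *s u) \<noteq> 0" if "z \<in> K'" for z
      using \<open>K' \<subseteq> - S x0\<close> that by (auto simp: S_def)
    have "\<exists>\<delta>>0. \<forall>x z. dist x0 x < \<delta> \<longrightarrow> z \<in> K' \<longrightarrow> mpoly_eval P (x + z *s u) \<noteq> 0"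
      by (rule tube_nbhd[OF \<open>compact K'\<close>]) (rule nz)
    then obtain \<delta>1 where \<delta>1: "\<delta>1 > 0" "\<And>x z. dist x0 x < \<delta>1 \<Longrightarrow> z \<in> K' \<Longrightarrow> mpoly_eval P (x + z *s u) \<noteq> 0"
      by blast
    have "isCont R x0" using R' has_derivative_continuous by blast
    then have "isCont (\<lambda>x. complex_of_real (R x)) x0" by (intro continuous_intros)
    moreover obtain e where "e > 0" "ball z1 e \<subseteq> Y" using \<open>open Y\<close> zY(2) by (meson openE)
    ultimately obtain \<delta>2 where \<delta>2: "\<delta>2 > 0" "\<And>x. dist x x0 < \<delta>2 \<Longrightarrow> dist (complex_of_real (R x)) z1 < e"
      unfolding continuous_at_eps_delta z1_def by blast
    have RY: "complex_of_real (R x) \<in> Y" if "dist x0 x < \<delta>2" for x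
      using \<delta>2(2)[of x] that \<open>ball z1 e \<subseteq> Y\<close> by (auto simp: dist_commute)
    define X where "X = ball x0 (min \<delta>1 \<delta>2)"
    have X: "open X" "convex X" "x0 \<in> X" using \<delta>1(1) \<delta>2(1) by (auto simp: X_def)
    have XY: "mpoly_eval P (x + z *s u) \<noteq> 0" if "x \<in> X" "z \<in> Y" for x z
      using \<delta>1(2)[of x z] that \<open>Y \<subseteq> K'\<close> by (auto simp: X_def)
    have "exact_on Y (lf x0)"
      using F[of x0] \<open>Y \<subseteq> K'\<close> \<open>K' \<subseteq> - S x0\<close> primitive_on_subset unfolding exact_on_def by blast
    then have "exact_on Y (\<lambda>z w. lf x0 z w - 0 / z * w)" by simp
    from tube_exact[OF X(1,2) \<open>open Y\<close> XY X(3) this]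
    obtain h where h: "primitive_on (X \<times> Y) (\<lambda>p h. \<omega> (fst p + snd p *s u) (fst h + snd h *s u) - 0 / snd p * snd h) h"
      by (auto simp: exact_on_def)
    have feq: "g x + h (x, 0) - h (x, complex_of_real (R x)) = f x" if x: "x \<in> X" for x
    proof -
      have "primitive_on Y (lf x) (\<lambda>z. h (x, z))"
        using primitive_slice[OF h x] by simp
      moreover have "Y \<subseteq> - S x" using XY[OF x] by (auto simp: S_def)
      then have "primitive_on Y (lf x) (F x)" using F[of x] primitive_on_subset by blast
      ultimately obtain c where "\<And>z. z \<in> Y \<Longrightarrow> F x z = h (x, z) + c"
        using primitive_on_unique[OF \<open>open Y\<close> \<open>connected Y\<close>, of "lf x" "F x" "\<lambda>z. h (x, z)"] by blast
      moreover have "complex_of_real (R x) \<in> Y" using RY[of x] x by (auto simp: X_def)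
      ultimately show ?thesis using zY(1) by (simp add: f_def)
    qed
    have hD: "(h has_derivative (\<lambda>k. \<omega> (x0 + z *s u) (fst k + snd k *s u))) (at (x0, z))" if "z \<in> Y" for z
      using h X(3) that by (auto simp: primitive_on_def)
    have D1: "((\<lambda>x. h (x, 0)) has_derivative \<omega> x0) (at x0)"
    proof -
      have "((\<lambda>x. (x, 0::complex)) has_derivative (\<lambda>v. (v, 0))) (at x0)" by (auto intro!: derivative_eq_intros)
      from has_derivative_compose[OF this hD[OF zY(1)]] show ?thesis by simp
    qed
    have D2: "((\<lambda>x. h (x, complex_of_real (R x))) has_derivative (\<lambda>v. \<omega> (\<sigma> x0) (\<sigma>' x0 v))) (at x0)"
    proof -
      have "((\<lambda>x. (x, complex_of_real (R x))) has_derivative (\<lambda>v. (v, complex_of_real (R' x0 v)))) (at x0)"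
        by (auto intro!: derivative_eq_intros R')
      from has_derivative_compose[OF this hD[OF zY(2), unfolded z1_def]] show ?thesis
        by (simp add: \<sigma>_def \<sigma>'_def)
    qed
    have D3: "(g has_derivative (\<lambda>v. \<omega> (\<sigma> x0) (\<sigma>' x0 v))) (at x0)"
      using g by (simp add: primitive_on_def)
    \<comment> \<open>The contributions along the section cancel, because \<open>g\<close> is a
      primitive of the pullback by \<open>\<sigma>\<close>; what remains is
      \<open>\<omega> x0\<close>.\<close>
    have "((\<lambda>x. g x + h (x, 0) - h (x, complex_of_real (R x))) has_derivative
       (\<lambda>v. \<omega> (\<sigma> x0) (\<sigma>' x0 v) + \<omega> x0 v - \<omega> (\<sigma> x0) (\<sigma>' x0 v))) (at x0)"
      by (intro has_derivative_diff has_derivative_add D1 D2 D3)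
    then have "((\<lambda>x. g x + h (x, 0) - h (x, complex_of_real (R x))) has_derivative \<omega> x0) (at x0)" by simp
    from has_derivative_transform_within_open[OF this X(1,3) feq] show ?thesis .
  qed
  then show ?thesis unfolding exact_on_def primitive_on_def by blast
qed

end

section \<open>Degrees and logarithmic derivatives\<close>

text \<open>This turns the degree in one variable into the degree of a polynomial over an integral
  domain, which is additive on products.\<close>

definition var_poly :: "'n::{finite,linorder} \<Rightarrow> 'n mpoly \<Rightarrow> 'n mpoly poly" where
  "var_poly i = msubst (\<lambda>c. [:mpoly_const c:]) (\<lambda>j. if j = i then [:0, 1:] else [:mpoly_X j:])"

lemma var_poly_mult: "var_poly i (p * q) = var_poly i p * var_poly i q"
  by (simp add: var_poly_def cpconst.msubst_mult)

lemma poly_var_poly: "poly (var_poly i p) (mpoly_X i) = p"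
  by (induction p rule: mpoly_induct)
     (simp_all add: var_poly_def cpconst.msubst_add cpconst.msubst_mult)

lemma coeff_var_poly:
  "coeff (var_poly i p) k = (\<Sum>m | m \<in> Poly_Mapping.keys p \<and> Poly_Mapping.lookup m i = k.
     Poly_Mapping.single (m - Poly_Mapping.single i k) (Poly_Mapping.lookup p m))"
proof -
  have 1: "[:mpoly_const c:] * (\<Prod>j\<in>UNIV. (if j = i then [:0, 1:] else [:mpoly_X j:]) ^ Poly_Mapping.lookup m j) =
     monom (Poly_Mapping.single (m - Poly_Mapping.single i (Poly_Mapping.lookup m i)) c) (Poly_Mapping.lookup m i)"
    (is "?l = ?r") for m :: "'a \<Rightarrow>\<^sub>0 nat" and c
  proof -
    let ?m = "m - Poly_Mapping.single i (Poly_Mapping.lookup m i)"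
    have pw: "[:a:] ^ n = [:a ^ n:]" for a :: "'a mpoly" and n
      by (induction n) (simp_all add: one_pCons mult.commute)
    have pr: "(\<Prod>j\<in>A. [:f j:]) = [:\<Prod>j\<in>A. f j:]" for f :: "'a \<Rightarrow> 'a mpoly" and A
      by (induction A rule: infinite_finite_induct) (simp_all add: one_pCons)
    have "(\<Prod>j\<in>UNIV. (if j = i then [:0, 1:] else [:mpoly_X j:]) ^ Poly_Mapping.lookup m j) =
       [:0, 1:] ^ Poly_Mapping.lookup m i * (\<Prod>j\<in>UNIV - {i}. [:mpoly_X j ^ Poly_Mapping.lookup m j :: 'a mpoly:])"
      by (subst prod.remove[of _ i]) (auto simp: pw intro!: prod.cong)
    also have "(\<Prod>j\<in>UNIV - {i}. [:mpoly_X j ^ Poly_Mapping.lookup m j :: 'a mpoly:]) =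
       [:\<Prod>j\<in>UNIV - {i}. mpoly_X j ^ Poly_Mapping.lookup m j:]" by (rule pr)
    also have "(\<Prod>j\<in>UNIV - {i}. mpoly_X j ^ Poly_Mapping.lookup m j) =
       (\<Prod>j\<in>UNIV. mpoly_X j ^ Poly_Mapping.lookup ?m j :: 'a mpoly)"
      by (subst (2) prod.remove[of _ i]) (auto simp: lookup_minus lookup_single intro!: prod.cong)
    also have "[:0, 1:] ^ Poly_Mapping.lookup m i = monom (1 :: 'a mpoly) (Poly_Mapping.lookup m i)"
      by (simp add: monom_altdef)
    finally have "?l = [:mpoly_const c * (\<Prod>j\<in>UNIV. mpoly_X j ^ Poly_Mapping.lookup ?m j):] * monom 1 (Poly_Mapping.lookup m i)"
      by (simp add: mult_ac)
    then show ?thesis by (simp add: single_eq_prod_X[of ?m] smult_monom)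
  qed
  have "coeff (var_poly i p) k = (\<Sum>m\<in>Poly_Mapping.keys p. if Poly_Mapping.lookup m i = k then
     Poly_Mapping.single (m - Poly_Mapping.single i k) (Poly_Mapping.lookup p m) else 0)"
    unfolding var_poly_def msubst_def 1 coeff_sum by (intro sum.cong) auto
  then show ?thesis by (simp add: sum.inter_filter)
qed

lemma degree_var_poly: "degree (var_poly i p) = mpoly_deg i p"
proof (rule antisym)
  let ?A = "insert 0 ((\<lambda>m. Poly_Mapping.lookup m i) ` Poly_Mapping.keys p)"
  show "degree (var_poly i p) \<le> mpoly_deg i p"
  proof (rule degree_le, intro allI impI)
    fix k assume k: "mpoly_deg i p < k"
    have "{m. m \<in> Poly_Mapping.keys p \<and> Poly_Mapping.lookup m i = k} = {}"
    proof (rule ccontr)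
      assume "{m. m \<in> Poly_Mapping.keys p \<and> Poly_Mapping.lookup m i = k} \<noteq> {}"
      then have "k \<in> ?A" by blast
      then have "k \<le> mpoly_deg i p" unfolding mpoly_deg_def by (intro Max_ge) auto
      with k show False by simp
    qed
    then show "coeff (var_poly i p) k = 0" by (simp only: coeff_var_poly sum.empty)
  qed
  show "mpoly_deg i p \<le> degree (var_poly i p)"
  proof (cases "mpoly_deg i p = 0")
    case False
    have "mpoly_deg i p \<in> ?A" unfolding mpoly_deg_def by (intro Max_in) auto
    with False obtain m0 where m0: "m0 \<in> Poly_Mapping.keys p" "Poly_Mapping.lookup m0 i = mpoly_deg i p" by auto
    define k where "k = mpoly_deg i p"
    define K where "K = {m. m \<in> Poly_Mapping.keys p \<and> Poly_Mapping.lookup m i = k}"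
    have "finite K" by (rule finite_subset[of _ "Poly_Mapping.keys p"]) (auto simp: K_def)
    \<comment> \<open>Monomials with the same power of X_i stay distinct when that power is removed,
      so nothing cancels in the top coefficient.\<close>
    have inj: "m = m0" if "m \<in> K" "m - Poly_Mapping.single i k = m0 - Poly_Mapping.single i k" for m
    proof (rule poly_mapping_eqI)
      fix j
      have "Poly_Mapping.lookup (m - Poly_Mapping.single i k) j = Poly_Mapping.lookup (m0 - Poly_Mapping.single i k) j"
        by (simp only: that(2))
      then show "Poly_Mapping.lookup m j = Poly_Mapping.lookup m0 j"
        using that(1) m0 by (cases "j = i") (simp_all add: K_def k_def lookup_minus lookup_single)
    qed
    have "Poly_Mapping.lookup (coeff (var_poly i p) k) (m0 - Poly_Mapping.single i k) =
       (\<Sum>m\<in>K. if m = m0 then Poly_Mapping.lookup p m else 0)"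
      unfolding coeff_var_poly K_def[symmetric] lookup_sum
      using inj by (intro sum.cong) (auto simp: lookup_single when_def)
    also have "\<dots> = Poly_Mapping.lookup p m0"
      using \<open>finite K\<close> m0 by (simp add: K_def k_def)
    finally have "coeff (var_poly i p) k \<noteq> 0" using m0(1) by (auto simp: in_keys_iff)
    then show ?thesis unfolding k_def by (rule le_degree)
  qed simp
qed

lemma var_poly_nonzero: "p \<noteq> 0 \<Longrightarrow> var_poly i p \<noteq> 0"
  by (metis poly_0 poly_var_poly)

lemma mpoly_deg_mult:
  fixes p q :: "'n::{finite,linorder} mpoly"
  assumes "p \<noteq> 0" "q \<noteq> 0"
  shows "mpoly_deg i (p * q) = mpoly_deg i p + mpoly_deg i q"
  unfolding degree_var_poly[symmetric] var_poly_mult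
  using assms by (intro degree_mult_eq var_poly_nonzero)

lemma lookup_le_mpoly_deg: "m \<in> Poly_Mapping.keys p \<Longrightarrow> Poly_Mapping.lookup m i \<le> mpoly_deg i p"
  unfolding mpoly_deg_def by (intro Max_ge) auto

lemma mpoly_deg_le_mpoly_deg: "mpoly_deg_le i p (int (mpoly_deg i p))"
  by (simp add: mpoly_deg_le_def lookup_le_mpoly_deg)

lemma mpoly_deg_le_imp:
  assumes "mpoly_deg_le i p d" "p \<noteq> 0"
  shows "int (mpoly_deg i p) \<le> d"
proof -
  obtain m where m: "m \<in> Poly_Mapping.keys p" using assms(2) by (metis all_not_in_conv keys_eq_empty)
  then have "0 \<le> d" using assms(1) unfolding mpoly_deg_le_def by (meson of_nat_0_le_iff order_trans)
  have "mpoly_deg i p \<in> insert 0 ((\<lambda>m. Poly_Mapping.lookup m i) ` Poly_Mapping.keys p)"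
    unfolding mpoly_deg_def by (intro Max_in) auto
  then show ?thesis using \<open>0 \<le> d\<close> assms(1) by (auto simp: mpoly_deg_le_def)
qed

lemma mpoly_deg_le_add: "mpoly_deg_le i p d \<Longrightarrow> mpoly_deg_le i q d \<Longrightarrow> mpoly_deg_le i (p + q) d"
  unfolding mpoly_deg_le_def using Poly_Mapping.keys_add[of p q] by blast

lemma mpoly_deg_le_mult:
  fixes p q :: "'n::{finite,linorder} mpoly"
  assumes "mpoly_deg_le i p d" "mpoly_deg_le i q e"
  shows "mpoly_deg_le i (p * q) (d + e)"
  unfolding mpoly_deg_le_def
proof
  fix m assume "m \<in> Poly_Mapping.keys (p * q)"
  then obtain a b where "a \<in> Poly_Mapping.keys p" "b \<in> Poly_Mapping.keys q" "m = a + b"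
    using keys_mult[of p q] by blast
  then show "int (Poly_Mapping.lookup m i) \<le> d + e"
    using assms by (auto simp: mpoly_deg_le_def lookup_add intro!: add_mono)
qed

lemma mpoly_deg_le_const: "d \<ge> 0 \<Longrightarrow> mpoly_deg_le i (mpoly_const c) d"
  by (auto simp: mpoly_deg_le_def)

lemma mpoly_deg_le_pd:
  "mpoly_deg_le k (mpoly_pd i p) (if k = i then int (mpoly_deg k p) - 1 else int (mpoly_deg k p))"
  unfolding mpoly_deg_le_def
proof
  fix m assume "m \<in> Poly_Mapping.keys (mpoly_pd i p)"
  then have "m + Poly_Mapping.single i 1 \<in> Poly_Mapping.keys p"
    by (auto simp: in_keys_iff lookup_mpoly_pd)
  from lookup_le_mpoly_deg[OF this, of k]
  show "int (Poly_Mapping.lookup m k) \<le> (if k = i then int (mpoly_deg k p) - 1 else int (mpoly_deg k p))"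
    by (auto simp: lookup_add lookup_single when_def)
qed

section \<open>Elements of F(P)\<close>

lemma mpoly_pd_commute: "mpoly_pd i (mpoly_pd j p) = mpoly_pd j (mpoly_pd i p)"
  by (rule poly_mapping_eqI) (simp add: lookup_mpoly_pd lookup_add lookup_single when_def add_ac)

text \<open>The closedness equations of \<open>F_space\<close> with the denominator P^2 cleared, in
  a form symmetric in i and j.\<close>

definition closed_cond :: "'n mpoly \<Rightarrow> 'n mpoly ^ 'n::{finite,linorder} \<Rightarrow> bool" where
  "closed_cond P A \<longleftrightarrow> (\<forall>i j. mpoly_pd i (A $ j) * P - A $ j * mpoly_pd i P =
     mpoly_pd j (A $ i) * P - A $ i * mpoly_pd j P)"

lemma F_space_iff:
  fixes P :: "'n::{finite,linorder} mpoly"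
  assumes "P \<noteq> 0"
  shows "A \<in> F_space P \<longleftrightarrow> closed_cond P A \<and> (\<forall>i j. mpoly_deg_le j (A $ i)
        (if j = i then int (mpoly_deg j P) - 1 else int (mpoly_deg j P)))"
proof -
  let ?E = "\<lambda>i j. mpoly_pd i (A $ j) * P - A $ j * mpoly_pd i P"
  have 1: "ratfun_pd i (Fract (A $ j) P) - ratfun_pd j (Fract (A $ i) P) = 0 \<longleftrightarrow> ?E i j = ?E j i" for i j
    unfolding ratfun_pd_Fract[OF assms] right_minus_eq using assms by (simp add: eq_fract)
  have "(\<forall>i j. i < j \<longrightarrow> ?E i j = ?E j i) \<longleftrightarrow> (\<forall>i j. ?E i j = ?E j i)"
    by (metis linorder_less_linear)
  then show ?thesis by (simp only: F_space_def closed_cond_def mem_Collect_eq 1)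
qed

lemma subspace_F_space:
  fixes P :: "'n::{finite,linorder} mpoly"
  assumes "P \<noteq> 0"
  shows "tuples.subspace (F_space P)"
proof (rule tuples.subspaceI)
  show "0 \<in> F_space P" by (simp add: F_space_iff[OF assms] closed_cond_def mpoly_deg_le_def)
next
  fix A B assume AB: "A \<in> F_space P" "B \<in> F_space P"
  have "closed_cond P (A + B)"
    unfolding closed_cond_def
  proof (intro allI)
    fix i j
    have 1: "mpoly_pd i (A $ j) * P - A $ j * mpoly_pd i P = mpoly_pd j (A $ i) * P - A $ i * mpoly_pd j P"
     and 2: "mpoly_pd i (B $ j) * P - B $ j * mpoly_pd i P = mpoly_pd j (B $ i) * P - B $ i * mpoly_pd j P"
      using AB by (auto simp: F_space_iff[OF assms] closed_cond_def)
    show "mpoly_pd i ((A + B) $ j) * P - (A + B) $ j * mpoly_pd i P =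
      mpoly_pd j ((A + B) $ i) * P - (A + B) $ i * mpoly_pd j P"
      using arg_cong2[OF 1 2, of "(+)"] by (simp add: mpoly_pd_add algebra_simps)
  qed
  then show "A + B \<in> F_space P"
    using AB by (simp add: F_space_iff[OF assms] mpoly_deg_le_add del: of_nat_diff)
next
  fix c A assume A: "A \<in> F_space P"
  have "closed_cond P (tuple_scale c A)"
    unfolding closed_cond_def
  proof (intro allI)
    fix i j
    have 1: "mpoly_pd i (A $ j) * P - A $ j * mpoly_pd i P = mpoly_pd j (A $ i) * P - A $ i * mpoly_pd j P"
      using A by (auto simp: F_space_iff[OF assms] closed_cond_def)
    show "mpoly_pd i (tuple_scale c A $ j) * P - tuple_scale c A $ j * mpoly_pd i P =
      mpoly_pd j (tuple_scale c A $ i) * P - tuple_scale c A $ i * mpoly_pd j P"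
      using arg_cong[OF 1, of "\<lambda>f. mpoly_const c * f"]
      by (simp add: tuple_scale_def mpoly_pd_mult algebra_simps)
  qed
  moreover have "mpoly_deg_le j (tuple_scale c A $ i) d" if "mpoly_deg_le j (A $ i) d" for i j d
    using mpoly_deg_le_mult[OF mpoly_deg_le_const[of 0 j c] that] by (simp add: tuple_scale_def)
  ultimately show "tuple_scale c A \<in> F_space P"
    using A by (simp add: F_space_iff[OF assms])
qed

text \<open>The numerators of dQ_j / Q_j over the common denominator P, the product of all
  Q_k.\<close>

definition dlog_tuple :: "nat \<Rightarrow> (nat \<Rightarrow> 'n::{finite,linorder} mpoly) \<Rightarrow> nat \<Rightarrow> 'n mpoly ^ 'n::{finite,linorder}" where
  "dlog_tuple s Q j = (\<chi> i. (\<Prod>k\<in>{..<s} - {j}. Q k) * mpoly_pd i (Q j))"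

text \<open>Closedness is the symmetry of second derivatives. The degree bounds hold because degrees
  add over the factors of P and differentiation in X_i lowers the bound in X_i by one.\<close>

lemma dlog_tuple_in_F_space:
  fixes P :: "'n::{finite,linorder} mpoly"
  assumes P: "P = (\<Prod>k<s. Q k)" "P \<noteq> 0" and j: "j < s"
  shows "dlog_tuple s Q j \<in> F_space P"
proof -
  define G where "G = (\<Prod>k\<in>{..<s} - {j}. Q k)"
  have PG: "P = G * Q j" unfolding P(1) G_def using j by (subst prod.remove[of _ j]) (auto simp: mult.commute)
  have nz: "G \<noteq> 0" "Q j \<noteq> 0" using P(2) PG by auto
  have A: "dlog_tuple s Q j $ i = G * mpoly_pd i (Q j)" for i by (simp add: dlog_tuple_def G_def)
  have "closed_cond P (dlog_tuple s Q j)"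
    unfolding closed_cond_def A PG mpoly_pd_mult
    by (intro allI) (simp add: algebra_simps mpoly_pd_commute)
  moreover have "mpoly_deg_le k (dlog_tuple s Q j $ i) (if k = i then int (mpoly_deg k P) - 1 else int (mpoly_deg k P))" for i k
    using mpoly_deg_le_mult[OF mpoly_deg_le_mpoly_deg[of k G] mpoly_deg_le_pd[of k i "Q j"]]
    unfolding A by (simp add: PG mpoly_deg_mult[OF nz] algebra_simps split: if_splits)
  ultimately show ?thesis by (simp add: F_space_iff[OF P(2)])
qed

text \<open>Here the bound m_i - 1 does its work: a nonzero multiple of P has degree at least m_i in
  X_i.\<close>

lemma tuple_component_eq_0:
  fixes P :: "'n::{finite,linorder} mpoly"
  assumes "P \<noteq> 0" "A \<in> F_space P" "P dvd A $ i"
  shows "A $ i = 0"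
proof (rule ccontr)
  assume nz: "A $ i \<noteq> 0"
  obtain B where B: "A $ i = P * B" using assms(3) by (rule dvdE)
  have "mpoly_deg_le i (A $ i) (int (mpoly_deg i P) - 1)"
    using assms(2) by (auto simp: F_space_iff[OF assms(1)] split: if_splits)
  from mpoly_deg_le_imp[OF this nz] have "int (mpoly_deg i (A $ i)) \<le> int (mpoly_deg i P) - 1" .
  moreover have "B \<noteq> 0" using nz B by auto
  ultimately show False unfolding B by (simp add: mpoly_deg_mult[OF assms(1)])
qed

text \<open>On the line through the origin Q becomes a nonconstant polynomial in z, which cannot
  divide its own derivative, nonzero and of smaller degree.\<close>

lemma not_dvd_mpoly_dd:
  fixes Q :: "'n::{finite,linorder} mpoly"
  assumes "irreducible Q" "good_dir u Q"
  shows "\<not> Q dvd mpoly_dd u Q"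
proof
  assume "Q dvd mpoly_dd u Q"
  then obtain k where k: "mpoly_dd u Q = Q * k" by (rule dvdE)
  obtain \<kappa> where \<kappa>: "lead_coeff (shift u Q) = mpoly_const \<kappa>" "\<kappa> \<noteq> 0"
    using assms(2) by (auto simp: good_dir_def)
  define q where "q = evp (shift u Q) 0"
  have deg: "degree q > 0"
    using lead_const_evp(1)[OF \<kappa>, of 0] degree_shift_pos[OF assms] by (simp add: q_def)
  have "pderiv q = q * evp (shift u k) 0"
    unfolding q_def evp_shift_dd[symmetric] k by simp
  then have "q dvd pderiv q" by (metis dvd_triv_left)
  moreover have "pderiv q \<noteq> 0" using deg by (simp add: pderiv_eq_0_iff)
  ultimately have "degree q \<le> degree (pderiv q)" by (rule dvd_imp_degree_le)
  then show False using deg by (simp add: degree_pderiv)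
qed

section \<open>Cofactors and discriminant of a reduced polynomial\<close>

locale factorization =
  fixes P :: "'n::{finite,linorder} mpoly" and Q :: "nat \<Rightarrow> 'n mpoly" and s :: nat
  assumes reduced: "reduced_mpoly P" and fact: "irreducible_factorization P s Q"
begin

lemma P_eq: "P = (\<Prod>k<s. Q k)" and irr: "j < s \<Longrightarrow> irreducible (Q j)"
  using fact by (auto simp: irreducible_factorization_def)

lemma P_nonzero: "P \<noteq> 0"
  unfolding P_eq using irr by (metis irreducible_def lessThan_iff prod_zero_iff finite_lessThan)

lemma not_dvd:
  assumes ij: "i < s" "j < s" "i \<noteq> j"
  shows "\<not> Q i dvd Q j"
proof
  assume d: "Q i dvd Q j"
  then obtain k where k: "Q j = Q i * k" by (rule dvdE)
  have "\<not> Q i dvd 1" using irr[OF ij(1)] by (rule irreducible_not_unit)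
  then have "k dvd 1" using irreducibleD[OF irr[OF ij(2)] k] by blast
  then obtain e where "1 = k * e" by (rule dvdE)
  then have "Q i = Q j * e" by (metis k mult.assoc mult.right_neutral)
  then have "Q j dvd Q i" by simp
  with d reduced fact ij show False unfolding reduced_mpoly_def by blast
qed

lemma prime_not_dvd_prod:
  assumes "irreducible q" "finite K" "\<And>k. k \<in> K \<Longrightarrow> \<not> q dvd Q k"
  shows "\<not> q dvd (\<Prod>k\<in>K. Q k)"
  using assms(2,3)
proof (induction K rule: finite_induct)
  case empty
  then show ?case using assms(1) irreducible_not_unit by auto
next
  case (insert k K)
  then show ?case using irreducible_mpoly_prime[OF assms(1), of "Q k" "\<Prod>k\<in>K. Q k"] by auto
qed

definition cof :: "nat \<Rightarrow> 'n mpoly" where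
  "cof j = (\<Prod>k\<in>{..<s} - {j}. Q k)"

lemma P_cof: "j < s \<Longrightarrow> P = cof j * Q j"
  unfolding P_eq cof_def by (subst prod.remove[of _ j]) (auto simp: mult.commute)

lemma cof_eq_0: "j < s \<Longrightarrow> k < s \<Longrightarrow> j \<noteq> k \<Longrightarrow> mpoly_eval (Q j) y = 0 \<Longrightarrow> mpoly_eval (cof k) y = 0"
  unfolding cof_def by (simp add: prod_zero_iff) blast

lemma root_factor: "mpoly_eval P y = 0 \<Longrightarrow> \<exists>j<s. mpoly_eval (Q j) y = 0"
  unfolding P_eq by (auto simp: prod_zero_iff)

lemma dd_at_root:
  assumes "j < s" "mpoly_eval (Q j) y = 0"
  shows "mpoly_eval (mpoly_dd u P) y = mpoly_eval (cof j * mpoly_dd u (Q j)) y"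
  using assms unfolding P_cof[OF assms(1)] by (simp add: mpoly_dd_mult)

lemma good_dir_Q: "good_dir u P \<Longrightarrow> j < s \<Longrightarrow> good_dir u (Q j)"
  unfolding P_eq by (rule good_dir_prod[of "{..<s}"]) auto

text \<open>Reducedness enters here: Q_j divides neither its cofactor nor its own derivative along
  u, hence by primality not their product, which is the derivative of P on V(Q_j).
  \<open>dichotomy\<close> then gives a relation free of z for each j, and the product of the
  \<open>D j\<close> serves.\<close>

lemma discriminant_exists:
  assumes u: "good_dir u P"
  shows "\<exists>D. D \<noteq> 0 \<and> (\<forall>x. mpoly_eval D x \<noteq> 0 \<longrightarrow>
    (\<forall>z. mpoly_eval P (x + z *s u) = 0 \<longrightarrow> mpoly_eval (mpoly_dd u P) (x + z *s u) \<noteq> 0))"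
proof -
  have "\<exists>U W D. D \<noteq> 0 \<and> [:D:] = U * shift u (Q j) + W * shift u (cof j * mpoly_dd u (Q j))" if j: "j < s" for j
  proof -
    have "\<not> Q j dvd cof j"
      unfolding cof_def using j not_dvd by (intro prime_not_dvd_prod irr) auto
    moreover have "\<not> Q j dvd mpoly_dd u (Q j)"
      by (rule not_dvd_mpoly_dd[OF irr[OF j] good_dir_Q[OF u j]])
    ultimately have "\<not> Q j dvd cof j * mpoly_dd u (Q j)"
      using irreducible_mpoly_prime[OF irr[OF j]] by blast
    then show ?thesis using dichotomy[OF irr[OF j] good_dir_Q[OF u j]] by blast
  qed
  then obtain U W D where D: "\<And>j. j < s \<Longrightarrow> D j \<noteq> 0"
    "\<And>j. j < s \<Longrightarrow> [:D j:] = U j * shift u (Q j) + W j * shift u (cof j * mpoly_dd u (Q j))"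
    by metis
  have "mpoly_eval (mpoly_dd u P) (x + z *s u) \<noteq> 0"
    if x: "mpoly_eval (\<Prod>j<s. D j) x \<noteq> 0" and z: "mpoly_eval P (x + z *s u) = 0" for x z
  proof -
    obtain j where j: "j < s" "mpoly_eval (Q j) (x + z *s u) = 0" using root_factor[OF z] by blast
    have "ev2 [:D j:] x z = ev2 (W j) x z * mpoly_eval (cof j * mpoly_dd u (Q j)) (x + z *s u)"
      unfolding D(2)[OF j(1)] ev2_add ev2_mult ev2_shift j(2) by simp
    moreover have "ev2 [:D j:] x z \<noteq> 0"
      using x j(1) by (auto simp: ev2_pCons prod_zero_iff)
    ultimately show ?thesis unfolding dd_at_root[OF j] by auto
  qed
  moreover have "(\<Prod>j<s. D j) \<noteq> 0" using D(1) by (auto simp: prod_zero_iff)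
  ultimately show ?thesis by blast
qed

end

section \<open>De Rham classes of rational forms\<close>

lemma C_k_on_cong:
  assumes "open U" "\<And>x. x \<in> U \<Longrightarrow> f x = g x" "C_k_on k f U"
  shows "C_k_on k g U"
  using assms(2,3)
proof (induction k arbitrary: f g)
  case 0
  then show ?case by (metis C_k_on.simps(1) continuous_on_cong)
next
  case (Suc k)
  have D: "(g has_derivative frechet_derivative f (at x)) (at x)" if "x \<in> U" for x
  proof -
    have "(f has_derivative frechet_derivative f (at x)) (at x)"
      using Suc.prems(2) that by (simp add: frechet_derivative_works[symmetric])
    from has_derivative_transform_within_open[OF this assms(1) that Suc.prems(1)] show ?thesis .
  qed
  have eq: "frechet_derivative f (at x) = frechet_derivative g (at x)" if "x \<in> U" for x
    using frechet_derivative_at[OF D[OF that]] .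
  have "C_k_on k (\<lambda>x. frechet_derivative g (at x) v) U" for v
    by (rule Suc.IH[of "\<lambda>x. frechet_derivative f (at x) v"]) (use eq Suc.prems(2) in auto)
  moreover have "g differentiable (at x)" if "x \<in> U" for x
    using D[OF that] by (rule differentiableI)
  ultimately show ?case by simp
qed

lemma C_k_on_SucI:
  assumes U: "open U" and D: "\<And>x. x \<in> U \<Longrightarrow> (f has_derivative f' x) (at x)"
    and C: "\<And>v. C_k_on k (\<lambda>x. f' x v) U"
  shows "C_k_on (Suc k) f U"
proof -
  have "C_k_on k (\<lambda>x. frechet_derivative f (at x) v) U" for v
    by (rule C_k_on_cong[OF U _ C[of v]]) (use frechet_derivative_at[OF D] in simp)
  moreover have "f differentiable (at x)" if "x \<in> U" for x
    using D[OF that] by (rule differentiableI)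
  ultimately show ?thesis by simp
qed

lemma C_k_on_lincomb:
  fixes f g :: "'a::real_normed_vector \<Rightarrow> complex"
  assumes "open U" "C_k_on k f U" "C_k_on k g U"
  shows "C_k_on k (\<lambda>x. f x + c * g x) U"
  using assms(2,3)
proof (induction k arbitrary: f g)
  case 0
  then show ?case by (auto intro!: continuous_intros)
next
  case (Suc k)
  show ?case
  proof (rule C_k_on_SucI[OF assms(1)])
    fix x assume "x \<in> U"
    then have "(f has_derivative frechet_derivative f (at x)) (at x)" "(g has_derivative frechet_derivative g (at x)) (at x)"
      using Suc.prems by (auto simp: frechet_derivative_works[symmetric])
    then show "((\<lambda>x. f x + c * g x) has_derivative (\<lambda>v. frechet_derivative f (at x) v + c * frechet_derivative g (at x) v)) (at x)"
      by (intro has_derivative_add has_derivative_mult_right)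
  qed (use Suc in auto)
qed

lemma smooth_on_lincomb:
  fixes f g :: "'a::real_normed_vector \<Rightarrow> complex"
  shows "open U \<Longrightarrow> smooth_on f U \<Longrightarrow> smooth_on g U \<Longrightarrow> smooth_on (\<lambda>x. f x + c * g x) U"
  by (simp add: smooth_on_def C_k_on_lincomb)

lemma smooth_on_has_derivative:
  assumes "smooth_on f U" "x \<in> U"
  shows "(f has_derivative frechet_derivative f (at x)) (at x)"
proof -
  have "C_k_on (Suc 0) f U" using assms(1) unfolding smooth_on_def by blast
  then show ?thesis using assms(2) by (simp add: frechet_derivative_works[symmetric])
qed

lemma exact_forms1_lincomb:
  assumes U: "open U" and "\<beta> \<in> exact_forms1 U" "\<gamma> \<in> exact_forms1 U"
  shows "(\<lambda>x v. \<beta> x v + c * \<gamma> x v) \<in> exact_forms1 U"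
proof -
  obtain f g where fg: "smooth_on f U" "\<beta> = ext_deriv0 U f" "smooth_on g U" "\<gamma> = ext_deriv0 U g"
    using assms by (auto simp: exact_forms1_def)
  have "frechet_derivative (\<lambda>x. f x + c * g x) (at x) = (\<lambda>v. frechet_derivative f (at x) v + c * frechet_derivative g (at x) v)"
    if "x \<in> U" for x
    by (rule frechet_derivative_at[symmetric])
       (intro has_derivative_add has_derivative_mult_right smooth_on_has_derivative[OF _ that] fg)
  then have "(\<lambda>x v. \<beta> x v + c * \<gamma> x v) = ext_deriv0 U (\<lambda>x. f x + c * g x)"
    by (intro ext) (simp add: fg ext_deriv0_def)
  then show ?thesis
    using smooth_on_lincomb[OF U fg(1,3)] by (auto simp: exact_forms1_def)
qed

text \<open>A primitive of a smooth form is smooth, since its derivatives are the values of the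
  form. Both \<open>\<omega>\<close> and \<open>ext_deriv0 U F\<close> are 0 off \<open>U\<close>,
  so they are equal as functions.\<close>

lemma exact_on_imp_exact_forms1:
  assumes U: "open U" and sm: "\<And>v. smooth_on (\<lambda>x. \<omega> x v) U" and out: "\<And>x v. x \<notin> U \<Longrightarrow> \<omega> x v = 0"
    and ex: "exact_on U \<omega>"
  shows "\<omega> \<in> exact_forms1 U"
proof -
  obtain F where F: "\<And>x. x \<in> U \<Longrightarrow> (F has_derivative \<omega> x) (at x)"
    using ex by (auto simp: exact_on_def primitive_on_def)
  have "C_k_on k F U" for k
  proof (cases k)
    case 0
    then show ?thesis using F
      by (auto intro!: continuous_at_imp_continuous_on has_derivative_continuous)
  next
    case (Suc k')
    have "C_k_on (Suc k') F U"
      by (rule C_k_on_SucI[OF U F]) (use sm in \<open>auto simp: smooth_on_def\<close>)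
    then show ?thesis using Suc by simp
  qed
  then have "smooth_on F U" by (simp add: smooth_on_def)
  moreover have "\<omega> = ext_deriv0 U F"
  proof (intro ext)
    fix x v
    show "\<omega> x v = ext_deriv0 U F x v"
      using out[of x v] frechet_derivative_at[OF F, of x] by (simp add: ext_deriv0_def)
  qed
  ultimately show ?thesis by (auto simp: exact_forms1_def)
qed

lemma exact_forms1_imp_exact_on:
  assumes "\<omega> \<in> exact_forms1 U"
  shows "exact_on U \<omega>"
proof -
  obtain f where f: "smooth_on f U" "\<omega> = ext_deriv0 U f" using assms by (auto simp: exact_forms1_def)
  have "primitive_on U \<omega> f"
    unfolding primitive_on_def
  proof
    fix x assume "x \<in> U"
    moreover from this have "\<omega> x = frechet_derivative f (at x)" by (auto simp: f(2) ext_deriv0_def)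
    ultimately show "(f has_derivative \<omega> x) (at x)" using smooth_on_has_derivative[OF f(1)] by simp
  qed
  then show ?thesis by (auto simp: exact_on_def)
qed

lemma zero_in_exact_forms1: "open U \<Longrightarrow> (\<lambda>x v. 0) \<in> exact_forms1 U"
proof -
  assume U: "open U"
  have "C_k_on k (\<lambda>x::'a. 0 :: complex) U" for k
    by (induction k) (auto intro!: C_k_on_SucI[OF U, of _ "\<lambda>x v. 0"] simp del: C_k_on.simps(2))
  then show ?thesis
    by (intro exact_on_imp_exact_forms1[OF U])
       (auto simp: smooth_on_def exact_on_def primitive_on_def intro!: exI[of _ "\<lambda>x. 0"])
qed

section \<open>Arithmetic of cohomology classes\<close>

lemma derham_classI: "\<beta> \<in> exact_forms1 U \<Longrightarrow> (\<lambda>x v. \<omega> x v + \<beta> x v) \<in> derham_class U \<omega>"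
  unfolding derham_class_def by (rule CollectI, rule exI[of _ \<beta>]) simp

lemma derham_class_self: "open U \<Longrightarrow> \<omega> \<in> derham_class U \<omega>"
  using derham_classI[OF zero_in_exact_forms1, of U \<omega>] by simp

lemma derham_class_eq_iff:
  assumes U: "open U"
  shows "derham_class U \<omega> = derham_class U \<eta> \<longleftrightarrow> (\<lambda>x v. \<omega> x v - \<eta> x v) \<in> exact_forms1 U"
proof
  assume "derham_class U \<omega> = derham_class U \<eta>"
  moreover have "\<omega> \<in> derham_class U \<omega>" by (rule derham_class_self[OF U])
  ultimately obtain \<beta> where \<beta>: "\<omega> = (\<lambda>x v. \<eta> x v + \<beta> x v)" "\<beta> \<in> exact_forms1 U"
    unfolding derham_class_def by blast
  then show "(\<lambda>x v. \<omega> x v - \<eta> x v) \<in> exact_forms1 U" by simp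
next
  assume *: "(\<lambda>x v. \<omega> x v - \<eta> x v) \<in> exact_forms1 U"
  have sub: "derham_class U \<omega> \<subseteq> derham_class U \<eta>" if "(\<lambda>x v. \<omega> x v - \<eta> x v) \<in> exact_forms1 U" for \<omega> \<eta>
  proof
    fix \<zeta> assume "\<zeta> \<in> derham_class U \<omega>"
    then obtain \<beta> where \<beta>: "\<zeta> = (\<lambda>x v. \<omega> x v + \<beta> x v)" "\<beta> \<in> exact_forms1 U" by (auto simp: derham_class_def)
    have "(\<lambda>x v. (\<omega> x v - \<eta> x v) + 1 * \<beta> x v) \<in> exact_forms1 U"
      by (rule exact_forms1_lincomb[OF U that \<beta>(2)])
    then show "\<zeta> \<in> derham_class U \<eta>"
      unfolding derham_class_def
      by (intro CollectI exI[of _ "\<lambda>x v. (\<omega> x v - \<eta> x v) + 1 * \<beta> x v"]) (auto simp: \<beta>(1))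
  qed
  have "(\<lambda>x v. \<eta> x v - \<omega> x v) \<in> exact_forms1 U"
    using exact_forms1_lincomb[OF U zero_in_exact_forms1[OF U] *, of "-1"] by simp
  with sub * show "derham_class U \<omega> = derham_class U \<eta>" by blast
qed

lemma derham_class_add:
  assumes U: "open U"
  shows "derham_add (derham_class U \<omega>) (derham_class U \<eta>) = derham_class U (\<lambda>x v. \<omega> x v + \<eta> x v)"
proof (intro equalityI subsetI)
  fix \<zeta> assume "\<zeta> \<in> derham_add (derham_class U \<omega>) (derham_class U \<eta>)"
  then obtain \<beta> \<gamma> where *: "\<beta> \<in> exact_forms1 U" "\<gamma> \<in> exact_forms1 U" "\<zeta> = (\<lambda>x v. (\<omega> x v + \<beta> x v) + (\<eta> x v + \<gamma> x v))"
    unfolding derham_add_def derham_class_def by blast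
  then show "\<zeta> \<in> derham_class U (\<lambda>x v. \<omega> x v + \<eta> x v)"
    unfolding derham_class_def using exact_forms1_lincomb[OF U *(1,2), of 1]
    by (intro CollectI exI[of _ "\<lambda>x v. \<beta> x v + 1 * \<gamma> x v"]) (auto simp: algebra_simps)
next
  fix \<zeta> assume "\<zeta> \<in> derham_class U (\<lambda>x v. \<omega> x v + \<eta> x v)"
  then obtain \<beta> where *: "\<beta> \<in> exact_forms1 U" "\<zeta> = (\<lambda>x v. \<omega> x v + \<eta> x v + \<beta> x v)"
    by (auto simp: derham_class_def)
  have 1: "\<omega> \<in> derham_class U \<omega>" by (rule derham_class_self[OF U])
  have 2: "(\<lambda>x v. \<eta> x v + \<beta> x v) \<in> derham_class U \<eta>" by (rule derham_classI[OF *(1)])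
  show "\<zeta> \<in> derham_add (derham_class U \<omega>) (derham_class U \<eta>)"
    unfolding derham_add_def
    by (rule CollectI, rule exI[of _ \<omega>], rule exI[of _ "\<lambda>x v. \<eta> x v + \<beta> x v"])
       (use 1 2 in \<open>simp add: *(2) add.assoc\<close>)
qed

lemma derham_class_scale:
  assumes U: "open U"
  shows "derham_scale U c (derham_class U \<omega>) = derham_class U (\<lambda>x v. c * \<omega> x v)"
proof (intro equalityI subsetI)
  fix \<zeta> assume "\<zeta> \<in> derham_scale U c (derham_class U \<omega>)"
  then obtain \<beta> \<gamma> where *: "\<beta> \<in> exact_forms1 U" "\<gamma> \<in> exact_forms1 U" "\<zeta> = (\<lambda>x v. c * (\<omega> x v + \<beta> x v) + \<gamma> x v)"
    unfolding derham_scale_def derham_class_def by blast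
  then show "\<zeta> \<in> derham_class U (\<lambda>x v. c * \<omega> x v)"
    unfolding derham_class_def using exact_forms1_lincomb[OF U *(2,1), of c]
    by (intro CollectI exI[of _ "\<lambda>x v. \<gamma> x v + c * \<beta> x v"]) (auto simp: algebra_simps)
next
  fix \<zeta> assume "\<zeta> \<in> derham_class U (\<lambda>x v. c * \<omega> x v)"
  then obtain \<beta> where *: "\<beta> \<in> exact_forms1 U" "\<zeta> = (\<lambda>x v. c * \<omega> x v + \<beta> x v)"
    by (auto simp: derham_class_def)
  have 1: "\<omega> \<in> derham_class U \<omega>" by (rule derham_class_self[OF U])
  show "\<zeta> \<in> derham_scale U c (derham_class U \<omega>)"
    unfolding derham_scale_def
    by (rule CollectI, rule exI[of _ \<omega>], rule exI[of _ \<beta>]) (use 1 * in simp)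
qed

section \<open>Forms with denominator P\<close>

lemma has_derivative_mpoly_dd:
  "(mpoly_eval p has_derivative (\<lambda>v. mpoly_eval (mpoly_dd v p) x)) (at x)"
proof -
  have "(\<lambda>v. mpoly_eval (mpoly_dd v p) x) = (\<lambda>v. \<Sum>i\<in>UNIV. mpoly_eval (mpoly_pd i p) x * v $ i)"
    by (rule ext) (simp add: mpoly_dd_def mult.commute)
  then show ?thesis using has_derivative_mpoly_eval[of p x UNIV] by simp
qed

lemma open_hyp_compl: "open (hyp_compl P)"
  for P :: "'n::{finite,linorder} mpoly"
  unfolding hyp_compl_def by (intro open_Collect_neq continuous_intros)

text \<open>The derivative is again a polynomial over a power of P, so these quotients form a class
  stable under differentiation; smoothness follows by induction.\<close>

lemma has_derivative_rational:
  fixes P a :: "'n::{finite,linorder} mpoly"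
  assumes "mpoly_eval P x \<noteq> 0"
  shows "((\<lambda>x. mpoly_eval a x / mpoly_eval P x ^ m) has_derivative
    (\<lambda>v. mpoly_eval (mpoly_dd v a * P - mpoly_const (of_nat m) * (a * mpoly_dd v P)) x / mpoly_eval P x ^ Suc m)) (at x)"
proof -
  have D: "((\<lambda>x. mpoly_eval a x / mpoly_eval P x ^ m) has_derivative
     (\<lambda>v. (mpoly_eval (mpoly_dd v a) x * mpoly_eval P x ^ m - mpoly_eval a x * (of_nat m * mpoly_eval (mpoly_dd v P) x * mpoly_eval P x ^ (m - 1))) /
       (mpoly_eval P x ^ m * mpoly_eval P x ^ m))) (at x)"
    by (rule has_derivative_divide'[OF has_derivative_mpoly_dd has_derivative_power[OF has_derivative_mpoly_dd]])
       (use assms in simp)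
  have "(\<lambda>v. (mpoly_eval (mpoly_dd v a) x * mpoly_eval P x ^ m - mpoly_eval a x * (of_nat m * mpoly_eval (mpoly_dd v P) x * mpoly_eval P x ^ (m - 1))) /
       (mpoly_eval P x ^ m * mpoly_eval P x ^ m)) =
     (\<lambda>v. mpoly_eval (mpoly_dd v a * P - mpoly_const (of_nat m) * (a * mpoly_dd v P)) x / mpoly_eval P x ^ Suc m)"
    \<comment> \<open>For m = 0 the truncated exponent m - 1 is harmless, because it comes with the
      factor \<open>of_nat m\<close>.\<close>
    using assms by (intro ext, cases m) (simp_all add: divide_simps, simp add: algebra_simps)
  with D show ?thesis by simp
qed

lemma smooth_on_rational:
  fixes P a :: "'n::{finite,linorder} mpoly"
  shows "smooth_on (\<lambda>x. mpoly_eval a x / mpoly_eval P x ^ m) (hyp_compl P)"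
proof -
  have "C_k_on k (\<lambda>x. mpoly_eval a x / mpoly_eval P x ^ m) (hyp_compl P)" for k
  proof (induction k arbitrary: a m)
    case 0
    show ?case by (auto simp: hyp_compl_def intro!: continuous_intros)
  next
    case (Suc k)
    show ?case
      by (rule C_k_on_SucI[OF open_hyp_compl has_derivative_rational Suc]) (simp add: hyp_compl_def)
  qed
  then show ?thesis by (simp add: smooth_on_def)
qed

text \<open>The numerator of \<open>omega P A\<close> on the constant vector field v.\<close>

definition contract :: "complex ^ 'n::{finite,linorder} \<Rightarrow> 'n mpoly ^ 'n::{finite,linorder} \<Rightarrow> 'n mpoly" where
  "contract v A = (\<Sum>i\<in>UNIV. mpoly_const (v $ i) * A $ i)"

lemma contract_add: "contract v (A + B) = contract v A + contract v B"
  by (simp add: contract_def distrib_left sum.distrib)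

lemma contract_scale: "contract v (tuple_scale c A) = mpoly_const c * contract v A"
  by (simp add: contract_def tuple_scale_def sum_distrib_left mult_ac)

lemma contract_0 [simp]: "contract v 0 = 0"
  by (simp add: contract_def)

lemma contract_sum: "contract v (sum f K) = (\<Sum>k\<in>K. contract v (f k))"
  by (induction K rule: infinite_finite_induct) (simp_all add: contract_add)

lemma contract_add_left: "contract (v + w) A = contract v A + contract w A"
  by (simp add: contract_def single_add distrib_right sum.distrib)

lemma contract_smult_left: "contract (c *s v) A = mpoly_const c * contract v A"
proof -
  have "mpoly_const (c * d) = (mpoly_const c * mpoly_const d :: 'a mpoly)" for d by (simp add: mult_single)
  then show ?thesis
    unfolding contract_def sum_distrib_left by (intro sum.cong refl) (simp add: mult.assoc)
qed

lemma contract_axis: "contract (axis i 1) A = A $ i"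
proof -
  have "contract (axis i 1) A = (\<Sum>j\<in>UNIV. if j = i then A $ j else 0)"
    unfolding contract_def by (intro sum.cong) (auto simp: axis_def)
  then show ?thesis by simp
qed

lemma omega_contract: "omega P A x v = mpoly_eval (contract v A) x / mpoly_eval P x"
  by (simp add: omega_def contract_def sum_divide_distrib mult_ac)

text \<open>On constant vectors the exterior derivative antisymmetrises a bilinear expression with
  coefficients \<open>E k i\<close>, and \<open>closed_cond\<close> says that \<open>E\<close> is
  symmetric.\<close>

lemma omega_closed:
  fixes P :: "'n::{finite,linorder} mpoly"
  assumes "closed_cond P A"
  shows "omega P A \<in> closed_forms1 (hyp_compl P)"
  unfolding closed_forms1_def smooth_forms1_def
proof (intro CollectI conjI ballI allI impI)
  show "linear (omega P A x)" for x
  proof (rule linearI)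
    show "omega P A x (b1 + b2) = omega P A x b1 + omega P A x b2" for b1 b2
      by (simp add: omega_contract contract_add_left add_divide_distrib)
    have "r *\<^sub>R b = complex_of_real r *s b" for r and b :: "complex ^ 'n::{finite,linorder}"
      unfolding vec_eq_iff by (simp add: scaleR_conv_of_real[of _ "_::complex"])
    then show "omega P A x (r *\<^sub>R b) = r *\<^sub>R omega P A x b" for r b
      by (simp add: omega_contract contract_smult_left scaleR_conv_of_real[of _ "_::complex"])
  qed
  show "smooth_on (\<lambda>x. omega P A x v) (hyp_compl P)" for v
    unfolding omega_contract using smooth_on_rational[of "contract v A" P 1] by simp
  show "omega P A x v = 0" if "x \<notin> hyp_compl P" for x v
    using that by (simp add: omega_contract hyp_compl_def)
  fix x v w assume x: "x \<in> hyp_compl P"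
  define E where "E = (\<lambda>k i. mpoly_pd k (A $ i) * P - A $ i * mpoly_pd k P)"
  have E: "E k i = E i k" for k i using assms by (simp add: closed_cond_def E_def)
  have fd: "frechet_derivative (\<lambda>y. omega P A y v) (at x) w =
    mpoly_eval (mpoly_dd w (contract v A) * P - contract v A * mpoly_dd w P) x / mpoly_eval P x ^ 2" for v w
  proof -
    have "((\<lambda>y. omega P A y v) has_derivative (\<lambda>w. mpoly_eval (mpoly_dd w (contract v A) * P -
      mpoly_const (of_nat 1) * (contract v A * mpoly_dd w P)) x / mpoly_eval P x ^ Suc 1)) (at x)"
      using has_derivative_rational[of P x "contract v A" 1] x by (simp add: omega_contract hyp_compl_def)
    from frechet_derivative_at[OF this, symmetric] show ?thesis by (simp add: power2_eq_square)
  qed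
  have ex: "mpoly_dd w (contract v A) * P - contract v A * mpoly_dd w P =
     (\<Sum>k\<in>UNIV. \<Sum>i\<in>UNIV. mpoly_const (w $ k) * mpoly_const (v $ i) * E k i)" for v w
    by (simp add: mpoly_dd_def contract_def mpoly_pd_sum mpoly_pd_mult sum_distrib_left sum_distrib_right E_def
      right_diff_distrib sum_subtractf mult_ac)
       (subst (2) sum.swap, simp add: mult_ac)
  have "(\<Sum>k\<in>UNIV. \<Sum>i\<in>UNIV. mpoly_const (w $ k) * mpoly_const (v $ i) * E k i) =
    (\<Sum>k\<in>UNIV. \<Sum>i\<in>UNIV. mpoly_const (v $ k) * mpoly_const (w $ i) * E k i)"
    by (subst sum.swap) (simp add: E mult_ac)
  then show "ext_deriv1 (omega P A) x v w = 0"
    unfolding ext_deriv1_def fd ex by simp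
qed

section \<open>The isomorphism\<close>

lemma simple_root_factor:
  fixes p :: "complex poly"
  assumes "poly p 0 = 0" "poly (pderiv p) 0 \<noteq> 0"
  obtains h \<epsilon> where "p = [:0, 1:] * h" "poly h 0 = poly (pderiv p) 0" "\<epsilon> > 0" "\<And>z. norm z < \<epsilon> \<Longrightarrow> poly h z \<noteq> 0"
proof -
  obtain h where h: "p = [:- 0, 1:] * h" using assms(1) by (auto simp: poly_eq_0_iff_dvd)
  then have p: "p = [:0, 1:] * h" by simp
  have h0: "poly h 0 = poly (pderiv p) 0" by (simp add: p pderiv_mult pderiv_pCons)
  have "open {z. poly h z \<noteq> 0}" by (intro open_Collect_neq continuous_intros)
  moreover have "0 \<in> {z. poly h z \<noteq> 0}" using h0 assms(2) by simp
  ultimately obtain \<epsilon> where "\<epsilon> > 0" "ball 0 \<epsilon> \<subseteq> {z. poly h z \<noteq> 0}" by (meson openE)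
  then show ?thesis using that[OF p h0, of \<epsilon>] by (auto simp: subset_iff)
qed

text \<open>\<open>c\<close> is the residue of a / p at the simple zero 0 of p. After subtraction of
  c / z the quotient k / h is left, with h nonvanishing near 0.\<close>

lemma exact_on_pole_part:
  fixes p a :: "complex poly"
  assumes "poly p 0 = 0" "poly (pderiv p) 0 \<noteq> 0" "poly a 0 = c * poly (pderiv p) 0"
  shows "\<exists>\<epsilon>>0. exact_on (ball 0 \<epsilon> - {0}) (\<lambda>z w. poly a z / poly p z * w - c / z * w)"
proof -
  obtain h \<epsilon> where h: "p = [:0, 1:] * h" "poly h 0 = poly (pderiv p) 0" "\<epsilon> > 0" "\<And>z. norm z < \<epsilon> \<Longrightarrow> poly h z \<noteq> 0"
    using simple_root_factor[OF assms(1,2)] by blast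
  have "poly (a - smult c h) 0 = 0" using assms(3) h(2) by simp
  then have "[:- 0, 1:] dvd a - smult c h" unfolding poly_eq_0_iff_dvd .
  then obtain k where k: "a - smult c h = [:- 0, 1:] * k" by (rule dvdE)
  have a: "poly a z = c * poly h z + z * poly k z" for z
    using arg_cong[OF k, of "\<lambda>f. poly f z"] by (simp add: algebra_simps)
  have "(\<lambda>z. poly k z / poly h z) holomorphic_on ball 0 \<epsilon>"
    using h(4) by (auto intro!: holomorphic_intros)
  then have "exact_on (ball 0 \<epsilon>) (\<lambda>z w. poly k z / poly h z * w)"
    by (intro exact_on_holomorphic) auto
  then have ex: "exact_on (ball 0 \<epsilon> - {0}) (\<lambda>z w. poly k z / poly h z * w)"
    by (rule exact_on_subset) auto
  have "exact_on (ball 0 \<epsilon> - {0}) (\<lambda>z w. poly a z / poly p z * w - c / z * w)"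
  proof -
    obtain F where F: "\<forall>z\<in>ball 0 \<epsilon> - {0}. (F has_derivative (\<lambda>w. poly k z / poly h z * w)) (at z)"
      using ex unfolding exact_on_def primitive_on_def by blast
    have "poly k z / poly h z * w = poly a z / poly p z * w - c / z * w" if "z \<in> ball 0 \<epsilon> - {0}" for z w
      using that h(4)[of z] by (simp add: a h(1) field_simps)
    then have "\<forall>z\<in>ball 0 \<epsilon> - {0}. (F has_derivative (\<lambda>w. poly a z / poly p z * w - c / z * w)) (at z)"
      using F by simp
    then show ?thesis unfolding exact_on_def primitive_on_def by blast
  qed
  with h(3) show ?thesis by blast
qed

lemma prod_roots_dvd:
  fixes g :: "complex poly"
  assumes "finite K" "\<And>s. s \<in> K \<Longrightarrow> poly g s = 0"
  shows "(\<Prod>s\<in>K. [:- s, 1:]) dvd g"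
  using assms
proof (induction K arbitrary: g rule: finite_induct)
  case (insert s K)
  obtain k where k: "g = [:- s, 1:] * k" using insert.prems[of s] by (auto simp: poly_eq_0_iff_dvd)
  have "(\<Prod>s\<in>K. [:- s, 1:]) dvd k"
  proof (rule insert.IH)
    fix t assume t: "t \<in> K"
    then have "(t - s) * poly k t = 0" using insert.prems[of t] k by (simp add: algebra_simps)
    then show "poly k t = 0" using t insert.hyps by auto
  qed
  then show ?case unfolding k using insert.hyps by (simp add: mult_dvd_mono del: mult_pCons_left)
qed simp

lemma (in hyp_line) simple_dd_nonzero:
  assumes "simple y" "mpoly_eval P y = 0"
  shows "mpoly_eval (mpoly_dd u P) y \<noteq> 0"
proof -
  have "0 \<in> S y" using assms(2) by (simp add: S_def)
  with assms(1) have "mpoly_eval (mpoly_dd u P) (y + 0 *s u) \<noteq> 0" unfolding simple_def by blast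
  then show ?thesis by simp
qed

section \<open>Residues of the logarithmic forms\<close>

context factorization
begin

lemma contract_dlog: "contract u (dlog_tuple s Q j) = cof j * mpoly_dd u (Q j)"
  by (simp add: contract_def dlog_tuple_def mpoly_dd_def cof_def sum_distrib_left mult_ac)

text \<open>At a zero of Q_j the cofactors of the other factors vanish. At a transverse zero the
  identity says that the combination has residue c_j.\<close>

lemma contract_sum_dlog_at_root:
  assumes j: "j < s" "mpoly_eval (Q j) y = 0"
  shows "mpoly_eval (contract u (\<Sum>k<s. tuple_scale (c k) (dlog_tuple s Q k))) y = c j * mpoly_eval (mpoly_dd u P) y"
proof -
  have "mpoly_eval (contract u (\<Sum>k<s. tuple_scale (c k) (dlog_tuple s Q k))) y =
     (\<Sum>k<s. c k * (mpoly_eval (cof k) y * mpoly_eval (mpoly_dd u (Q k)) y))"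
    by (simp add: contract_sum contract_scale contract_dlog)
  also have "\<dots> = (\<Sum>k<s. if k = j then c j * mpoly_eval (mpoly_dd u P) y else 0)"
    by (intro sum.cong refl) (use j in \<open>auto simp: cof_eq_0[OF j(1) _ _ j(2)] dd_at_root[OF j]\<close>)
  finally show ?thesis using j(1) by simp
qed

lemma lead_const:
  assumes "good_dir u P"
  obtains \<kappa> where "hyp_line P u \<kappa>"
  using assms by (auto simp: good_dir_def hyp_line_def)

text \<open>Q_j has positive degree in z on every line in a good direction, so a line all of whose
  zeros are simple meets V(Q_j).\<close>

lemma simple_root_exists:
  assumes "hyp_line P u \<kappa>" and D: "D \<noteq> 0" "\<And>x. mpoly_eval D x \<noteq> 0 \<Longrightarrow> hyp_line.simple P u x" and j: "j < s"
  shows "\<exists>y. hyp_line.simple P u y \<and> mpoly_eval (Q j) y = 0"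
proof -
  interpret hyp_line P u \<kappa> by fact
  have "good_dir u P" using lead \<kappa> by (auto simp: good_dir_def)
  then have gj: "good_dir u (Q j)" by (rule good_dir_Q[OF _ j])
  then obtain \<kappa>j where \<kappa>j: "lead_coeff (shift u (Q j)) = mpoly_const \<kappa>j" "\<kappa>j \<noteq> 0" by (auto simp: good_dir_def)
  obtain x where x: "mpoly_eval D x \<noteq> 0" using mpoly_nonzero_dense[OF D(1), of 1 0] by auto
  have "degree (evp (shift u (Q j)) x) \<noteq> 0"
    using lead_const_evp(1)[OF \<kappa>j, of x] degree_shift_pos[OF irr[OF j] gj] by simp
  then obtain z where "poly (evp (shift u (Q j)) x) z = 0"
    using Fundamental_Theorem_Algebra.fundamental_theorem_of_algebra[of "evp (shift u (Q j)) x"] by (auto simp: constant_degree)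
  then have "mpoly_eval (Q j) (x + z *s u) = 0" by (simp add: poly_evp)
  moreover have "simple (x + z *s u)" using D(2)[OF x] by (simp add: simple_translate)
  ultimately show ?thesis by blast
qed

text \<open>The constants c_j are the values of the residue on V(Q_j), once it is known to be
  constant there. The corrected form has residue 0 at every simple zero, and
  \<open>exact_global\<close> applies.\<close>

lemma exact_modulo_dlog:
  assumes u: "good_dir u P" and loc: "loc_exact {x. mpoly_eval P x \<noteq> 0} \<omega>"
  shows "\<exists>c. exact_on {x. mpoly_eval P x \<noteq> 0}
    (\<lambda>x v. \<omega> x v - omega P (\<Sum>k<s. tuple_scale (c k) (dlog_tuple s Q k)) x v)"
proof -
  obtain \<kappa> where hl: "hyp_line P u \<kappa>" using lead_const[OF u] .
  interpret F1: form_along_line P u \<kappa> \<omega>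
    using hl loc by (simp add: form_along_line_def form_along_line_axioms_def)
  obtain D where D: "D \<noteq> 0" "\<And>x. mpoly_eval D x \<noteq> 0 \<Longrightarrow> F1.simple x"
    using discriminant_exists[OF u] unfolding F1.simple_def F1.S_def by blast
  interpret W: weighted_roots P u \<kappa> F1.res D
    by unfold_locales (use D F1.res_loc_const in auto)
  obtain A where A: "\<And>y. F1.simple y \<Longrightarrow> mpoly_eval P y = 0 \<Longrightarrow> mpoly_eval A y = F1.res y * mpoly_eval (mpoly_dd u P) y"
    using W.weight_poly by blast
  have dd: "mpoly_eval (mpoly_dd u P) y \<noteq> 0" if "F1.simple y" "mpoly_eval P y = 0" for y
    using that by (rule F1.simple_dd_nonzero)
  have QP: "mpoly_eval P y = 0" if "j < s" "mpoly_eval (Q j) y = 0" for j y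
    unfolding P_cof[OF that(1)] using that(2) by simp
  have "\<exists>c. \<forall>y. F1.simple y \<longrightarrow> mpoly_eval (Q j) y = 0 \<longrightarrow> F1.res y = c" if j: "j < s" for j
  proof -
    have gj: "good_dir u (Q j)" by (rule good_dir_Q[OF u j])
    then obtain \<kappa>j where \<kappa>j: "lead_coeff (shift u (Q j)) = mpoly_const \<kappa>j" "\<kappa>j \<noteq> 0" by (auto simp: good_dir_def)
    obtain y0 where y0: "F1.simple y0" "mpoly_eval (Q j) y0 = 0"
      using simple_root_exists[OF hl D j] by blast
    define c where "c = F1.res y0"
    \<comment> \<open>At a simple point of V(Q_j), \<open>B\<close> vanishes exactly when the
      residue is \<open>c\<close>; divisibility of \<open>B\<close> by Q_j therefore gives the same
      residue at all of them.\<close>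
    define B where "B = A - mpoly_const c * mpoly_dd u P"
    have "Q j dvd B"
    proof (rule ccontr)
      assume "\<not> Q j dvd B"
      \<comment> \<open>\<open>E\<close> is free of z. A line with E D \<noteq> 0 close to
        \<open>y0\<close> meets V(Q_j) in a simple point so near to \<open>y0\<close> that the
        residue there is still \<open>c\<close>; both Q_j and \<open>B\<close> vanish at this point,
        which forces E = 0 on that line.\<close>
      then obtain U V E where E: "E \<noteq> 0" "[:E:] = U * shift u (Q j) + V * shift u B"
        using dichotomy[OF irr[OF j] gj] by blast
      obtain \<delta> where \<delta>: "\<delta> > 0" "\<And>y. dist y0 y < \<delta> \<Longrightarrow> mpoly_eval P y = 0 \<Longrightarrow> F1.res y = c"
        using F1.res_loc_const[OF QP[OF j y0(2)] dd[OF y0(1) QP[OF j y0(2)]]] unfolding c_def by blast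
      define \<delta>' where "\<delta>' = \<delta> / (2 * (1 + norm u))"
      have nu: "1 + norm u > 0" using norm_ge_zero[of u] by linarith
      have \<delta>': "\<delta>' > 0" "\<delta>' * (1 + norm u) = \<delta> / 2" using \<delta>(1) nu by (simp_all add: \<delta>'_def field_simps)
      interpret Qj: hyp_line "Q j" u \<kappa>j using \<kappa>j by unfold_locales
      have "0 \<in> Qj.S y0" using y0(2) by (simp add: Qj.S_def)
      from Qj.root_near[OF this \<delta>'(1)]
      obtain \<eta> where \<eta>: "\<eta> > 0" "\<And>x. dist y0 x < \<eta> \<Longrightarrow> \<exists>s'\<in>Qj.S x. norm (0 - s') < \<delta>'" by blast
      have "E * D \<noteq> 0" using E(1) D(1) by simp
      moreover have "min \<eta> (\<delta> / 2) > 0" using \<eta>(1) \<delta>(1) by simp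
      ultimately obtain x where x: "dist y0 x < min \<eta> (\<delta> / 2)" "mpoly_eval (E * D) x \<noteq> 0"
        by (rule mpoly_nonzero_dense)
      then obtain z where z: "z \<in> Qj.S x" "norm z < \<delta>'" using \<eta>(2)[of x] by auto
      define y where "y = x + z *s u"
      have Qy: "mpoly_eval (Q j) y = 0" using z(1) by (simp add: Qj.S_def y_def)
      have sy: "F1.simple y" using D(2)[of x] x(2) by (simp add: y_def F1.simple_translate)
      have "dist y0 y = norm ((y0 - x) - z *s u)" by (simp add: y_def dist_norm diff_diff_eq)
      also have "\<dots> \<le> dist y0 x + norm z * norm u"
        by (rule order_trans[OF norm_triangle_ineq4]) (simp only: dist_norm norm_vector_smult_complex order_refl)
      also have "norm z * norm u \<le> \<delta>' * (1 + norm u)" using z(2) \<delta>'(1) by (intro mult_mono) auto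
      finally have "dist y0 y < \<delta>" using x(1) \<delta>'(2) by simp
      then have "F1.res y = c" by (rule \<delta>(2)[OF _ QP[OF j Qy]])
      then have By: "mpoly_eval B y = 0" using A[OF sy QP[OF j Qy]] by (simp add: B_def)
      have "ev2 [:E:] x z = ev2 U x z * mpoly_eval (Q j) y + ev2 V x z * mpoly_eval B y"
        unfolding E(2) by (simp add: y_def)
      then show False using Qy By x(2) by (simp add: ev2_pCons)
    qed
    then obtain k where k: "B = Q j * k" by (rule dvdE)
    have "F1.res y = c" if y: "F1.simple y" "mpoly_eval (Q j) y = 0" for y
    proof -
      have "mpoly_eval B y = 0" using y(2) by (simp add: k)
      then have "F1.res y * mpoly_eval (mpoly_dd u P) y = c * mpoly_eval (mpoly_dd u P) y"
        using A[OF y(1) QP[OF j y(2)]] by (simp add: B_def)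
      then show ?thesis using dd[OF y(1) QP[OF j y(2)]] by simp
    qed
    then show ?thesis by blast
  qed
  then obtain c where c: "\<And>j y. j < s \<Longrightarrow> F1.simple y \<Longrightarrow> mpoly_eval (Q j) y = 0 \<Longrightarrow> F1.res y = c j" by metis
  define A0 where "A0 = (\<Sum>k<s. tuple_scale (c k) (dlog_tuple s Q k))"
  have "dlog_tuple s Q k \<in> F_space P" if "k < s" for k
    by (rule dlog_tuple_in_F_space[OF P_eq P_nonzero that])
  then have "A0 \<in> F_space P"
    unfolding A0_def using subspace_F_space[OF P_nonzero]
    by (intro tuples.subspace_sum tuples.subspace_scale) auto
  then have "closed_cond P A0" by (simp add: F_space_iff[OF P_nonzero])
  then have "loc_exact (hyp_compl P) (omega P A0)"
    by (intro closed_form_loc_exact open_hyp_compl omega_closed)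
  then have loc0: "loc_exact {x. mpoly_eval P x \<noteq> 0} (omega P A0)" by (simp add: hyp_compl_def)
  define \<omega>' where "\<omega>' = (\<lambda>x v. \<omega> x v - omega P A0 x v)"
  have "loc_exact {x. mpoly_eval P x \<noteq> 0} \<omega>'" unfolding \<omega>'_def by (rule loc_exact_diff[OF loc loc0])
  then interpret F2: form_along_line P u \<kappa> \<omega>'
    using hl by (simp add: form_along_line_def form_along_line_axioms_def)
  have "F2.residue_at y 0" if y: "mpoly_eval P y = 0" "F1.simple y" for y
  proof -
    obtain j where j: "j < s" "mpoly_eval (Q j) y = 0" using root_factor[OF y(1)] by blast
    have "F1.residue_at y (c j)" using c[OF j(1) y(2) j(2)] by (simp add: F1.residue_at_iff)
    then obtain \<epsilon>1 where \<epsilon>1: "\<epsilon>1 > 0" "exact_on (ball 0 \<epsilon>1 - {0}) (\<lambda>z w. F1.lf y z w - c j / z * w)"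
      unfolding F1.residue_at_def by blast
    define p where "p = evp (shift u P) y"
    define a where "a = evp (shift u (contract u A0)) y"
    have pd: "poly (pderiv p) 0 = mpoly_eval (mpoly_dd u P) y"
      using F1.poly_pderiv_pol[of y 0] by (simp add: p_def)
    have a0: "poly a 0 = mpoly_eval (contract u A0) y" by (simp add: a_def poly_evp)
    have "\<exists>\<epsilon>>0. exact_on (ball 0 \<epsilon> - {0}) (\<lambda>z w. poly a z / poly p z * w - c j / z * w)"
    proof (rule exact_on_pole_part)
      show "poly p 0 = 0" using y(1) by (simp add: p_def poly_evp)
      show "poly (pderiv p) 0 \<noteq> 0" using dd[OF y(2,1)] by (simp add: pd)
      show "poly a 0 = c j * poly (pderiv p) 0"
        using contract_sum_dlog_at_root[OF j, of u c] by (simp add: pd a0 A0_def)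
    qed
    then obtain \<epsilon>2 where \<epsilon>2: "\<epsilon>2 > 0" "exact_on (ball 0 \<epsilon>2 - {0}) (\<lambda>z w. poly a z / poly p z * w - c j / z * w)"
      by blast
    define \<epsilon> where "\<epsilon> = min \<epsilon>1 \<epsilon>2"
    have e1: "exact_on (ball 0 \<epsilon> - {0}) (\<lambda>z w. F1.lf y z w - c j / z * w)"
      by (rule exact_on_subset[OF \<epsilon>1(2)]) (auto simp: \<epsilon>_def)
    have e2: "exact_on (ball 0 \<epsilon> - {0}) (\<lambda>z w. poly a z / poly p z * w - c j / z * w)"
      by (rule exact_on_subset[OF \<epsilon>2(2)]) (auto simp: \<epsilon>_def)
    have "(\<lambda>z w. (F1.lf y z w - c j / z * w) - (poly a z / poly p z * w - c j / z * w)) = (\<lambda>z w. F2.lf y z w - 0 / z * w)"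
    proof (intro ext)
      fix z w
      have "F2.lf y z w = \<omega>' (y + z *s u) (w *s u)" by (simp only: F2.lf_def)
      also have "\<dots> = F1.lf y z w - poly a z / poly p z * w"
        by (simp add: F1.lf_def \<omega>'_def omega_contract contract_smult_left a_def p_def poly_evp)
      finally show "(F1.lf y z w - c j / z * w) - (poly a z / poly p z * w - c j / z * w) = F2.lf y z w - 0 / z * w"
        by simp
    qed
    with exact_on_diff[OF e1 e2] have "exact_on (ball 0 \<epsilon> - {0}) (\<lambda>z w. F2.lf y z w - 0 / z * w)" by simp
    moreover have "\<epsilon> > 0" using \<epsilon>1(1) \<epsilon>2(1) by (simp add: \<epsilon>_def)
    ultimately show ?thesis unfolding F2.residue_at_def by blast
  qed
  then have "exact_on {x. mpoly_eval P x \<noteq> 0} \<omega>'"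
    by (intro F2.exact_global[OF D]) auto
  then show ?thesis unfolding \<omega>'_def A0_def by blast
qed

text \<open>An exact form has no residues, so the numerator on a generic line vanishes at all roots
  of \<open>pol x\<close>. These are simple, so \<open>pol x\<close> divides the numerator, and
  generic divisibility lifts because the leading coefficient is constant.\<close>

lemma dvd_contract_if_exact:
  assumes u: "good_dir u P" and ex: "exact_on {x. mpoly_eval P x \<noteq> 0} (omega P A)"
  shows "P dvd contract u A"
proof -
  obtain \<kappa> where hl: "hyp_line P u \<kappa>" using lead_const[OF u] .
  interpret hyp_line P u \<kappa> by fact
  obtain D where D: "D \<noteq> 0" "\<And>x. mpoly_eval D x \<noteq> 0 \<Longrightarrow> simple x"
    using discriminant_exists[OF u] unfolding simple_def S_def by blast
  obtain F where F: "primitive_on {x. mpoly_eval P x \<noteq> 0} (omega P A) F" using ex by (auto simp: exact_on_def)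
  have "shift u P dvd shift u (contract u A)"
  proof (rule dvd_if_generic_evp_dvd[OF lead \<kappa> D(1)])
    fix x assume "mpoly_eval D x \<noteq> 0"
    then have simple: "simple x" by (rule D(2))
    have "poly (evp (shift u (contract u A)) x) t = 0" if t: "t \<in> S x" for t
    proof -
      define y where "y = x + t *s u"
      have sy: "simple y" "mpoly_eval P y = 0" using simple t by (auto simp: y_def simple_translate S_def)
      define p where "p = evp (shift u P) y"
      define a where "a = evp (shift u (contract u A)) y"
      have "poly p 0 = 0" using sy(2) by (simp add: p_def poly_evp)
      moreover have "poly (pderiv p) 0 \<noteq> 0"
        using simple_dd_nonzero[OF sy] unfolding p_def poly_pderiv_pol by simp
      ultimately obtain h \<epsilon> where h: "p = [:0, 1:] * h" "poly h 0 = poly (pderiv p) 0" "\<epsilon> > 0" "\<And>z. norm z < \<epsilon> \<Longrightarrow> poly h z \<noteq> 0"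
        using simple_root_factor by blast
      have pz: "poly p z \<noteq> 0" if "z \<in> ball 0 \<epsilon> - {0}" for z using that h(4)[of z] by (simp add: h(1))
      have "primitive_on (ball 0 \<epsilon> - {0}) (\<lambda>z w. omega P A (y + z *s u) (w *s u)) (\<lambda>z. F (y + z *s u))"
      proof (rule primitive_on_pullback[OF F])
        fix z :: complex assume "z \<in> ball 0 \<epsilon> - {0}"
        from pz[OF this] show "y + z *s u \<in> {x. mpoly_eval P x \<noteq> 0} \<and> ((\<lambda>z. y + z *s u) has_derivative (\<lambda>w. w *s u)) (at z)"
          by (auto simp: p_def poly_evp intro!: derivative_eq_intros)
      qed
      \<comment> \<open>Cancelling the simple zero of \<open>p\<close> at 0 shows the form as a
        function holomorphic near 0, divided by z.\<close>
      moreover have "(\<lambda>z w. omega P A (y + z *s u) (w *s u)) = (\<lambda>z w. (poly a z / poly h z) / (z - 0) * w)"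
      proof (intro ext)
        fix z w
        have "omega P A (y + z *s u) (w *s u) = w * poly a z / poly p z"
          by (simp add: omega_contract contract_smult_left a_def p_def poly_evp)
        also have "\<dots> = (poly a z / poly h z) / (z - 0) * w"
          unfolding h(1) by (simp add: mult_ac)
        finally show "omega P A (y + z *s u) (w *s u) = (poly a z / poly h z) / (z - 0) * w" .
      qed
      ultimately have "exact_on (ball 0 \<epsilon> - {0}) (\<lambda>z w. (poly a z / poly h z) / (z - 0) * w)"
        by (auto simp: exact_on_def)
      then have "poly a 0 / poly h 0 = 0"
      proof (rule exact_on_simple_pole[of _ 0 "\<epsilon> / 2", rotated 2])
        show "(\<lambda>z. poly a z / poly h z) holomorphic_on cball 0 (\<epsilon> / 2)"
          using h(3,4) by (auto intro!: holomorphic_intros)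
      qed (use h(3) in auto)
      then have "poly a 0 = 0" using h(3) h(4)[of 0] by simp
      then show ?thesis by (simp add: a_def y_def poly_evp)
    qed
    then have "(\<Prod>t\<in>S x. [:- t, 1:]) dvd evp (shift u (contract u A)) x"
      by (intro prod_roots_dvd) auto
    then show "pol x dvd evp (shift u (contract u A)) x"
      unfolding simple_decompose(1)[OF simple] using \<kappa> by (simp add: smult_dvd_iff)
  qed
  then show ?thesis by (rule dvd_if_shift_dvd)
qed

lemma exact_imp_zero:
  assumes A: "A \<in> F_space P" and ex: "exact_on {x. mpoly_eval P x \<noteq> 0} (omega P A)"
  shows "A = 0"
proof -
  obtain H where H: "H \<noteq> 0" "\<And>u. mpoly_eval H u \<noteq> 0 \<Longrightarrow> good_dir u P"
    using good_dir_exists[OF P_nonzero] by blast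
  obtain u where u: "mpoly_eval H u \<noteq> 0" using mpoly_nonzero_dense[OF H(1), of 1 0] by auto
  have "A $ i = 0" for i
  proof -
    have "mpoly_eval H (u + 0 *s axis i 1) \<noteq> 0" using u by simp
    then have "finite {t. mpoly_eval H (u + t *s axis i 1) = 0}" by (rule evp_shift_eq_0_finite)
    \<comment> \<open>Both u and its translate by t along axis i are to be good directions, with t
      \<noteq> 0; the difference of the two divisibilities isolates t A_i.\<close>
    then obtain t where t: "t \<notin> insert 0 {t. mpoly_eval H (u + t *s axis i 1) = 0}"
      using ex_new_if_finite[OF infinite_UNIV_char_0, of "insert 0 {t. mpoly_eval H (u + t *s axis i 1) = 0}"] by auto
    have 1: "P dvd contract (u + t *s axis i 1) A"
      by (rule dvd_contract_if_exact[OF H(2) ex]) (use t in auto)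
    have 2: "P dvd contract u A" by (rule dvd_contract_if_exact[OF H(2)[OF u] ex])
    have "contract (u + t *s axis i 1) A = contract u A + mpoly_const t * A $ i"
      by (simp add: contract_add_left contract_smult_left contract_axis)
    with 1 2 have "P dvd mpoly_const t * A $ i" by (metis dvd_add_right_iff)
    then have "P dvd mpoly_const (1 / t) * (mpoly_const t * A $ i)" by (rule dvd_mult)
    moreover have "mpoly_const (1 / t) * (mpoly_const t * A $ i) = A $ i"
      using t by (simp add: mult.assoc[symmetric] mult_single)
    ultimately show ?thesis using tuple_component_eq_0[OF P_nonzero A] by simp
  qed
  then show ?thesis by (simp add: vec_eq_iff)
qed

end

lemma omega_add: "omega P (A + B) = (\<lambda>x v. omega P A x v + omega P B x v)"
  for P :: "'n::{finite,linorder} mpoly"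
  by (intro ext) (simp add: omega_contract contract_add add_divide_distrib)

lemma omega_scale: "omega P (tuple_scale c A) = (\<lambda>x v. c * omega P A x v)"
  for P :: "'n::{finite,linorder} mpoly"
  by (intro ext) (simp add: omega_contract contract_scale)

lemma omega_diff: "omega P (A - B) = (\<lambda>x v. omega P A x v - omega P B x v)"
  for P :: "'n::{finite,linorder} mpoly"
proof -
  have "omega P A = (\<lambda>x v. omega P (A - B) x v + omega P B x v)" using omega_add[of P "A - B" B] by simp
  then show ?thesis by simp
qed

theorem theorem3p3:
  fixes P :: "'n::{finite,linorder} mpoly" and Q :: "nat \<Rightarrow> 'n mpoly" and s :: nat
  assumes "CARD('n) \<ge> 2"
    and "\<not> (\<exists>c. P = mpoly_const c)"
    and "reduced_mpoly P"
    and "irreducible_factorization P s Q"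
  shows "tuples.subspace (F_space P) \<and>
    (\<forall>A\<in>F_space P. \<forall>B\<in>F_space P. T_map P (A + B) = derham_add (T_map P A) (T_map P B)) \<and>
    (\<forall>c. \<forall>A\<in>F_space P. T_map P (tuple_scale c A) = derham_scale (hyp_compl P) c (T_map P A)) \<and>
    bij_betw (T_map P) (F_space P) (derham_H1 (hyp_compl P)) \<and>
    tuples.dim (F_space P) = s"
proof -
  interpret factorization P Q s using assms by unfold_locales
  have M: "hyp_compl P = {x. mpoly_eval P x \<noteq> 0}" by (simp add: hyp_compl_def)
  have sub: "tuples.subspace (F_space P)" by (rule subspace_F_space[OF P_nonzero])
  have add: "T_map P (A + B) = derham_add (T_map P A) (T_map P B)" for A B
    unfolding T_map_def omega_add derham_class_add[OF open_hyp_compl] ..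
  have scale: "T_map P (tuple_scale c A) = derham_scale (hyp_compl P) c (T_map P A)" for c A
    unfolding T_map_def omega_scale derham_class_scale[OF open_hyp_compl] ..
  have closed: "omega P A \<in> closed_forms1 (hyp_compl P)" if "A \<in> F_space P" for A
    using that by (intro omega_closed) (simp add: F_space_iff[OF P_nonzero])
  have inj: "A = B" if AB: "A \<in> F_space P" "B \<in> F_space P" and eq: "T_map P A = T_map P B" for A B
  proof -
    have "omega P (A - B) \<in> exact_forms1 (hyp_compl P)"
      using eq unfolding T_map_def derham_class_eq_iff[OF open_hyp_compl] omega_diff .
    then have "exact_on {x. mpoly_eval P x \<noteq> 0} (omega P (A - B))"
      using exact_forms1_imp_exact_on unfolding M by blast
    moreover have "A - B \<in> F_space P" using tuples.subspace_diff[OF sub AB] .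
    ultimately show ?thesis using exact_imp_zero[of "A - B"] by simp
  qed
  obtain H where H: "H \<noteq> 0" "\<And>u. mpoly_eval H u \<noteq> 0 \<Longrightarrow> good_dir u P"
    using good_dir_exists[OF P_nonzero] by blast
  obtain u where "mpoly_eval H u \<noteq> 0" using mpoly_nonzero_dense[OF H(1), of 1 0] by auto
  then have u: "good_dir u P" by (rule H(2))
  have dlog: "dlog_tuple s Q k \<in> F_space P" if "k < s" for k
    by (rule dlog_tuple_in_F_space[OF P_eq P_nonzero that])
  have comb: "(\<Sum>k<s. tuple_scale (c k) (dlog_tuple s Q k)) \<in> F_space P" for c
    using dlog by (intro tuples.subspace_sum[OF sub] tuples.subspace_scale[OF sub]) auto
  have surj: "\<exists>c. derham_class (hyp_compl P) \<omega> = T_map P (\<Sum>k<s. tuple_scale (c k) (dlog_tuple s Q k))"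
    if \<omega>: "\<omega> \<in> closed_forms1 (hyp_compl P)" for \<omega>
  proof -
    have "loc_exact {x. mpoly_eval P x \<noteq> 0} \<omega>"
      using closed_form_loc_exact[OF open_hyp_compl \<omega>] by (simp add: M)
    from exact_modulo_dlog[OF u this] obtain c where
      c: "exact_on (hyp_compl P) (\<lambda>x v. \<omega> x v - omega P (\<Sum>k<s. tuple_scale (c k) (dlog_tuple s Q k)) x v)"
      unfolding M by blast
    let ?A = "\<Sum>k<s. tuple_scale (c k) (dlog_tuple s Q k)"
    have sm: "smooth_on (\<lambda>x. \<omega> x v) (hyp_compl P)" "smooth_on (\<lambda>x. omega P ?A x v) (hyp_compl P)" for v
      using \<omega> closed[OF comb] by (auto simp: closed_forms1_def smooth_forms1_def)
    have out: "\<omega> x v = 0" "omega P ?A x v = 0" if "x \<notin> hyp_compl P" for x v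
      using \<omega> closed[OF comb] that by (auto simp: closed_forms1_def smooth_forms1_def)
    have "(\<lambda>x v. \<omega> x v - omega P ?A x v) \<in> exact_forms1 (hyp_compl P)"
    proof (rule exact_on_imp_exact_forms1[OF open_hyp_compl _ _ c])
      show "smooth_on (\<lambda>x. \<omega> x v - omega P ?A x v) (hyp_compl P)" for v
        using smooth_on_lincomb[OF open_hyp_compl sm, of v "-1" v] by simp
    qed (simp add: out)
    then show ?thesis unfolding T_map_def derham_class_eq_iff[OF open_hyp_compl] by blast
  qed
  have bij: "bij_betw (T_map P) (F_space P) (derham_H1 (hyp_compl P))"
    unfolding bij_betw_def
  proof (intro conjI inj_onI equalityI subsetI)
    show "C \<in> derham_H1 (hyp_compl P)" if "C \<in> T_map P ` F_space P" for C
      using that closed by (auto simp: derham_H1_def T_map_def)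
    show "C \<in> T_map P ` F_space P" if "C \<in> derham_H1 (hyp_compl P)" for C
    proof -
      obtain \<omega> where "\<omega> \<in> closed_forms1 (hyp_compl P)" "C = derham_class (hyp_compl P) \<omega>"
        using \<open>C \<in> derham_H1 (hyp_compl P)\<close> by (auto simp: derham_H1_def)
      with surj[of \<omega>] comb show ?thesis by blast
    qed
  qed (rule inj)
  obtain \<kappa> where hl: "hyp_line P u \<kappa>" using lead_const[OF u] .
  interpret hyp_line P u \<kappa> by fact
  obtain D where D: "D \<noteq> 0" "\<And>x. mpoly_eval D x \<noteq> 0 \<Longrightarrow> simple x"
    using discriminant_exists[OF u] unfolding simple_def S_def by blast
  \<comment> \<open>At a simple zero of Q_j the numerator of the combination is c_j times a nonzero
    number, so the coefficient can be read off.\<close>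
  have indep: "c j = 0" if c: "(\<Sum>k<s. tuple_scale (c k) (dlog_tuple s Q k)) = 0" and j: "j < s" for c j
  proof -
    obtain y where y: "simple y" "mpoly_eval (Q j) y = 0" using simple_root_exists[OF hl D j] by blast
    have "mpoly_eval P y = 0" unfolding P_cof[OF j] using y(2) by simp
    then have "mpoly_eval (mpoly_dd u P) y \<noteq> 0"
      by (rule simple_dd_nonzero[OF y(1)])
    moreover have "c j * mpoly_eval (mpoly_dd u P) y = 0"
      using contract_sum_dlog_at_root[OF j y(2), of u c] by (simp add: c)
    ultimately show ?thesis by simp
  qed
  have inj_dlog: "inj_on (dlog_tuple s Q) {..<s}"
  proof (rule inj_onI, rule ccontr)
    fix i j assume ij: "i \<in> {..<s}" "j \<in> {..<s}" "dlog_tuple s Q i = dlog_tuple s Q j" "i \<noteq> j"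
    \<comment> \<open>Two equal members of the family would give a linear relation with coefficients
      1 and -1.\<close>
    define c where "c = (\<lambda>k. if k = i then 1 else if k = j then -1 else 0 :: complex)"
    have "(\<Sum>k<s. tuple_scale (c k) (dlog_tuple s Q k)) =
       tuple_scale (c i) (dlog_tuple s Q i) + (tuple_scale (c j) (dlog_tuple s Q j) + (\<Sum>k\<in>{..<s} - {i} - {j}. tuple_scale (c k) (dlog_tuple s Q k)))"
      using ij by (subst sum.remove[of "{..<s}" i], simp, simp, subst sum.remove[of "{..<s} - {i}" j]) simp_all
    also have "(\<Sum>k\<in>{..<s} - {i} - {j}. tuple_scale (c k) (dlog_tuple s Q k)) = 0"
      by (intro sum.neutral) (auto simp: c_def)
    finally have "(\<Sum>k<s. tuple_scale (c k) (dlog_tuple s Q k)) = 0"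
      using ij by (simp add: c_def)
    from indep[OF this, of i] ij show False by (simp add: c_def)
  qed
  have "tuples.dim (F_space P) = s"
  proof (rule tuples.dim_unique)
    let ?B = "dlog_tuple s Q ` {..<s}"
    show "?B \<subseteq> F_space P" using dlog by auto
    show "card ?B = s" using card_image[OF inj_dlog] by simp
    show "F_space P \<subseteq> tuples.span ?B"
    proof
      fix A assume A: "A \<in> F_space P"
      \<comment> \<open>Surjectivity provides a combination of logarithmic tuples with the same
        class as \<open>A\<close>; injectivity makes it equal to \<open>A\<close>.\<close>
      obtain c where "T_map P A = T_map P (\<Sum>k<s. tuple_scale (c k) (dlog_tuple s Q k))"
        using surj[OF closed[OF A]] unfolding T_map_def by blast
      then have eq: "A = (\<Sum>k<s. tuple_scale (c k) (dlog_tuple s Q k))"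
        by (rule inj[OF A comb])
      show "A \<in> tuples.span ?B"
        unfolding eq by (rule tuples.span_sum, rule tuples.span_scale, rule tuples.span_base) simp
    qed
    show "\<not> tuples.dependent ?B"
    proof
      assume "tuples.dependent ?B"
      then obtain c v where v: "v \<in> ?B" "c v \<noteq> 0" and c: "(\<Sum>v\<in>?B. tuple_scale (c v) v) = 0"
        by (subst (asm) tuples.dependent_finite) auto
      have "(\<Sum>k<s. tuple_scale (c (dlog_tuple s Q k)) (dlog_tuple s Q k)) = 0"
        using c by (simp add: sum.reindex[OF inj_dlog])
      from indep[OF this] v show False by auto
    qed
  qed
  with sub add scale bij show ?thesis by blast
qed

end
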